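(* Let $D$ be a central division algebra of degree $d$ over a local field $K$, and let $r\in \mathbf{N}$. The map $$B_{0}(rd)\to \mathcal{I}^{0,rd}\colon [(g,x)]\mapsto [(p_{rd}(g),x)]^{0,rd}$$ (where points of $B_0(rd)$ are represented by pairs $(g,x)$ with $g\in P_0$ and $x\in[-\omega(\pi_D^{rd}),\omega(\pi_D^{rd})]$) is a well-defined bijection, equivariant with respect to the homomorphism $p_{rd}\colon P_{0}\to P_{0}^{0,rd}$.
   Context: $K$ is a non-archimedean local field, $D$ a central division algebra over $K$ with $\dim_K D=d^2$; $\mathcal{O}_D,\mathfrak{m}_D,\pi_D$ are its ring of integers, maximal ideal and a uniformiser (similarly for other fields), and $\omega$ the (real-valued) valuation on $D$. $\mathrm{SL}_2(D)$ is the group of $2\times2$ matrices over $D$ of reduced norm $1$. For matrices, $\omega(g)\ge m$ means $\omega(g_{ij})\ge m_{ij}$ for all $i,j$. Bruhat--Tits tree of $\mathrm{SL}_2(D)$. For $x\in\mathbf{R}$ let $P_x=\{g\in\mathrm{SL}_2(D)\mid \omega(g)\ge\begin{pmatrix} 0 & -x \\ x & 0 \end{pmatrix}\}$; in particular $P_0=\mathrm{SL}_2(\mathcal{O}_D)$. Let $T=\{\begin{pmatrix} x & 0 \\ 0 & x^{-1} \end{pmatrix}\mid x\in D^\times\}$, $M=\{\begin{pmatrix} 0 & -x \\ x^{-1} & 0 \end{pmatrix}\mid x\in D^\times\}$, $N=T\sqcup M$, and let $\nu\colon N\to\mathrm{Aff}(\mathbf{R})$ send $\begin{pmatrix} 0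 & -x \\ x^{-1} & 0 \end{pmatrix}$ to the reflection through $-\omega(x)$ and $\begin{pmatrix} x & 0 \\ 0 & x^{-1} \end{pmatrix}$ to the translation by $-2\omega(x)$. On $\mathrm{SL}_2(D)\times\mathbf{R}$ put $(g,x)\sim(h,y)$ iff there is $n\in N$ with $\nu(n)(x)=y$ and $g^{-1}hn\in P_x$. Then $\mathcal{I}=\mathrm{SL}_2(D)\times\mathbf{R}/\!\sim$, with classes $[(g,x)]$, and $\mathrm{SL}_2(D)$ acts by left multiplication on the first component. $\mathcal{I}$ carries an $\mathrm{SL}_2(D)$-invariant metric restricting on each apartment $\{[(g,x)]\mid x\in\mathbf{R}\}$ to the metric of $\mathbf{R}$, scaled so that $0$ and $\omega(\pi_D)$ are at distance $1$. $B_0(rd)$ is the closed ball of radius $rd$ around $[(\mathrm{Id},0)]$; equivalently $B_0(rd)=\{[(g,x)]\mid g\in P_0,\ x\in[-\omega(\pi_D^{rd}),\omega(\pi_D^{rd})]\}$. Local version. Write $D=\bigoplus_{i=0}^{d-1}u^iE$, a cyclic algebra with $E/K$ unramified of degree $d$, $u^d=\pi_K$ and $u^{-1}xu=\tau(x)$ ($x\in E$) for a generator $\tau$ of $\mathrm{Gal}(E/K)$. Left multiplication on the right $E$-vector space $D$ with basis $1,u,\dots,u^{d-1}$ gives an embedding $\varphi\colon D\to M_d(E)$, mapping $\mathcal{O}_D=\bigoplus u^i\mathcal{O}_E$ into $M_d(\mathcal{O}_E)$ and inducing $\overline{\varphi}\colon\mathcal{O}_D/\mathfrak{m}_D^{rd}\hookrightarrow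 M_d(\mathcal{O}_E/\mathfrak{m}_E^r)$. Then $\mathrm{SL}_2(\mathcal{O}_D/\mathfrak{m}_D^{rd})$ is the group of $2\times2$ matrices $(g_{ij})$ over $\mathcal{O}_D/\mathfrak{m}_D^{rd}$ such that the $2d\times2d$ matrix $(\overline{\varphi}(g_{ij}))$ has determinant $1$. The valuation induces a map $\omega$ on $\mathcal{O}_D/\mathfrak{m}_D^{rd}$ (with $\omega(0)=\infty$). For $x\in[-\omega(\pi_D^{rd}),\omega(\pi_D^{rd})]$ let $P_x^{0,rd}=\{g\in\mathrm{SL}_2(\mathcal{O}_D/\mathfrak{m}_D^{rd})\mid\omega(g)\ge\begin{pmatrix} 0 & -x \\ x & 0 \end{pmatrix}\}$. Let $H^{0,rd}$ (resp. $M^{0,rd}$) be the set of matrices $\begin{pmatrix} x & 0 \\ 0 & x^{-1} \end{pmatrix}$ (resp. $\begin{pmatrix} 0 & -x \\ x^{-1} & 0 \end{pmatrix}$) in $\mathrm{SL}_2(\mathcal{O}_D/\mathfrak{m}_D^{rd})$ with $\omega(x)=0$, and $N^{0,rd}=H^{0,rd}\sqcup M^{0,rd}$; $\nu$ sends elements of $H^{0,rd}$ to the identity of $\mathbf{R}$ and elements of $M^{0,rd}$ to the reflection through $0$. On $P_0^{0,rd}\times[-\omega(\pi_D^{rd}),\omega(\pi_D^{rd})]$ put $(g,x)\sim_{0,rd}(h,y)$ iff there is $n\in N^{0,rd}$ with $\nu(n)(x)=y$ and $g^{-1}hn\in P_x^{0,rd}$. $\mathcal{I}^{0,rd}$ is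 the quotient, with classes $[(g,x)]^{0,rd}$, on which $P_0^{0,rd}$ acts by left multiplication on the first component. $p_{rd}\colon P_0=\mathrm{SL}_2(\mathcal{O}_D)\to P_0^{0,rd}=\mathrm{SL}_2(\mathcal{O}_D/\mathfrak{m}_D^{rd})$ is induced by reduction of coefficients. *)

theory Defs
  imports
    "HOL-Algebra.Algebra"
    "HOL-Combinatorics.Permutations"
    "HOL-Library.Extended_Real"
    "HOL-Analysis.Abstract_Metric_Spaces"
begin

section \<open>Valued division rings and local fields\<close>

locale skew_field = ring D for D :: "('a, 'b) ring_scheme" (structure) +
  assumes one_neq_zero: "\<one> \<noteq> \<zero>"
    and nonzero_Units: "Units D = carrier D - {\<zero>}"

locale valued_skew_field = skew_field D for D :: "('a, 'b) ring_scheme" (structure) +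
  fixes \<omega> :: "'a \<Rightarrow> ereal"
  assumes val_eq_infinity_iff: "x \<in> carrier D \<Longrightarrow> \<omega> x = \<infinity> \<longleftrightarrow> x = \<zero>"
    and val_neq_minus_infinity: "x \<in> carrier D \<Longrightarrow> \<omega> x \<noteq> -\<infinity>"
    and val_mult: "\<lbrakk>x \<in> carrier D; y \<in> carrier D\<rbrakk> \<Longrightarrow> \<omega> (x \<otimes> y) = \<omega> x + \<omega> y"
    and val_add: "\<lbrakk>x \<in> carrier D; y \<in> carrier D\<rbrakk> \<Longrightarrow> min (\<omega> x) (\<omega> y) \<le> \<omega> (x \<oplus> y)"

text \<open>In the following, \<open>A\<close> is the carrier of a division subring of \<open>D\<close>; it is used
  with \<open>A\<close> one of \<open>K\<close>, \<open>E\<close> and \<open>carrier D\<close>.\<close>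

definition val_ring :: "('a, 'b) ring_scheme \<Rightarrow> ('a \<Rightarrow> ereal) \<Rightarrow> 'a set \<Rightarrow> ('a, 'b) ring_scheme"
  where "val_ring D \<omega> A = D\<lparr>carrier := {x \<in> A. 0 \<le> \<omega> x}\<rparr>"

definition val_ideal :: "('a \<Rightarrow> ereal) \<Rightarrow> 'a set \<Rightarrow> 'a set"
  where "val_ideal \<omega> A = {x \<in> A. 0 < \<omega> x}"

definition uniformiser :: "('a \<Rightarrow> ereal) \<Rightarrow> 'a set \<Rightarrow> 'a \<Rightarrow> bool"
  where "uniformiser \<omega> A p \<longleftrightarrow> p \<in> val_ideal \<omega> A \<and> \<omega> p \<noteq> \<infinity> \<and> (\<forall>x \<in> val_ideal \<omega> A. \<omega> p \<le> \<omega> x)"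

definition val_complete :: "('a, 'b) ring_scheme \<Rightarrow> ('a \<Rightarrow> ereal) \<Rightarrow> 'a set \<Rightarrow> bool"
  where "val_complete D \<omega> A \<longleftrightarrow>
    (\<forall>s :: nat \<Rightarrow> 'a. (\<forall>n. s n \<in> A) \<longrightarrow>
      (\<forall>B :: real. \<exists>n0. \<forall>m \<ge> n0. \<forall>n \<ge> n0. ereal B \<le> \<omega> (s m \<ominus>\<^bsub>D\<^esub> s n)) \<longrightarrow>
      (\<exists>l \<in> A. \<forall>B :: real. \<exists>n0. \<forall>n \<ge> n0. ereal B \<le> \<omega> (s n \<ominus>\<^bsub>D\<^esub> l)))"

text \<open>The valuation on \<open>K\<close> is the restriction of \<open>\<omega>\<close>; discreteness and non-triviality of
  this restriction are expressed by the existence of a uniformiser.\<close>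

definition local_subfield :: "('a, 'b) ring_scheme \<Rightarrow> ('a \<Rightarrow> ereal) \<Rightarrow> 'a set \<Rightarrow> bool"
  where "local_subfield D \<omega> K \<longleftrightarrow>
    subfield K D \<and> (\<exists>p. uniformiser \<omega> K p) \<and> val_complete D \<omega> K \<and>
    finite (carrier (val_ring D \<omega> K Quot val_ideal \<omega> K))"

definition ring_centre :: "('a, 'b) ring_scheme \<Rightarrow> 'a set"
  where "ring_centre D = {z \<in> carrier D. \<forall>x \<in> carrier D. z \<otimes>\<^bsub>D\<^esub> x = x \<otimes>\<^bsub>D\<^esub> z}"

locale local_division_algebra = valued_skew_field D \<omega>
  for D :: "('a, 'b) ring_scheme" (structure) and \<omega> :: "'a \<Rightarrow> ereal" +
  fixes K :: "'a set" and d :: nat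
  assumes local_field: "local_subfield D \<omega> K"
    and central: "ring_centre D = K"
    and dimension_over_centre: "dimension (d\<^sup>2) K (carrier D)"


section \<open>Presentation as a cyclic algebra\<close>

definition galois_group :: "('a, 'b) ring_scheme \<Rightarrow> 'a set \<Rightarrow> 'a set \<Rightarrow> ('a \<Rightarrow> 'a) monoid"
  where "galois_group D E K =
    BijGroup E \<lparr>carrier :=
      {\<sigma> \<in> Bij E. \<sigma> \<in> ring_hom (D\<lparr>carrier := E\<rparr>) (D\<lparr>carrier := E\<rparr>) \<and> (\<forall>x \<in> K. \<sigma> x = x)}\<rparr>"

text \<open>Residue fields are finite, so residue extensions are separable and \<open>E\<close> is unramified
  over \<open>K\<close> as soon as both have the same value group.\<close>

locale cyclic_local_division_algebra = local_division_algebra D \<omega> K d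
  for D :: "('a, 'b) ring_scheme" (structure) and \<omega> :: "'a \<Rightarrow> ereal" and K :: "'a set" and d :: nat +
  fixes E :: "'a set" and \<tau> :: "'a \<Rightarrow> 'a" and u \<pi>\<^sub>K :: 'a
  assumes E_subfield: "subfield E D" and K_subset_E: "K \<subseteq> E"
    and E_degree: "dimension d K E"
    and E_unramified: "\<omega> ` (E - {\<zero>}) = \<omega> ` (K - {\<zero>})"
    and \<tau>_in_galois_group: "\<tau> \<in> carrier (galois_group D E K)"
    and \<tau>_generates: "generate (galois_group D E K) {\<tau>} = carrier (galois_group D E K)"
    and uniformiser_K: "uniformiser \<omega> K \<pi>\<^sub>K"
    and u_closed: "u \<in> carrier D" and u_nonzero: "u \<noteq> \<zero>"
    and u_pow: "u [^] d = \<pi>\<^sub>K"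
    and u_conj: "x \<in> E \<Longrightarrow> inv u \<otimes> x \<otimes> u = \<tau> x"
    and direct_sum: "x \<in> carrier D \<Longrightarrow>
      \<exists>!c. c \<in> {..<d} \<rightarrow>\<^sub>E E \<and> x = (\<Oplus>i\<in>{..<d}. u [^] i \<otimes> c i)"

definition coords :: "('a, 'b) ring_scheme \<Rightarrow> 'a set \<Rightarrow> 'a \<Rightarrow> nat \<Rightarrow> 'a \<Rightarrow> nat \<Rightarrow> 'a"
  where "coords D E u d x =
    (THE c. c \<in> {..<d} \<rightarrow>\<^sub>E E \<and> x = (\<Oplus>\<^bsub>D\<^esub>i\<in>{..<d}. u [^]\<^bsub>D\<^esub> i \<otimes>\<^bsub>D\<^esub> c i))"

text \<open>The \<open>d \<times> d\<close> matrix over \<open>E\<close> of left multiplication by \<open>a\<close> with respect to the basis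
  \<open>1, u, \<dots>, u\<^sup>d\<^sup>-\<^sup>1\<close> of the right \<open>E\<close>-vector space \<open>D\<close>. Rows and columns are numbered from \<open>0\<close>.\<close>

definition phi :: "('a, 'b) ring_scheme \<Rightarrow> 'a set \<Rightarrow> 'a \<Rightarrow> nat \<Rightarrow> 'a \<Rightarrow> nat \<Rightarrow> nat \<Rightarrow> 'a"
  where "phi D E u d a i j = coords D E u d (a \<otimes>\<^bsub>D\<^esub> u [^]\<^bsub>D\<^esub> j) i"


section \<open>Matrices\<close>

definition ring_det :: "('a, 'b) ring_scheme \<Rightarrow> nat \<Rightarrow> (nat \<Rightarrow> nat \<Rightarrow> 'a) \<Rightarrow> 'a"
  where "ring_det R n A =
    (\<Oplus>\<^bsub>R\<^esub>p\<in>{p. p permutes {..<n}}.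
       (if evenperm p then \<one>\<^bsub>R\<^esub> else \<ominus>\<^bsub>R\<^esub> \<one>\<^bsub>R\<^esub>) \<otimes>\<^bsub>R\<^esub> (\<Otimes>\<^bsub>R\<^esub>i\<in>{..<n}. A i (p i)))"

datatype 'a mat2 = Mat2 (m11: 'a) (m12: 'a) (m21: 'a) (m22: 'a)

definition mat2_monoid :: "('a, 'b) ring_scheme \<Rightarrow> 'a mat2 monoid"
  where "mat2_monoid R =
    \<lparr>carrier = {g. set_mat2 g \<subseteq> carrier R},
     monoid.mult = (\<lambda>g h. Mat2
       (m11 g \<otimes>\<^bsub>R\<^esub> m11 h \<oplus>\<^bsub>R\<^esub> m12 g \<otimes>\<^bsub>R\<^esub> m21 h) (m11 g \<otimes>\<^bsub>R\<^esub> m12 h \<oplus>\<^bsub>R\<^esub> m12 g \<otimes>\<^bsub>R\<^esub> m22 h)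
       (m21 g \<otimes>\<^bsub>R\<^esub> m11 h \<oplus>\<^bsub>R\<^esub> m22 g \<otimes>\<^bsub>R\<^esub> m21 h) (m21 g \<otimes>\<^bsub>R\<^esub> m12 h \<oplus>\<^bsub>R\<^esub> m22 g \<otimes>\<^bsub>R\<^esub> m22 h)),
     one = Mat2 \<one>\<^bsub>R\<^esub> \<zero>\<^bsub>R\<^esub> \<zero>\<^bsub>R\<^esub> \<one>\<^bsub>R\<^esub>\<rparr>"

text \<open>The \<open>2d \<times> 2d\<close> matrix obtained by replacing every entry of \<open>g\<close> by its image under \<open>F\<close>,
  a \<open>d \<times> d\<close> matrix.\<close>

definition block_mat :: "('a \<Rightarrow> nat \<Rightarrow> nat \<Rightarrow> 'c) \<Rightarrow> nat \<Rightarrow> 'a mat2 \<Rightarrow> nat \<Rightarrow> nat \<Rightarrow> 'c"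
  where "block_mat F d g i j =
    (if i < d then (if j < d then F (m11 g) i j else F (m12 g) i (j - d))
     else (if j < d then F (m21 g) (i - d) j else F (m22 g) (i - d) (j - d)))"

definition val_ge :: "('a \<Rightarrow> ereal) \<Rightarrow> 'a mat2 \<Rightarrow> real \<Rightarrow> bool"
  where "val_ge v g x \<longleftrightarrow>
    0 \<le> v (m11 g) \<and> ereal (- x) \<le> v (m12 g) \<and> ereal x \<le> v (m21 g) \<and> 0 \<le> v (m22 g)"

definition point_stab :: "'a mat2 monoid \<Rightarrow> ('a \<Rightarrow> ereal) \<Rightarrow> real \<Rightarrow> 'a mat2 set"
  where "point_stab G v x = {g \<in> carrier G. val_ge v g x}"


section \<open>The Bruhat--Tits tree\<close>

text \<open>Scalar extension to \<open>E\<close> turns \<open>\<phi>\<close> into an isomorphism of \<open>D \<otimes>\<^sub>K E\<close> with the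
  \<open>d \<times> d\<close> matrices over \<open>E\<close>; the reduced norm of a \<open>2 \<times> 2\<close> matrix over \<open>D\<close> is the determinant
  of its image in this splitting.\<close>

definition reduced_norm :: "('a, 'b) ring_scheme \<Rightarrow> 'a set \<Rightarrow> 'a \<Rightarrow> nat \<Rightarrow> 'a mat2 \<Rightarrow> 'a"
  where "reduced_norm D E u d g = ring_det (D\<lparr>carrier := E\<rparr>) (2 * d) (block_mat (phi D E u d) d g)"

definition SL2 :: "('a, 'b) ring_scheme \<Rightarrow> 'a set \<Rightarrow> 'a \<Rightarrow> nat \<Rightarrow> 'a mat2 monoid"
  where "SL2 D E u d = (mat2_monoid D)\<lparr>carrier :=
    {g \<in> carrier (mat2_monoid D). reduced_norm D E u d g = \<one>\<^bsub>D\<^esub>}\<rparr>"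

definition torus :: "('a, 'b) ring_scheme \<Rightarrow> 'a mat2 set"
  where "torus D = {Mat2 x \<zero>\<^bsub>D\<^esub> \<zero>\<^bsub>D\<^esub> (inv\<^bsub>D\<^esub> x) | x. x \<in> carrier D - {\<zero>\<^bsub>D\<^esub>}}"

definition antitorus :: "('a, 'b) ring_scheme \<Rightarrow> 'a mat2 set"
  where "antitorus D = {Mat2 \<zero>\<^bsub>D\<^esub> (\<ominus>\<^bsub>D\<^esub> x) (inv\<^bsub>D\<^esub> x) \<zero>\<^bsub>D\<^esub> | x. x \<in> carrier D - {\<zero>\<^bsub>D\<^esub>}}"

text \<open>On \<open>antitorus D\<close> the entry \<open>m12 n\<close> is \<open>-x\<close>, which has the valuation of \<open>x\<close>, and the
  reflection through \<open>-\<omega>(x)\<close> is \<open>t \<mapsto> 2 (-\<omega>(x)) - t\<close>.\<close>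

definition nu :: "('a, 'b) ring_scheme \<Rightarrow> ('a \<Rightarrow> ereal) \<Rightarrow> 'a mat2 \<Rightarrow> real \<Rightarrow> real"
  where "nu D \<omega> n =
    (if n \<in> torus D then (\<lambda>t. t - 2 * real_of_ereal (\<omega> (m11 n)))
     else (\<lambda>t. 2 * (- real_of_ereal (\<omega> (m12 n))) - t))"

definition tree_rel ::
  "('a, 'b) ring_scheme \<Rightarrow> ('a \<Rightarrow> ereal) \<Rightarrow> 'a set \<Rightarrow> 'a \<Rightarrow> nat \<Rightarrow> (('a mat2 \<times> real) \<times> ('a mat2 \<times> real)) set"
  where "tree_rel D \<omega> E u d = (let G = SL2 D E u d in
    {((g, x), (h, y)). g \<in> carrier G \<and> h \<in> carrier G \<and>
      (\<exists>n \<in> torus D \<union> antitorus D. nu D \<omega> n x = y \<and>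
        inv\<^bsub>G\<^esub> g \<otimes>\<^bsub>G\<^esub> h \<otimes>\<^bsub>G\<^esub> n \<in> point_stab G \<omega> x)})"

definition tree ::
  "('a, 'b) ring_scheme \<Rightarrow> ('a \<Rightarrow> ereal) \<Rightarrow> 'a set \<Rightarrow> 'a \<Rightarrow> nat \<Rightarrow> ('a mat2 \<times> real) set set"
  where "tree D \<omega> E u d = (carrier (SL2 D E u d) \<times> UNIV) // tree_rel D \<omega> E u d"

definition tree_pt ::
  "('a, 'b) ring_scheme \<Rightarrow> ('a \<Rightarrow> ereal) \<Rightarrow> 'a set \<Rightarrow> 'a \<Rightarrow> nat \<Rightarrow> 'a mat2 \<Rightarrow> real \<Rightarrow> ('a mat2 \<times> real) set"
  where "tree_pt D \<omega> E u d g x = tree_rel D \<omega> E u d `` {(g, x)}"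

text \<open>Left multiplication on the first component, applied to all members of a class; it is used
  for both trees below.\<close>

definition left_act :: "'a mat2 monoid \<Rightarrow> 'a mat2 \<Rightarrow> ('a mat2 \<times> real) set \<Rightarrow> ('a mat2 \<times> real) set"
  where "left_act G k C = (\<lambda>(g, x). (k \<otimes>\<^bsub>G\<^esub> g, x)) ` C"

text \<open>The metric on the tree is determined by these properties, because any two points lie in
  a common apartment. The scale is \<open>s\<close>, the real length that is to have distance \<open>1\<close>.\<close>

definition tree_metric ::
  "('a, 'b) ring_scheme \<Rightarrow> ('a \<Rightarrow> ereal) \<Rightarrow> 'a set \<Rightarrow> 'a \<Rightarrow> nat \<Rightarrow> real \<Rightarrow>
    (('a mat2 \<times> real) set \<Rightarrow> ('a mat2 \<times> real) set \<Rightarrow> real) \<Rightarrow> bool"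
  where "tree_metric D \<omega> E u d s \<delta> \<longleftrightarrow>
    Metric_space (tree D \<omega> E u d) \<delta> \<and>
    (\<forall>k \<in> carrier (SL2 D E u d). \<forall>p \<in> tree D \<omega> E u d. \<forall>q \<in> tree D \<omega> E u d.
      \<delta> (left_act (SL2 D E u d) k p) (left_act (SL2 D E u d) k q) = \<delta> p q) \<and>
    (\<forall>g \<in> carrier (SL2 D E u d). \<forall>x y.
      \<delta> (tree_pt D \<omega> E u d g x) (tree_pt D \<omega> E u d g y) = \<bar>x - y\<bar> / s)"

definition tree_ball ::
  "('a, 'b) ring_scheme \<Rightarrow> ('a \<Rightarrow> ereal) \<Rightarrow> 'a set \<Rightarrow> 'a \<Rightarrow> nat \<Rightarrow>
    (('a mat2 \<times> real) set \<Rightarrow> ('a mat2 \<times> real) set \<Rightarrow> real) \<Rightarrow> real \<Rightarrow> ('a mat2 \<times> real) set set"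
  where "tree_ball D \<omega> E u d \<delta> \<rho> =
    Metric_space.mcball (tree D \<omega> E u d) \<delta> (tree_pt D \<omega> E u d \<one>\<^bsub>SL2 D E u d\<^esub> 0) \<rho>"

definition P0 :: "('a, 'b) ring_scheme \<Rightarrow> ('a \<Rightarrow> ereal) \<Rightarrow> 'a set \<Rightarrow> 'a \<Rightarrow> nat \<Rightarrow> 'a mat2 monoid"
  where "P0 D \<omega> E u d = (SL2 D E u d)\<lparr>carrier := point_stab (SL2 D E u d) \<omega> 0\<rparr>"


section \<open>The local version\<close>

definition val_ideal_pow ::
  "('a, 'b) ring_scheme \<Rightarrow> ('a \<Rightarrow> ereal) \<Rightarrow> 'a set \<Rightarrow> nat \<Rightarrow> 'a set"
  where "val_ideal_pow D \<omega> A k = val_ideal \<omega> A [^]\<^bsub>ideals_set (val_ring D \<omega> A)\<^esub> k"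

definition trunc_ring ::
  "('a, 'b) ring_scheme \<Rightarrow> ('a \<Rightarrow> ereal) \<Rightarrow> 'a set \<Rightarrow> nat \<Rightarrow> 'a set ring"
  where "trunc_ring D \<omega> A k = val_ring D \<omega> A Quot val_ideal_pow D \<omega> A k"

definition trunc ::
  "('a, 'b) ring_scheme \<Rightarrow> ('a \<Rightarrow> ereal) \<Rightarrow> 'a set \<Rightarrow> nat \<Rightarrow> 'a \<Rightarrow> 'a set"
  where "trunc D \<omega> A k x = val_ideal_pow D \<omega> A k +>\<^bsub>val_ring D \<omega> A\<^esub> x"

text \<open>\<open>\<omega>\<close> is constant on non-zero classes, and the class of \<open>\<phi>(a)\<^sub>i\<^sub>j\<close> depends only on the class of
  \<open>a\<close>, so \<^const>\<open>the_elem\<close> below is applied to singletons.\<close>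

definition trunc_val ::
  "('a, 'b) ring_scheme \<Rightarrow> ('a \<Rightarrow> ereal) \<Rightarrow> 'a set \<Rightarrow> nat \<Rightarrow> 'a set \<Rightarrow> ereal"
  where "trunc_val D \<omega> A k C =
    (if C = \<zero>\<^bsub>trunc_ring D \<omega> A k\<^esub> then \<infinity> else the_elem (\<omega> ` C))"

definition phi_bar ::
  "('a, 'b) ring_scheme \<Rightarrow> ('a \<Rightarrow> ereal) \<Rightarrow> 'a set \<Rightarrow> 'a \<Rightarrow> nat \<Rightarrow> nat \<Rightarrow> 'a set \<Rightarrow> nat \<Rightarrow> nat \<Rightarrow> 'a set"
  where "phi_bar D \<omega> E u d r C i j = the_elem ((\<lambda>a. trunc D \<omega> E r (phi D E u d a i j)) ` C)"

definition SL2_loc ::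
  "('a, 'b) ring_scheme \<Rightarrow> ('a \<Rightarrow> ereal) \<Rightarrow> 'a set \<Rightarrow> 'a \<Rightarrow> nat \<Rightarrow> nat \<Rightarrow> 'a set mat2 monoid"
  where "SL2_loc D \<omega> E u d r = (let M = mat2_monoid (trunc_ring D \<omega> (carrier D) (r * d)) in
    M\<lparr>carrier := {g \<in> carrier M.
      ring_det (trunc_ring D \<omega> E r) (2 * d) (block_mat (phi_bar D \<omega> E u d r) d g)
        = \<one>\<^bsub>trunc_ring D \<omega> E r\<^esub>}\<rparr>)"

definition point_stab_loc ::
  "('a, 'b) ring_scheme \<Rightarrow> ('a \<Rightarrow> ereal) \<Rightarrow> 'a set \<Rightarrow> 'a \<Rightarrow> nat \<Rightarrow> nat \<Rightarrow> real \<Rightarrow> 'a set mat2 set"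
  where "point_stab_loc D \<omega> E u d r x =
    point_stab (SL2_loc D \<omega> E u d r) (trunc_val D \<omega> (carrier D) (r * d)) x"

definition P0_loc ::
  "('a, 'b) ring_scheme \<Rightarrow> ('a \<Rightarrow> ereal) \<Rightarrow> 'a set \<Rightarrow> 'a \<Rightarrow> nat \<Rightarrow> nat \<Rightarrow> 'a set mat2 monoid"
  where "P0_loc D \<omega> E u d r = (SL2_loc D \<omega> E u d r)\<lparr>carrier := point_stab_loc D \<omega> E u d r 0\<rparr>"

definition H_loc ::
  "('a, 'b) ring_scheme \<Rightarrow> ('a \<Rightarrow> ereal) \<Rightarrow> 'a set \<Rightarrow> 'a \<Rightarrow> nat \<Rightarrow> nat \<Rightarrow> 'a set mat2 set"
  where "H_loc D \<omega> E u d r = (let R = trunc_ring D \<omega> (carrier D) (r * d) in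
    carrier (SL2_loc D \<omega> E u d r) \<inter>
    {Mat2 x \<zero>\<^bsub>R\<^esub> \<zero>\<^bsub>R\<^esub> (inv\<^bsub>R\<^esub> x) | x. x \<in> Units R \<and> trunc_val D \<omega> (carrier D) (r * d) x = 0})"

definition M_loc ::
  "('a, 'b) ring_scheme \<Rightarrow> ('a \<Rightarrow> ereal) \<Rightarrow> 'a set \<Rightarrow> 'a \<Rightarrow> nat \<Rightarrow> nat \<Rightarrow> 'a set mat2 set"
  where "M_loc D \<omega> E u d r = (let R = trunc_ring D \<omega> (carrier D) (r * d) in
    carrier (SL2_loc D \<omega> E u d r) \<inter>
    {Mat2 \<zero>\<^bsub>R\<^esub> (\<ominus>\<^bsub>R\<^esub> x) (inv\<^bsub>R\<^esub> x) \<zero>\<^bsub>R\<^esub> | x. x \<in> Units R \<and> trunc_val D \<omega> (carrier D) (r * d) x = 0})"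

definition nu_loc ::
  "('a, 'b) ring_scheme \<Rightarrow> ('a \<Rightarrow> ereal) \<Rightarrow> 'a set \<Rightarrow> 'a \<Rightarrow> nat \<Rightarrow> nat \<Rightarrow> 'a set mat2 \<Rightarrow> real \<Rightarrow> real"
  where "nu_loc D \<omega> E u d r n = (if n \<in> H_loc D \<omega> E u d r then id else uminus)"

definition apt_interval :: "('a, 'b) ring_scheme \<Rightarrow> ('a \<Rightarrow> ereal) \<Rightarrow> 'a \<Rightarrow> nat \<Rightarrow> real set"
  where "apt_interval D \<omega> \<pi> k =
    {- real_of_ereal (\<omega> (\<pi> [^]\<^bsub>D\<^esub> k)) .. real_of_ereal (\<omega> (\<pi> [^]\<^bsub>D\<^esub> k))}"

definition loc_rel ::
  "('a, 'b) ring_scheme \<Rightarrow> ('a \<Rightarrow> ereal) \<Rightarrow> 'a set \<Rightarrow> 'a \<Rightarrow> nat \<Rightarrow> 'a \<Rightarrow> nat \<Rightarrow>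
    (('a set mat2 \<times> real) \<times> ('a set mat2 \<times> real)) set"
  where "loc_rel D \<omega> E u d \<pi> r = (let G = P0_loc D \<omega> E u d r; I = apt_interval D \<omega> \<pi> (r * d) in
    {((g, x), (h, y)). g \<in> carrier G \<and> h \<in> carrier G \<and> x \<in> I \<and> y \<in> I \<and>
      (\<exists>n \<in> H_loc D \<omega> E u d r \<union> M_loc D \<omega> E u d r. nu_loc D \<omega> E u d r n x = y \<and>
        inv\<^bsub>G\<^esub> g \<otimes>\<^bsub>G\<^esub> h \<otimes>\<^bsub>G\<^esub> n \<in> point_stab_loc D \<omega> E u d r x)})"

definition loc_tree ::
  "('a, 'b) ring_scheme \<Rightarrow> ('a \<Rightarrow> ereal) \<Rightarrow> 'a set \<Rightarrow> 'a \<Rightarrow> nat \<Rightarrow> 'a \<Rightarrow> nat \<Rightarrow>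
    ('a set mat2 \<times> real) set set"
  where "loc_tree D \<omega> E u d \<pi> r =
    (carrier (P0_loc D \<omega> E u d r) \<times> apt_interval D \<omega> \<pi> (r * d)) // loc_rel D \<omega> E u d \<pi> r"

definition loc_pt ::
  "('a, 'b) ring_scheme \<Rightarrow> ('a \<Rightarrow> ereal) \<Rightarrow> 'a set \<Rightarrow> 'a \<Rightarrow> nat \<Rightarrow> 'a \<Rightarrow> nat \<Rightarrow>
    'a set mat2 \<Rightarrow> real \<Rightarrow> ('a set mat2 \<times> real) set"
  where "loc_pt D \<omega> E u d \<pi> r g x = loc_rel D \<omega> E u d \<pi> r `` {(g, x)}"

definition reduction :: "('a, 'b) ring_scheme \<Rightarrow> ('a \<Rightarrow> ereal) \<Rightarrow> nat \<Rightarrow> 'a mat2 \<Rightarrow> 'a set mat2"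
  where "reduction D \<omega> k = map_mat2 (trunc D \<omega> (carrier D) k)"

end

theory Submission imports Defs begin

text \<open>The group of all matrices over \<open>D\<close> whose reduced norm has valuation \<open>0\<close> acts on the tree,
  and the relation \<open>pt_rel\<close> between its elements paired with points of the apartment is defined with
  the full group of monomial matrices. On \<open>SL\<^sub>2(D)\<close> it is the relation defining the tree. On the
  integral matrices whose reduced norm is congruent to \<open>1\<close> it is the relation defining the local
  version, lifted along reduction: an element of the stabiliser of the vertex \<open>0\<close> relates two points
  of the standard apartment only if they agree up to sign, so monomial matrices with unit entries
  suffice, and within the given radius membership in a point stabiliser is visible modulo
  \<open>\<mm>\<^sub>D\<^sup>r\<^sup>d\<close>. This gives a well-defined injection.

  Surjectivity does not require lifting to reduced norm exactly \<open>1\<close>. Gauss elimination writes an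
  integral matrix with unit reduced norm as a product of elementary matrices, which lie in
  \<open>SL\<^sub>2(\<O>\<^sub>D)\<close>, and a diagonal matrix with unit entries, which fixes the standard apartment pointwise.\<close>

section \<open>Determinants over commutative rings\<close>

text \<open>The obstacle is noncommutativity: a matrix over D has no determinant or adjugate with
  entries in D, so inverses and statements about units must come from elsewhere. The substitute is
  the valuation of the reduced norm, and two facts about it drive the geometry: it is additive on
  products, and on a diagonal matrix it vanishes exactly when the valuations of the two entries add
  up to 0. Additivity is multiplicativity of the Leibniz determinant over E. The vanishing criterion
  is harder, since left multiplication by a noncentral element is in general not triangular; it is
  deduced from the central element \<open>\<pi>\<^sub>K\<close>, whose matrix is scalar, together
  with u^d = \<open>\<pi>\<^sub>K\<close>.

  The exponents rd on D and r on E belong together because \<open>qD\<close> times d is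
  \<open>q\<close>: the one real number r * q is the level of both truncations and the half-length
  of the interval in the apartment.\<close>

lemma (in abelian_monoid) finsum_swap:
  assumes "finite A" "finite B" "\<And>i j. i \<in> A \<Longrightarrow> j \<in> B \<Longrightarrow> f i j \<in> carrier G"
  shows "(\<Oplus>i\<in>A. \<Oplus>j\<in>B. f i j) = (\<Oplus>j\<in>B. \<Oplus>i\<in>A. f i j)"
  using assms
proof (induction A rule: finite_induct)
  case empty
  then show ?case by simp
next
  case (insert a A)
  have c: "(\<lambda>j. f a j) \<in> B \<rightarrow> carrier G" "(\<lambda>i. \<Oplus>j\<in>B. f i j) \<in> A \<rightarrow> carrier G"
      "(\<lambda>j. \<Oplus>i\<in>A. f i j) \<in> B \<rightarrow> carrier G"
    using insert.prems by (auto intro!: finsum_closed)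
  have "(\<Oplus>i\<in>insert a A. \<Oplus>j\<in>B. f i j) = (\<Oplus>j\<in>B. f a j) \<oplus> (\<Oplus>j\<in>B. \<Oplus>i\<in>A. f i j)"
    using insert c by (simp add: finsum_insert)
  also have "\<dots> = (\<Oplus>j\<in>B. f a j \<oplus> (\<Oplus>i\<in>A. f i j))"
    using c by (simp add: finsum_addf)
  also have "\<dots> = (\<Oplus>j\<in>B. \<Oplus>i\<in>insert a A. f i j)"
    using insert by (intro finsum_cong') (auto intro!: finsum_closed finsum_insert[symmetric])
  finally show ?case .
qed

lemma (in abelian_monoid) finsum_Times:
  assumes "finite A" "finite B" "\<And>i j. i \<in> A \<Longrightarrow> j \<in> B \<Longrightarrow> f i j \<in> carrier G"
  shows "(\<Oplus>i\<in>A. \<Oplus>j\<in>B. f i j) = (\<Oplus>z\<in>A \<times> B. f (fst z) (snd z))"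
  using assms
proof (induction A rule: finite_induct)
  case empty
  then show ?case by simp
next
  case (insert a A)
  have c: "(\<lambda>j. f a j) \<in> B \<rightarrow> carrier G" "(\<lambda>i. \<Oplus>j\<in>B. f i j) \<in> A \<rightarrow> carrier G"
    using insert.prems by (auto intro!: finsum_closed)
  have "insert a A \<times> B = {a} \<times> B \<union> A \<times> B" by auto
  moreover have "(\<Oplus>z\<in>{a} \<times> B \<union> A \<times> B. f (fst z) (snd z))
      = (\<Oplus>z\<in>{a} \<times> B. f (fst z) (snd z)) \<oplus> (\<Oplus>z\<in>A \<times> B. f (fst z) (snd z))"
    using insert by (intro finsum_Un_disjoint) auto
  moreover have "(\<Oplus>z\<in>{a} \<times> B. f (fst z) (snd z)) = (\<Oplus>z\<in>Pair a ` B. f (fst z) (snd z))"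
    by (rule arg_cong[where f="\<lambda>S. \<Oplus>z\<in>S. f (fst z) (snd z)"]) auto
  moreover have "\<dots> = (\<Oplus>j\<in>B. f a j)"
    using insert.prems by (subst finsum_reindex) (auto simp: inj_on_def)
  ultimately show ?case
    using insert c by (simp add: finsum_insert)
qed

text \<open>Multiplying out a product of sums chooses one index per factor;
  \<open>ring_det_mult\<close> starts from this sum over choice functions.\<close>

lemma (in cring) finprod_finsum_distrib:
  assumes "finite S" "finite T" "\<And>i k. i \<in> S \<Longrightarrow> k \<in> T \<Longrightarrow> f i k \<in> carrier R"
  shows "(\<Otimes>i\<in>S. \<Oplus>k\<in>T. f i k) = (\<Oplus>g\<in>S \<rightarrow>\<^sub>E T. \<Otimes>i\<in>S. f i (g i))"
  using assms
proof (induction S rule: finite_induct)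
  case empty
  then show ?case by (simp add: finsum_insert)
next
  case (insert a S)
  let ?P = "\<lambda>g. \<Otimes>i\<in>S. f i (g i)"
  have fin: "finite (S \<rightarrow>\<^sub>E T)" using insert by (intro finite_PiE) auto
  have P: "?P g \<in> carrier R" if "g \<in> S \<rightarrow>\<^sub>E T" for g
    using insert.prems that by (intro finprod_closed) (auto simp: PiE_iff)
  have fa: "(\<lambda>k. f a k) \<in> T \<rightarrow> carrier R" using insert.prems by auto
  have inj: "inj_on (\<lambda>z. (snd z)(a := fst z)) (T \<times> (S \<rightarrow>\<^sub>E T))"
    using inj_combinator[of a S "\<lambda>_. T"] insert.hyps by (simp add: case_prod_unfold)
  have "(\<Otimes>i\<in>insert a S. \<Oplus>k\<in>T. f i k) = (\<Oplus>k\<in>T. f a k) \<otimes> (\<Oplus>g\<in>S \<rightarrow>\<^sub>E T. ?P g)"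
    using insert by (simp add: finsum_closed Pi_def finprod_insert)
  also have "\<dots> = (\<Oplus>k\<in>T. f a k \<otimes> (\<Oplus>g\<in>S \<rightarrow>\<^sub>E T. ?P g))"
    using insert fa P by (intro finsum_ldistr) (auto intro!: finsum_closed)
  also have "\<dots> = (\<Oplus>k\<in>T. \<Oplus>g\<in>S \<rightarrow>\<^sub>E T. f a k \<otimes> ?P g)"
    using insert fa P fin by (intro finsum_cong' finsum_rdistr) (auto intro!: finsum_closed)
  also have "\<dots> = (\<Oplus>z\<in>T \<times> (S \<rightarrow>\<^sub>E T). f a (fst z) \<otimes> ?P (snd z))"
    using insert fin P by (intro finsum_Times) auto
  also have "\<dots> = (\<Oplus>z\<in>T \<times> (S \<rightarrow>\<^sub>E T). \<Otimes>i\<in>insert a S. f i (((snd z)(a := fst z)) i))"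
  proof (intro finsum_cong' refl)
    show "(\<lambda>z. \<Otimes>i\<in>insert a S. f i (((snd z)(a := fst z)) i)) \<in> T \<times> (S \<rightarrow>\<^sub>E T) \<rightarrow> carrier R"
      using insert.prems by (auto intro!: finprod_closed simp: PiE_iff)
    fix z assume z: "z \<in> T \<times> (S \<rightarrow>\<^sub>E T)"
    have "(\<Otimes>i\<in>S. f i (((snd z)(a := fst z)) i)) = ?P (snd z)"
      using insert z by (intro finprod_cong') (auto simp: PiE_iff)
    then show "f a (fst z) \<otimes> ?P (snd z) = (\<Otimes>i\<in>insert a S. f i (((snd z)(a := fst z)) i))"
      using insert z by (subst finprod_insert) (auto simp: PiE_iff)
  qed
  also have "\<dots> = (\<Oplus>g\<in>(\<lambda>z. (snd z)(a := fst z)) ` (T \<times> (S \<rightarrow>\<^sub>E T)). \<Otimes>i\<in>insert a S. f i (g i))"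
    using insert.prems
    by (intro finsum_reindex[OF _ inj, symmetric]) (auto intro!: finprod_closed simp: PiE_iff)
  also have "(\<lambda>z. (snd z)(a := fst z)) ` (T \<times> (S \<rightarrow>\<^sub>E T)) = insert a S \<rightarrow>\<^sub>E T"
    using PiE_insert_eq[of a S "\<lambda>_. T"] by (simp add: case_prod_unfold)
  finally show ?case .
qed

lemma (in abelian_monoid) finsum_lessThan_double:
  fixes n :: nat
  assumes "\<And>k. k < 2 * n \<Longrightarrow> f k \<in> carrier G"
  shows "(\<Oplus>k\<in>{..<2 * n}. f k) = (\<Oplus>k\<in>{..<n}. f k) \<oplus> (\<Oplus>k\<in>{..<n}. f (k + n))"
proof -
  have "{..<2 * n} = {..<n} \<union> (\<lambda>k. k + n) ` {..<n}"
    by (auto simp: image_iff) (metis le_add_diff_inverse2 linorder_not_less mult_2 nat_add_left_cancel_less add.commute lessThan_iff)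
  then have "(\<Oplus>k\<in>{..<2 * n}. f k) = (\<Oplus>k\<in>{..<n}. f k) \<oplus> (\<Oplus>k\<in>(\<lambda>k. k + n) ` {..<n}. f k)"
    using assms by (simp only:, intro finsum_Un_disjoint) auto
  also have "(\<Oplus>k\<in>(\<lambda>k. k + n) ` {..<n}. f k) = (\<Oplus>k\<in>{..<n}. f (k + n))"
    using assms by (intro finsum_reindex) (auto simp: inj_on_def)
  finally show ?thesis .
qed

text \<open>The determinant in \<open>reduced_norm\<close> is formed in the structure restricted to
  E, while coordinates are summed in D; this moves between the two.\<close>

lemma (in ring) finsum_subring_consistent:
  assumes "subring S R" "finite A" "\<And>i. i \<in> A \<Longrightarrow> f i \<in> S"
  shows "finsum (R\<lparr>carrier := S\<rparr>) f A = finsum R f A"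
proof -
  interpret S: ring "R\<lparr>carrier := S\<rparr>" using subring_is_ring[OF assms(1)] .
  note sub = subringE(1)[OF assms(1)]
  show ?thesis using assms(2,3)
  proof (induction A rule: finite_induct)
    case empty
    then show ?case by simp
  next
    case (insert i A)
    then have "finsum (R\<lparr>carrier := S\<rparr>) f (insert i A) = f i \<oplus> finsum (R\<lparr>carrier := S\<rparr>) f A"
      by (subst S.finsum_insert) auto
    moreover have "finsum R f (insert i A) = f i \<oplus> finsum R f A"
      using insert sub by (intro finsum_insert) auto
    ultimately show ?case using insert by simp
  qed
qed

section \<open>The Leibniz determinant over a commutative ring\<close>

definition perm_sign :: "('a, 'b) ring_scheme \<Rightarrow> (nat \<Rightarrow> nat) \<Rightarrow> 'a"
  where "perm_sign R p = (if evenperm p then \<one>\<^bsub>R\<^esub> else \<ominus>\<^bsub>R\<^esub> \<one>\<^bsub>R\<^esub>)"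

lemma ring_det_alt:
  "ring_det R n A = (\<Oplus>\<^bsub>R\<^esub>p\<in>{p. p permutes {..<n}}. perm_sign R p \<otimes>\<^bsub>R\<^esub> (\<Otimes>\<^bsub>R\<^esub>i\<in>{..<n}. A i (p i)))"
  by (simp add: ring_det_def perm_sign_def)

context cring
begin

lemma perm_sign_closed [simp]: "perm_sign R p \<in> carrier R"
  by (simp add: perm_sign_def)

lemma perm_sign_comp:
  assumes "p permutes {..<n}" "q permutes {..<n}"
  shows "perm_sign R (p \<circ> q) = perm_sign R p \<otimes> perm_sign R q"
proof -
  have "permutation p" "permutation q" using assms permutation_permutes by blast+
  then have "evenperm (p \<circ> q) \<longleftrightarrow> evenperm p = evenperm q" by (rule evenperm_comp)
  then show ?thesis by (auto simp: perm_sign_def l_minus r_minus)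
qed

lemma det_summand_closed:
  assumes "p permutes {..<n}" "\<And>i j. i < n \<Longrightarrow> j < n \<Longrightarrow> A i j \<in> carrier R"
  shows "(\<Otimes>i\<in>{..<n}. A i (p i)) \<in> carrier R"
proof -
  have "p i < n" if "i < n" for i using permutes_in_image[OF assms(1), of i] that by simp
  then show ?thesis using assms by (intro finprod_closed) auto
qed

lemma ring_det_closed:
  assumes "\<And>i j. i < n \<Longrightarrow> j < n \<Longrightarrow> A i j \<in> carrier R"
  shows "ring_det R n A \<in> carrier R"
  unfolding ring_det_alt by (intro finsum_closed) (auto intro!: det_summand_closed assms)

lemma ring_det_cong:
  assumes "\<And>i j. i < n \<Longrightarrow> j < n \<Longrightarrow> A i j = B i j"
    and "\<And>i j. i < n \<Longrightarrow> j < n \<Longrightarrow> B i j \<in> carrier R"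
  shows "ring_det R n A = ring_det R n B"
  unfolding ring_det_alt
proof (intro finsum_cong' refl)
  show "(\<lambda>p. perm_sign R p \<otimes> (\<Otimes>i\<in>{..<n}. B i (p i))) \<in> {p. p permutes {..<n}} \<rightarrow> carrier R"
    by (auto intro!: det_summand_closed assms)
  fix p assume "p \<in> {p. p permutes {..<n}}"
  then have "p i < n" if "i < n" for i using permutes_in_image[of p "{..<n}" i] that by simp
  then have "(\<Otimes>i\<in>{..<n}. A i (p i)) = (\<Otimes>i\<in>{..<n}. B i (p i))"
    using assms by (intro finprod_cong') auto
  then show "perm_sign R p \<otimes> (\<Otimes>i\<in>{..<n}. A i (p i)) = perm_sign R p \<otimes> (\<Otimes>i\<in>{..<n}. B i (p i))"
    by simp
qed

text \<open>Substituting \<open>p \<circ> q\<close> for \<open>p\<close> in the sum and reindexing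
  each product along \<open>q\<close> leaves only the sign of \<open>q\<close>.\<close>

lemma ring_det_permute_rows:
  assumes q: "q permutes {..<n}" and B: "\<And>i j. i < n \<Longrightarrow> j < n \<Longrightarrow> B i j \<in> carrier R"
  shows "ring_det R n (\<lambda>i. B (q i)) = perm_sign R q \<otimes> ring_det R n B"
proof -
  let ?P = "{p. p permutes {..<n}}"
  have qn: "q i < n" if "i < n" for i using permutes_in_image[OF q, of i] that by simp
  have inj: "inj_on (\<lambda>p. p \<circ> q) ?P"
  proof (rule inj_onI)
    fix p p' assume "p \<circ> q = p' \<circ> q"
    then show "p = p'" using permutes_surj[OF q] by (simp add: fun.inj_map_strong surj_fun_eq)
  qed
  have img: "(\<lambda>p. p \<circ> q) ` ?P = ?P"
    by (rule image_compose_permutations_right[OF q, unfolded setcompr_eq_image, simplified])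
  have cl: "(\<lambda>p. perm_sign R p \<otimes> (\<Otimes>i\<in>{..<n}. B i (p i))) \<in> ?P \<rightarrow> carrier R"
    by (auto intro!: det_summand_closed B)
  have "ring_det R n (\<lambda>i. B (q i)) = (\<Oplus>p\<in>(\<lambda>p. p \<circ> q) ` ?P. perm_sign R p \<otimes> (\<Otimes>i\<in>{..<n}. B (q i) (p i)))"
    unfolding ring_det_alt img ..
  also have "\<dots> = (\<Oplus>p\<in>?P. perm_sign R (p \<circ> q) \<otimes> (\<Otimes>i\<in>{..<n}. B (q i) ((p \<circ> q) i)))"
    using inj img by (intro finsum_reindex) (auto intro!: det_summand_closed B qn)
  also have "\<dots> = (\<Oplus>p\<in>?P. perm_sign R q \<otimes> (perm_sign R p \<otimes> (\<Otimes>i\<in>{..<n}. B i (p i))))"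
  proof (intro finsum_cong' refl)
    show "(\<lambda>p. perm_sign R q \<otimes> (perm_sign R p \<otimes> (\<Otimes>i\<in>{..<n}. B i (p i)))) \<in> ?P \<rightarrow> carrier R"
      using cl by auto
    fix p assume "p \<in> ?P"
    then have p: "p permutes {..<n}" by simp
    have pn: "p i < n" if "i < n" for i using permutes_in_image[OF p, of i] that by simp
    have "(\<Otimes>i\<in>{..<n}. B (q i) (p (q i))) = (\<Otimes>i\<in>q ` {..<n}. B i (p i))"
      using permutes_inj_on[OF q] pn qn B by (intro finprod_reindex[symmetric]) auto
    then have "(\<Otimes>i\<in>{..<n}. B (q i) ((p \<circ> q) i)) = (\<Otimes>i\<in>{..<n}. B i (p i))"
      using permutes_image[OF q] by simp
    moreover have "(\<Otimes>i\<in>{..<n}. B i (p i)) \<in> carrier R" by (intro det_summand_closed p B)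
    ultimately show "perm_sign R (p \<circ> q) \<otimes> (\<Otimes>i\<in>{..<n}. B (q i) ((p \<circ> q) i))
        = perm_sign R q \<otimes> (perm_sign R p \<otimes> (\<Otimes>i\<in>{..<n}. B i (p i)))"
      using perm_sign_comp[OF p q] by (simp add: m_ac)
  qed
  also have "\<dots> = perm_sign R q \<otimes> ring_det R n B"
    unfolding ring_det_alt using cl by (intro finsum_rdistr[symmetric]) (auto simp: finite_permutations)
  finally show ?thesis .
qed

text \<open>Composition with the transposition pairs even with odd permutations that have the same
  product, so the terms cancel in pairs. Arguing that the determinant is its own negative would fail
  in characteristic 2, which a local field may have.\<close>

lemma ring_det_identical_rows:
  assumes ij: "i < n" "j < n" "i \<noteq> j" and eq: "\<And>l. l < n \<Longrightarrow> B i l = B j l"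
    and B: "\<And>i j. i < n \<Longrightarrow> j < n \<Longrightarrow> B i j \<in> carrier R"
  shows "ring_det R n B = \<zero>"
proof -
  let ?P = "{p. p permutes {..<n}}" and ?t = "Transposition.transpose i j"
  let ?E = "{p. p permutes {..<n} \<and> evenperm p}" and ?O = "{p. p permutes {..<n} \<and> \<not> evenperm p}"
  define s where "s p = (\<Otimes>i\<in>{..<n}. B i (p i))" for p
  have t: "?t permutes {..<n}" using ij by (intro permutes_swap_id) auto
  have tt: "?t \<circ> ?t = id" by simp
  have sc: "s p \<in> carrier R" if "p permutes {..<n}" for p
    unfolding s_def by (intro det_summand_closed that B)
  have st: "s (p \<circ> ?t) = s p" if p: "p permutes {..<n}" for p
  proof -
    have tn: "?t i < n" if "i < n" for i using permutes_in_image[OF t, of i] that by simp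
    have pn: "p i < n" if "i < n" for i using permutes_in_image[OF p, of i] that by simp
    have "s p = (\<Otimes>l\<in>?t ` {..<n}. B l (p l))" unfolding s_def using permutes_image[OF t] by simp
    also have "\<dots> = (\<Otimes>l\<in>{..<n}. B (?t l) (p (?t l)))"
      using permutes_inj_on[OF t] tn pn B by (intro finprod_reindex) auto
    also have "\<dots> = s (p \<circ> ?t)"
      unfolding s_def
    proof (intro finprod_cong' refl)
      show "(\<lambda>l. B l ((p \<circ> ?t) l)) \<in> {..<n} \<rightarrow> carrier R" using tn pn B by auto
      fix l assume "l \<in> {..<n}"
      then show "B (?t l) (p (?t l)) = B l ((p \<circ> ?t) l)"
        using eq[of "p j"] eq[of "p i"] pn ij by (auto simp: Transposition.transpose_def)
    qed
    finally show ?thesis by simp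
  qed
  have par: "evenperm (p \<circ> ?t) \<longleftrightarrow> \<not> evenperm p" if "p permutes {..<n}" for p
  proof -
    have "permutation p" using that permutation_permutes by blast
    then show ?thesis using evenperm_comp[OF _ permutation_swap_id, of p i j] ij by (simp add: evenperm_swap)
  qed
  have comp: "p \<circ> ?t permutes {..<n}" if "p permutes {..<n}" for p
    using permutes_compose[OF t that] .
  have inj: "inj_on (\<lambda>p. p \<circ> ?t) ?E"
  proof (rule inj_onI)
    fix p p' assume "p \<circ> ?t = p' \<circ> ?t"
    then have "(p \<circ> ?t) \<circ> ?t = (p' \<circ> ?t) \<circ> ?t" by simp
    then show "p = p'" unfolding o_assoc[symmetric] tt by simp
  qed
  have O: "?O = (\<lambda>p. p \<circ> ?t) ` ?E"
  proof (intro equalityI subsetI)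
    fix p assume p: "p \<in> ?O"
    then have "p = (p \<circ> ?t) \<circ> ?t" unfolding o_assoc[symmetric] tt by simp
    moreover have "p \<circ> ?t \<in> ?E" using p comp par by auto
    ultimately show "p \<in> (\<lambda>p. p \<circ> ?t) ` ?E" by blast
  qed (auto simp: comp par)
  have fin: "finite ?E" "finite ?O" using finite_permutations[of "{..<n}"] by (auto intro: rev_finite_subset)
  have "ring_det R n B = (\<Oplus>p\<in>?E \<union> ?O. perm_sign R p \<otimes> s p)"
    unfolding ring_det_alt s_def by (rule arg_cong[where f="finsum _ _"]) auto
  also have "\<dots> = (\<Oplus>p\<in>?E. perm_sign R p \<otimes> s p) \<oplus> (\<Oplus>p\<in>?O. perm_sign R p \<otimes> s p)"
    using fin sc by (intro finsum_Un_disjoint) auto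
  also have "(\<Oplus>p\<in>?E. perm_sign R p \<otimes> s p) = (\<Oplus>p\<in>?E. s p)"
    using sc by (intro finsum_cong') (auto simp: perm_sign_def)
  also have "(\<Oplus>p\<in>?O. perm_sign R p \<otimes> s p) = (\<Oplus>p\<in>?E. perm_sign R (p \<circ> ?t) \<otimes> s (p \<circ> ?t))"
    unfolding O using inj sc comp by (intro finsum_reindex) auto
  also have "\<dots> = (\<Oplus>p\<in>?E. \<ominus> \<one> \<otimes> s p)"
    using sc by (intro finsum_cong') (auto simp: perm_sign_def par st)
  also have "\<dots> = \<ominus> \<one> \<otimes> (\<Oplus>p\<in>?E. s p)"
    using sc fin by (intro finsum_rdistr[symmetric]) auto
  finally show ?thesis
    using finsum_closed[of s ?E] sc by (simp add: l_minus r_neg)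
qed

text \<open>Multiplying out the rows gives a sum over all index functions \<open>g\<close>. Those
  that repeat an index yield a determinant with two equal rows; the injective ones are permutations,
  and undoing the permutation of rows supplies the signs of the determinant of
  \<open>A\<close>.\<close>

theorem ring_det_mult:
  assumes A: "\<And>i j. i < n \<Longrightarrow> j < n \<Longrightarrow> A i j \<in> carrier R"
    and B: "\<And>i j. i < n \<Longrightarrow> j < n \<Longrightarrow> B i j \<in> carrier R"
  shows "ring_det R n (\<lambda>i j. \<Oplus>k\<in>{..<n}. A i k \<otimes> B k j) = ring_det R n A \<otimes> ring_det R n B"
proof -
  let ?P = "{p. p permutes {..<n}}" and ?F = "{..<n} \<rightarrow>\<^sub>E {..<n}"
  define a where "a g = (\<Otimes>i\<in>{..<n}. A i (g i))" for g
  define b where "b g p = (\<Otimes>i\<in>{..<n}. B (g i) (p i))" for g p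
  have pn: "p i < n" if "p permutes {..<n}" "i < n" for p i using permutes_in_image[OF that(1), of i] that by simp
  have gn: "g i < n" if "g \<in> ?F" "i < n" for g i using that by (auto simp: PiE_iff)
  have ac: "a g \<in> carrier R" if "g \<in> ?F" for g
    unfolding a_def using A gn that by (intro finprod_closed) auto
  have bc: "b g p \<in> carrier R" if "g \<in> ?F" "p \<in> ?P" for g p
    unfolding b_def using B gn pn that by (intro finprod_closed) auto
  have dc: "ring_det R n (\<lambda>i. B (g i)) \<in> carrier R" if g: "g \<in> ?F" for g
  proof (rule ring_det_closed)
    fix i j assume "i < n" "j < n"
    then show "B (g i) j \<in> carrier R" using gn[OF g, of i] B by blast
  qed
  have fF: "finite ?F" by (intro finite_PiE) auto
  have fP: "finite ?P" by (intro finite_permutations) auto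
  have prod: "(\<Otimes>i\<in>{..<n}. \<Oplus>k\<in>{..<n}. A i k \<otimes> B k (p i)) = (\<Oplus>g\<in>?F. a g \<otimes> b g p)" if p: "p \<in> ?P" for p
  proof -
    have "(\<Otimes>i\<in>{..<n}. \<Oplus>k\<in>{..<n}. A i k \<otimes> B k (p i)) = (\<Oplus>g\<in>?F. \<Otimes>i\<in>{..<n}. A i (g i) \<otimes> B (g i) (p i))"
      using A B p pn by (intro finprod_finsum_distrib) auto
    also have "\<dots> = (\<Oplus>g\<in>?F. a g \<otimes> b g p)"
    proof (intro finsum_cong' refl)
      show "(\<lambda>g. a g \<otimes> b g p) \<in> ?F \<rightarrow> carrier R" using ac bc p by auto
      fix g assume "g \<in> ?F"
      then show "(\<Otimes>i\<in>{..<n}. A i (g i) \<otimes> B (g i) (p i)) = a g \<otimes> b g p"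
        unfolding a_def b_def using A B p pn gn by (intro finprod_multf) auto
    qed
    finally show ?thesis .
  qed
  have detB: "(\<Oplus>p\<in>?P. perm_sign R p \<otimes> b g p) = ring_det R n (\<lambda>i. B (g i))" for g
    by (simp add: ring_det_alt b_def)
  have zero: "ring_det R n (\<lambda>i. B (g i)) = \<zero>" if g: "g \<in> ?F" "\<not> inj_on g {..<n}" for g
  proof -
    from g obtain i j where "i < n" "j < n" "i \<noteq> j" "g i = g j" by (auto simp: inj_on_def)
    then show ?thesis using g gn B by (intro ring_det_identical_rows[of i n j]) auto
  qed
  \<comment> \<open>An index function is undefined outside \<open>{..<n}\<close> whereas a
    permutation is the identity there, so permutations are matched with their restrictions.\<close>
  let ?res = "\<lambda>p. restrict p {..<n}"
  have resF: "?res p \<in> ?F" "inj_on (?res p) {..<n}" if "p \<in> ?P" for p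
    using that pn permutes_inj[of p "{..<n}"] by (auto simp: inj_on_def)
  have injres: "inj_on ?res ?P"
  proof (rule inj_onI)
    fix p q assume pq: "p \<in> ?P" "q \<in> ?P" "?res p = ?res q"
    show "p = q"
    proof
      fix i show "p i = q i"
      proof (cases "i < n")
        case True
        then show ?thesis using pq(3) by (metis lessThan_iff restrict_apply')
      next
        case False
        then show ?thesis using pq(1,2) by (simp add: permutes_not_in)
      qed
    qed
  qed
  have imres: "g \<in> ?res ` ?P" if g: "g \<in> ?F" "inj_on g {..<n}" for g
  proof -
    let ?p = "\<lambda>i. if i < n then g i else i"
    have "g ` {..<n} = {..<n}" using g gn by (intro endo_inj_surj) auto
    then have "bij_betw g {..<n} {..<n}" using g(2) by (simp add: bij_betw_def)
    then have "bij_betw ?p {..<n} {..<n}" by (subst bij_betw_cong[of _ _ g]) auto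
    then have "?p permutes {..<n}" by (rule bij_imp_permutes) auto
    moreover have "g = ?res ?p" using g(1) by (auto simp: PiE_iff extensional_def)
    ultimately show ?thesis by blast
  qed
  have "ring_det R n (\<lambda>i j. \<Oplus>k\<in>{..<n}. A i k \<otimes> B k j)
      = (\<Oplus>p\<in>?P. perm_sign R p \<otimes> (\<Oplus>g\<in>?F. a g \<otimes> b g p))"
    unfolding ring_det_alt using ac bc prod by (intro finsum_cong') (auto intro!: finsum_closed)
  also have "\<dots> = (\<Oplus>p\<in>?P. \<Oplus>g\<in>?F. perm_sign R p \<otimes> (a g \<otimes> b g p))"
    using ac bc fF by (intro finsum_cong' finsum_rdistr) (auto intro!: finsum_closed)
  also have "\<dots> = (\<Oplus>g\<in>?F. \<Oplus>p\<in>?P. perm_sign R p \<otimes> (a g \<otimes> b g p))"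
    using ac bc fF fP by (intro finsum_swap) auto
  also have "\<dots> = (\<Oplus>g\<in>?F. a g \<otimes> ring_det R n (\<lambda>i. B (g i)))"
  proof (intro finsum_cong' refl)
    show "(\<lambda>g. a g \<otimes> ring_det R n (\<lambda>i. B (g i))) \<in> ?F \<rightarrow> carrier R"
      by (intro funcsetI m_closed ac dc)
    fix g assume g: "g \<in> ?F"
    have "(\<Oplus>p\<in>?P. perm_sign R p \<otimes> (a g \<otimes> b g p)) = (\<Oplus>p\<in>?P. a g \<otimes> (perm_sign R p \<otimes> b g p))"
      using ac[OF g] bc[OF g] by (intro finsum_cong') (auto simp: m_lcomm)
    also have "\<dots> = a g \<otimes> (\<Oplus>p\<in>?P. perm_sign R p \<otimes> b g p)"
      using ac[OF g] bc[OF g] fP by (intro finsum_rdistr[symmetric]) auto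
    finally show "(\<Oplus>p\<in>?P. perm_sign R p \<otimes> (a g \<otimes> b g p)) = a g \<otimes> ring_det R n (\<lambda>i. B (g i))"
      by (simp add: detB)
  qed
  also have "\<dots> = (\<Oplus>g\<in>?res ` ?P. a g \<otimes> ring_det R n (\<lambda>i. B (g i)))"
  proof (rule add.finprod_mono_neutral_cong_right[OF fF])
    show "?res ` ?P \<subseteq> ?F" using resF(1) by (rule image_subsetI)
    fix g assume "g \<in> ?F - ?res ` ?P"
    then have g: "g \<in> ?F" and ng: "g \<notin> ?res ` ?P" unfolding Diff_iff by (rule conjunct1, rule conjunct2)
    have ninj: "\<not> inj_on g {..<n}" by (rule contrapos_nn[OF ng imres[OF g]])
    show "a g \<otimes> ring_det R n (\<lambda>i. B (g i)) = \<zero>" unfolding zero[OF g ninj] by (intro r_null ac g)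
  next
    show "(\<lambda>g. a g \<otimes> ring_det R n (\<lambda>i. B (g i))) \<in> ?F \<rightarrow> carrier R"
      by (intro funcsetI m_closed ac dc)
  qed simp
  also have "\<dots> = (\<Oplus>p\<in>?P. a (?res p) \<otimes> ring_det R n (\<lambda>i. B (?res p i)))"
  proof (rule finsum_reindex[OF _ injres])
    show "(\<lambda>g. a g \<otimes> ring_det R n (\<lambda>i. B (g i))) \<in> ?res ` ?P \<rightarrow> carrier R"
    proof (rule funcsetI)
      fix g assume "g \<in> ?res ` ?P"
      then have "g \<in> ?F" using resF(1) by (elim imageE) (simp only:)
      then show "a g \<otimes> ring_det R n (\<lambda>i. B (g i)) \<in> carrier R" by (intro m_closed ac dc)
    qed
  qed
  also have "\<dots> = (\<Oplus>p\<in>?P. (perm_sign R p \<otimes> a p) \<otimes> ring_det R n B)"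
  proof (intro finsum_cong' refl)
    have apc: "a p \<in> carrier R" if "p \<in> ?P" for p
      unfolding a_def using that A by (intro det_summand_closed) auto
    then show "(\<lambda>p. (perm_sign R p \<otimes> a p) \<otimes> ring_det R n B) \<in> ?P \<rightarrow> carrier R"
      using B by (auto intro!: ring_det_closed)
    fix p assume p: "p \<in> ?P"
    have "a (?res p) = a p" unfolding a_def using A pn p by (intro finprod_cong') auto
    moreover have "ring_det R n (\<lambda>i. B (?res p i)) = ring_det R n (\<lambda>i. B (p i))"
      using B pn p by (intro ring_det_cong) auto
    moreover have "\<dots> = perm_sign R p \<otimes> ring_det R n B" using p B by (intro ring_det_permute_rows) auto
    ultimately show "a (?res p) \<otimes> ring_det R n (\<lambda>i. B (?res p i)) = (perm_sign R p \<otimes> a p) \<otimes> ring_det R n B"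
      using apc[OF p] ring_det_closed[of n B] B by (simp add: m_ac)
  qed
  also have "\<dots> = ring_det R n A \<otimes> ring_det R n B"
    unfolding ring_det_alt[of R n A] a_def using A B fP
    by (intro finsum_ldistr[symmetric]) (auto intro!: det_summand_closed ring_det_closed)
  finally show ?thesis .
qed

text \<open>A permutation other than the identity lowers some index and raises some index, so its
  product meets a zero whichever side of the diagonal vanishes. Both shapes occur later, for
  \<open>lwr\<close> and \<open>upr\<close>.\<close>

lemma ring_det_triangular:
  assumes A: "\<And>i j. i < n \<Longrightarrow> j < n \<Longrightarrow> A i j \<in> carrier R"
    and tri: "(\<forall>i<n. \<forall>j<i. A i j = \<zero>) \<or> (\<forall>j<n. \<forall>i<j. A i j = \<zero>)"
  shows "ring_det R n A = (\<Otimes>i\<in>{..<n}. A i i)"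
proof -
  let ?P = "{p. p permutes {..<n}}"
  have c: "(\<Otimes>i\<in>{..<n}. A i (p i)) \<in> carrier R" if "p \<in> ?P" for p
    using that A by (intro det_summand_closed) auto
  have z: "(\<Otimes>i\<in>{..<n}. A i (p i)) = \<zero>" if p: "p \<in> ?P" "p \<noteq> id" for p
  proof -
    have p': "p permutes {..<n}" using p by simp
    have pn: "p i < n" if "i < n" for i using permutes_in_image[OF p', of i] that by simp
    have "\<exists>i\<in>{..<n}. A i (p i) = \<zero>"
      using tri
    proof
      assume t: "\<forall>i<n. \<forall>j<i. A i j = \<zero>"
      obtain i where "i < n" "p i < i"
        using permutes_natset_ge[OF p'] p(2) by (meson lessThan_iff not_le)
      then show ?thesis using t by auto
    next
      assume t: "\<forall>j<n. \<forall>i<j. A i j = \<zero>"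
      obtain i where "i < n" "i < p i"
        using permutes_natset_le[OF p'] p(2) by (meson lessThan_iff not_le)
      then show ?thesis using t pn by auto
    qed
    then obtain i where i: "i < n" "A i (p i) = \<zero>" by auto
    have "{..<n} = insert i ({..<n} - {i})" using i by auto
    then have "(\<Otimes>i\<in>{..<n}. A i (p i)) = (\<Otimes>i\<in>insert i ({..<n} - {i}). A i (p i))" by simp
    also have "\<dots> = A i (p i) \<otimes> (\<Otimes>i\<in>{..<n} - {i}. A i (p i))"
      using A pn i by (intro finprod_insert) auto
    also have "\<dots> = \<zero>" using i A pn by (simp add: finprod_closed Pi_def)
    finally show ?thesis .
  qed
  have "ring_det R n A = (\<Oplus>p\<in>{id}. perm_sign R p \<otimes> (\<Otimes>i\<in>{..<n}. A i (p i)))"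
    unfolding ring_det_alt
  proof (rule add.finprod_mono_neutral_cong_right)
    show "finite ?P" by (intro finite_permutations) auto
    show "{id} \<subseteq> ?P" using permutes_id by auto
  qed (use c z in auto)
  also have "\<dots> = (\<Otimes>i\<in>{..<n}. A i i)"
    using A by (subst finsum_insert) (auto simp: perm_sign_def intro!: finprod_closed)
  finally show ?thesis .
qed

end

text \<open>Applied to the inclusion of O_E in E and to the reduction of O_E modulo a power of its
  maximal ideal.\<close>

lemma (in ring_hom_cring) hom_ring_det:
  assumes "\<And>i j. i < n \<Longrightarrow> j < n \<Longrightarrow> A i j \<in> carrier R"
  shows "h (ring_det R n A) = ring_det S n (\<lambda>i j. h (A i j))"
proof -
  have sg: "h (perm_sign R p) = perm_sign S p" for p by (simp add: perm_sign_def)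
  have pn: "p i < n" if "p permutes {..<n}" "i < n" for p i using permutes_in_image[OF that(1), of i] that by simp
  have "h (ring_det R n A) = (\<Oplus>\<^bsub>S\<^esub>p\<in>{p. p permutes {..<n}}. (h \<circ> (\<lambda>p. perm_sign R p \<otimes>\<^bsub>R\<^esub> (\<Otimes>\<^bsub>R\<^esub>i\<in>{..<n}. A i (p i)))) p)"
    unfolding ring_det_alt using assms by (subst hom_finsum) (auto intro!: R.det_summand_closed simp: o_def)
  also have "\<dots> = ring_det S n (\<lambda>i j. h (A i j))"
    unfolding ring_det_alt
  proof (intro S.finsum_cong' refl)
    show "(\<lambda>p. perm_sign S p \<otimes>\<^bsub>S\<^esub> (\<Otimes>\<^bsub>S\<^esub>i\<in>{..<n}. h (A i (p i)))) \<in> {p. p permutes {..<n}} \<rightarrow> carrier S"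
      using assms pn by (auto intro!: S.finprod_closed)
    fix p assume p: "p \<in> {p. p permutes {..<n}}"
    then have "h (\<Otimes>\<^bsub>R\<^esub>i\<in>{..<n}. A i (p i)) = (\<Otimes>\<^bsub>S\<^esub>i\<in>{..<n}. (h \<circ> (\<lambda>i. A i (p i))) i)"
      using assms pn by (subst hom_finprod) (auto simp: o_def)
    then show "(h \<circ> (\<lambda>p. perm_sign R p \<otimes>\<^bsub>R\<^esub> (\<Otimes>\<^bsub>R\<^esub>i\<in>{..<n}. A i (p i)))) p
        = perm_sign S p \<otimes>\<^bsub>S\<^esub> (\<Otimes>\<^bsub>S\<^esub>i\<in>{..<n}. h (A i (p i)))"
      using p R.det_summand_closed[of p n A] assms by (simp add: sg o_def)
  qed
  finally show ?thesis .
qed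

section \<open>Two by two matrices over a valued skew field\<close>

lemma mat2_mult [simp]:
  "Mat2 a b c e \<otimes>\<^bsub>mat2_monoid R\<^esub> Mat2 a' b' c' e' =
    Mat2 (a \<otimes>\<^bsub>R\<^esub> a' \<oplus>\<^bsub>R\<^esub> b \<otimes>\<^bsub>R\<^esub> c') (a \<otimes>\<^bsub>R\<^esub> b' \<oplus>\<^bsub>R\<^esub> b \<otimes>\<^bsub>R\<^esub> e')
      (c \<otimes>\<^bsub>R\<^esub> a' \<oplus>\<^bsub>R\<^esub> e \<otimes>\<^bsub>R\<^esub> c') (c \<otimes>\<^bsub>R\<^esub> b' \<oplus>\<^bsub>R\<^esub> e \<otimes>\<^bsub>R\<^esub> e')"
  by (simp add: mat2_monoid_def)

lemma mat2_carrier [simp]: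
  "Mat2 a b c e \<in> carrier (mat2_monoid R) \<longleftrightarrow>
    a \<in> carrier R \<and> b \<in> carrier R \<and> c \<in> carrier R \<and> e \<in> carrier R"
  by (auto simp: mat2_monoid_def)

lemma mat2_one [simp]: "\<one>\<^bsub>mat2_monoid R\<^esub> = Mat2 \<one>\<^bsub>R\<^esub> \<zero>\<^bsub>R\<^esub> \<zero>\<^bsub>R\<^esub> \<one>\<^bsub>R\<^esub>"
  by (simp add: mat2_monoid_def)

lemma mat2_carrierE:
  assumes "g \<in> carrier (mat2_monoid R)"
  obtains a b c e where "g = Mat2 a b c e"
    "a \<in> carrier R" "b \<in> carrier R" "c \<in> carrier R" "e \<in> carrier R"
  using assms by (cases g) auto

context ring
begin

lemma monoid_mat2: "monoid (mat2_monoid R)"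
proof (rule monoidI)
  fix g h assume "g \<in> carrier (mat2_monoid R)" "h \<in> carrier (mat2_monoid R)"
  then show "g \<otimes>\<^bsub>mat2_monoid R\<^esub> h \<in> carrier (mat2_monoid R)"
    by (auto elim!: mat2_carrierE)
next
  fix f g h
  assume "f \<in> carrier (mat2_monoid R)" "g \<in> carrier (mat2_monoid R)" "h \<in> carrier (mat2_monoid R)"
  then show "f \<otimes>\<^bsub>mat2_monoid R\<^esub> g \<otimes>\<^bsub>mat2_monoid R\<^esub> h = f \<otimes>\<^bsub>mat2_monoid R\<^esub> (g \<otimes>\<^bsub>mat2_monoid R\<^esub> h)"
    by (elim mat2_carrierE) (simp add: l_distr r_distr m_assoc a_ac)
qed (auto elim!: mat2_carrierE)

abbreviation upr :: "'a \<Rightarrow> 'a mat2" where "upr b \<equiv> Mat2 \<one> b \<zero> \<one>"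
abbreviation lwr :: "'a \<Rightarrow> 'a mat2" where "lwr c \<equiv> Mat2 \<one> \<zero> c \<one>"
abbreviation dia :: "'a \<Rightarrow> 'a \<Rightarrow> 'a mat2" where "dia a e \<equiv> Mat2 a \<zero> \<zero> e"
abbreviation ant :: "'a \<Rightarrow> 'a \<Rightarrow> 'a mat2" where "ant b c \<equiv> Mat2 \<zero> b c \<zero>"
abbreviation weyl :: "'a mat2" where "weyl \<equiv> ant (\<ominus> \<one>) \<one>"

end

section \<open>Factorisations of matrices over a skew field\<close>

context skew_field
begin

abbreviation M where "M \<equiv> mat2_monoid D"

abbreviation mat2_times (infixl \<open>\<star>\<close> 70) where "g \<star> h \<equiv> g \<otimes>\<^bsub>M\<^esub> h"

lemma nonzero_inv:
  assumes "x \<in> carrier D" "x \<noteq> \<zero>"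
  shows "inv x \<in> carrier D" "inv x \<otimes> x = \<one>" "x \<otimes> inv x = \<one>" "inv x \<noteq> \<zero>"
proof -
  have "x \<in> Units D" using assms nonzero_Units by blast
  then show "inv x \<in> carrier D" "inv x \<otimes> x = \<one>" "x \<otimes> inv x = \<one>" by auto
  then show "inv x \<noteq> \<zero>" using assms one_neq_zero by auto
qed

lemma cancel_inv:
  assumes "x \<in> carrier D" "x \<noteq> \<zero>" "y \<in> carrier D"
  shows "x \<otimes> (inv x \<otimes> y) = y" "inv x \<otimes> (x \<otimes> y) = y"
  using nonzero_inv[OF assms(1,2)] assms by (simp_all add: m_assoc[symmetric])

lemma cancel_add_minus:
  assumes "x \<in> carrier D" "y \<in> carrier D"
  shows "x \<oplus> (y \<ominus> x) = y" "x \<oplus> (\<ominus> x \<oplus> y) = y" "(y \<ominus> x) \<oplus> x = y"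
proof -
  have "y \<oplus> \<ominus> x = \<ominus> x \<oplus> y" using assms by (simp add: a_comm)
  then show "x \<oplus> (y \<ominus> x) = y" using assms by (simp add: minus_eq r_neg2)
  show "x \<oplus> (\<ominus> x \<oplus> y) = y" using assms by (simp add: r_neg2)
  show "(y \<ominus> x) \<oplus> x = y" using assms by (simp add: minus_eq a_assoc l_neg)
qed

text \<open>Gauss elimination with pivot \<open>a\<close>; the middle factor carries the Schur
  complement. There are four versions because the admissible pivot found later can be any entry, and
  a pivot off the diagonal leaves an antidiagonal middle factor.\<close>

lemma pivot11:
  assumes "a \<in> carrier D" "b \<in> carrier D" "c \<in> carrier D" "e \<in> carrier D" "a \<noteq> \<zero>"
  shows "Mat2 a b c e = lwr (c \<otimes> inv a) \<star> dia a (e \<ominus> c \<otimes> inv a \<otimes> b) \<star> upr (inv a \<otimes> b)"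
  using assms nonzero_inv[OF assms(1,5)] by (simp add: m_assoc cancel_inv cancel_add_minus)

lemma pivot21:
  assumes "a \<in> carrier D" "b \<in> carrier D" "c \<in> carrier D" "e \<in> carrier D" "c \<noteq> \<zero>"
  shows "Mat2 a b c e = upr (a \<otimes> inv c) \<star> ant (b \<ominus> a \<otimes> inv c \<otimes> e) c \<star> upr (inv c \<otimes> e)"
  using assms nonzero_inv[OF assms(3,5)] by (simp add: m_assoc cancel_inv cancel_add_minus)

lemma pivot12:
  assumes "a \<in> carrier D" "b \<in> carrier D" "c \<in> carrier D" "e \<in> carrier D" "b \<noteq> \<zero>"
  shows "Mat2 a b c e = lwr (e \<otimes> inv b) \<star> ant b (c \<ominus> e \<otimes> inv b \<otimes> a) \<star> lwr (inv b \<otimes> a)"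
  using assms nonzero_inv[OF assms(2,5)] by (simp add: m_assoc cancel_inv cancel_add_minus)

lemma pivot22:
  assumes "a \<in> carrier D" "b \<in> carrier D" "c \<in> carrier D" "e \<in> carrier D" "e \<noteq> \<zero>"
  shows "Mat2 a b c e = upr (b \<otimes> inv e) \<star> dia (a \<ominus> b \<otimes> inv e \<otimes> c) e \<star> lwr (inv e \<otimes> c)"
  using assms nonzero_inv[OF assms(4,5)] by (simp add: m_assoc cancel_inv cancel_add_minus)

lemma weyl_elementary: "weyl = upr (\<ominus> \<one>) \<star> lwr \<one> \<star> upr (\<ominus> \<one>)"
  by (simp add: l_neg r_neg)

text \<open>Elementary factors give access to the reduced norm of this matrix, whose blocks under
  \<open>phi\<close> need not be triangular.\<close>

lemma dia_elementary:
  assumes "x \<in> carrier D" "x \<noteq> \<zero>"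
  shows "dia x (inv x) = upr (\<ominus> x) \<star> lwr (inv x) \<star> upr (\<ominus> x) \<star> ant \<one> (\<ominus> \<one>)"
  using assms nonzero_inv[OF assms] by (simp add: l_minus r_minus l_neg r_neg)

text \<open>The square of \<open>weyl\<close> is minus the identity, so this matrix is both its cube
  and its inverse.\<close>

lemma weyl_cubed_elementary: "ant \<one> (\<ominus> \<one>) = upr \<one> \<star> lwr (\<ominus> \<one>) \<star> upr \<one>"
  by (simp add: l_neg r_neg)

end

section \<open>The valuation and matrices with bounded entries\<close>

context valued_skew_field
begin

lemma val_zero [simp]: "\<omega> \<zero> = \<infinity>"
  using val_eq_infinity_iff by blast

lemma val_finite:
  assumes "x \<in> carrier D" "x \<noteq> \<zero>"
  obtains r where "\<omega> x = ereal r"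
  using assms val_eq_infinity_iff val_neq_minus_infinity by (cases "\<omega> x") auto

lemma val_one [simp]: "\<omega> \<one> = 0"
proof -
  obtain r where "\<omega> \<one> = ereal r" using val_finite one_neq_zero by auto
  moreover have "\<omega> \<one> = \<omega> \<one> + \<omega> \<one>" using val_mult[of \<one> \<one>] by simp
  ultimately show ?thesis by simp
qed

lemma val_uminus [simp]:
  assumes "x \<in> carrier D"
  shows "\<omega> (\<ominus> x) = \<omega> x"
proof -
  have "\<ominus> \<one> \<noteq> \<zero>" using one_neq_zero by (metis minus_minus minus_zero one_closed)
  then obtain r where r: "\<omega> (\<ominus> \<one>) = ereal r" using val_finite[of "\<ominus> \<one>"] by auto
  have "\<omega> (\<ominus> \<one>) + \<omega> (\<ominus> \<one>) = \<omega> \<one>"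
    using val_mult[of "\<ominus> \<one>" "\<ominus> \<one>"] by (simp add: l_minus r_minus)
  then have "\<omega> (\<ominus> \<one>) = 0" using r by simp
  then show ?thesis using val_mult[of "\<ominus> \<one>" x] assms by (simp add: l_minus)
qed

lemma val_inv:
  assumes "x \<in> carrier D" "x \<noteq> \<zero>"
  shows "\<omega> (inv x) = - \<omega> x"
proof -
  obtain r where r: "\<omega> x = ereal r" using assms val_finite by auto
  obtain s where s: "\<omega> (inv x) = ereal s" using nonzero_inv[OF assms] val_finite by metis
  have "\<omega> x + \<omega> (inv x) = 0" using val_mult[of x "inv x"] nonzero_inv[OF assms] assms by simp
  then show ?thesis using r s by auto
qed

lemma val_add_ge:
  assumes "x \<in> carrier D" "y \<in> carrier D" "B \<le> \<omega> x" "B \<le> \<omega> y"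
  shows "B \<le> \<omega> (x \<oplus> y)"
  using val_add[OF assms(1,2)] assms(3,4) by (meson min.boundedI order_trans)

lemma val_mult_ge:
  assumes "x \<in> carrier D" "y \<in> carrier D" "ereal p \<le> \<omega> x" "ereal q \<le> \<omega> y" "B = ereal (p + q)"
  shows "B \<le> \<omega> (x \<otimes> y)"
  unfolding val_mult[OF assms(1,2)] assms(5) using add_mono[OF assms(3,4)] by simp

lemma val_add_eq:
  assumes "x \<in> carrier D" "y \<in> carrier D" "\<omega> x < \<omega> y"
  shows "\<omega> (x \<oplus> y) = \<omega> x"
proof (rule antisym)
  show "\<omega> x \<le> \<omega> (x \<oplus> y)" using assms by (intro val_add_ge) auto
  have "x = (x \<oplus> y) \<oplus> \<ominus> y" using assms by (simp add: a_assoc r_neg)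
  then have "min (\<omega> (x \<oplus> y)) (\<omega> y) \<le> \<omega> x"
    using val_add[of "x \<oplus> y" "\<ominus> y"] assms by simp
  then show "\<omega> (x \<oplus> y) \<le> \<omega> x" using assms(3) by (auto simp: min_def split: if_splits)
qed

lemma val_pow:
  assumes "x \<in> carrier D" "\<omega> x = ereal s"
  shows "\<omega> (x [^] (n::nat)) = ereal (real n * s)"
  by (induction n) (use assms in \<open>auto simp: val_mult algebra_simps zero_ereal_def\<close>)

text \<open>Terms of different valuations cannot cancel: at each step the smaller one decides. The
  hypothesis compares only pairs whose first term is nonzero, so several terms may vanish.\<close>

lemma val_finsum_distinct:
  assumes "finite S" "f \<in> S \<rightarrow> carrier D"
    and "\<And>i j. i \<in> S \<Longrightarrow> j \<in> S \<Longrightarrow> i \<noteq> j \<Longrightarrow> f i \<noteq> \<zero> \<Longrightarrow> \<omega> (f i) \<noteq> \<omega> (f j)"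
  shows "(\<forall>i\<in>S. \<omega> (\<Oplus>i\<in>S. f i) \<le> \<omega> (f i)) \<and>
    ((\<Oplus>i\<in>S. f i) = \<zero> \<or> (\<exists>i\<in>S. f i \<noteq> \<zero> \<and> \<omega> (\<Oplus>i\<in>S. f i) = \<omega> (f i)))"
  using assms
proof (induction S rule: finite_induct)
  case (insert i S)
  let ?s = "\<Oplus>i\<in>S. f i"
  have cl: "f i \<in> carrier D" "?s \<in> carrier D" using insert.prems by (auto intro!: finsum_closed)
  have sum: "(\<Oplus>i\<in>insert i S. f i) = f i \<oplus> ?s" using insert by (intro finsum_insert) auto
  have IH: "\<And>j. j \<in> S \<Longrightarrow> \<omega> ?s \<le> \<omega> (f j)" "?s = \<zero> \<or> (\<exists>j\<in>S. f j \<noteq> \<zero> \<and> \<omega> ?s = \<omega> (f j))"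
    using insert.IH insert.prems by auto
  show ?case
  proof (cases "?s = \<zero>")
    case True
    then have "\<omega> (f j) = \<infinity>" if "j \<in> S" for j using IH(1)[OF that] by simp
    then show ?thesis using True cl unfolding sum by auto
  next
    case False
    then obtain j where j: "j \<in> S" "f j \<noteq> \<zero>" "\<omega> ?s = \<omega> (f j)" using IH(2) by blast
    have "\<omega> (f j) \<noteq> \<omega> (f i)" using j insert.hyps by (intro insert.prems(2)) auto
    then have ne: "\<omega> (f i) \<noteq> \<omega> ?s" using j by simp
    then consider "\<omega> (f i) < \<omega> ?s" | "\<omega> ?s < \<omega> (f i)" by fastforce
    then show ?thesis
    proof cases
      case 1
      then have v: "\<omega> (f i \<oplus> ?s) = \<omega> (f i)" using cl by (intro val_add_eq)
      have "f i \<noteq> \<zero>" using 1 by auto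
      moreover have "\<omega> (f i) \<le> \<omega> (f j)" if "j \<in> S" for j using 1 IH(1)[OF that] by simp
      ultimately show ?thesis unfolding sum v by auto
    next
      case 2
      then have v: "\<omega> (f i \<oplus> ?s) = \<omega> ?s" using cl val_add_eq[of ?s "f i"] by (simp add: a_comm)
      show ?thesis unfolding sum v using 2 IH(1) j by auto
    qed
  qed
qed simp

lemma integral_subring:
  assumes "subring A D"
  shows "subring {x \<in> A. 0 \<le> \<omega> x} D"
proof (rule subringI)
  note A = subringE[OF assms]
  show "{x \<in> A. 0 \<le> \<omega> x} \<subseteq> carrier D" using A(1) by auto
  show "\<one> \<in> {x \<in> A. 0 \<le> \<omega> x}" using A by simp
  fix x assume x: "x \<in> {x \<in> A. 0 \<le> \<omega> x}"
  then show "\<ominus> x \<in> {x \<in> A. 0 \<le> \<omega> x}" using A by (auto simp: subset_iff)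
  fix y assume y: "y \<in> {x \<in> A. 0 \<le> \<omega> x}"
  have c: "x \<in> carrier D" "y \<in> carrier D" using x y A(1) by auto
  show "x \<otimes> y \<in> {x \<in> A. 0 \<le> \<omega> x}" using x y c A by (auto simp: val_mult)
  show "x \<oplus> y \<in> {x \<in> A. 0 \<le> \<omega> x}" using x y c A by (auto intro: val_add_ge)
qed

lemma val_ring_ring: "subring A D \<Longrightarrow> ring (val_ring D \<omega> A)"
  unfolding val_ring_def by (rule subring_is_ring[OF integral_subring])

lemma val_ring_cring: "subcring A D \<Longrightarrow> cring (val_ring D \<omega> A)"
  unfolding val_ring_def
  using subcring_iff[of "{x \<in> A. 0 \<le> \<omega> x}"] subcringI[OF integral_subring[of A]]
    subcring.axioms(1)[of A D] subcringE(1,8)[of A D] by blast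

text \<open>The bounds 0, -x, x, 0 are differences of weights 0 and x attached to the two indices,
  so they add up along a matrix product.\<close>

lemma val_ge_mult:
  assumes "g \<in> carrier M" "h \<in> carrier M" "val_ge \<omega> g x" "val_ge \<omega> h x"
  shows "val_ge \<omega> (g \<star> h) x"
  using assms
proof (elim mat2_carrierE)
  fix a b c e a' b' c' e'
  assume gh: "g = Mat2 a b c e" "h = Mat2 a' b' c' e'"
    and cl: "a \<in> carrier D" "b \<in> carrier D" "c \<in> carrier D" "e \<in> carrier D"
      "a' \<in> carrier D" "b' \<in> carrier D" "c' \<in> carrier D" "e' \<in> carrier D"
  have v: "ereal 0 \<le> \<omega> a" "ereal (- x) \<le> \<omega> b" "ereal x \<le> \<omega> c" "ereal 0 \<le> \<omega> e"
      "ereal 0 \<le> \<omega> a'" "ereal (- x) \<le> \<omega> b'" "ereal x \<le> \<omega> c'" "ereal 0 \<le> \<omega> e'"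
    using assms(3,4) unfolding gh val_ge_def by (simp_all add: zero_ereal_def)
  note ge = val_mult_ge[OF cl(1,5) v(1,5)] val_mult_ge[OF cl(2,7) v(2,7)]
    val_mult_ge[OF cl(1,6) v(1,6)] val_mult_ge[OF cl(2,8) v(2,8)]
    val_mult_ge[OF cl(3,5) v(3,5)] val_mult_ge[OF cl(4,7) v(4,7)]
    val_mult_ge[OF cl(3,6) v(3,6)] val_mult_ge[OF cl(4,8) v(4,8)]
  show ?thesis
    unfolding gh val_ge_def mat2_mult mat2.sel
    using cl by (intro conjI val_add_ge ge) (simp_all add: zero_ereal_def)
qed

section \<open>Elementary and monomial matrices\<close>

definition elem_fix :: "real \<Rightarrow> 'a mat2 set"
  where "elem_fix x = {upr b | b. b \<in> carrier D \<and> ereal (- x) \<le> \<omega> b} \<union> {lwr c | c. c \<in> carrier D \<and> ereal x \<le> \<omega> c}"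

text \<open>The set \<open>N\<close> of the paper is not closed under multiplication unless \<open>D\<close> is commutative, since
  the product of the diagonal matrices of \<open>x\<close> and \<open>y\<close> has lower right entry \<open>x\<inverse>y\<inverse>\<close>. It is replaced
  by all monomial matrices whose entries have valuations adding up to \<open>0\<close>; these differ from
  elements of \<open>N\<close> by diagonal matrices with unit entries.\<close>

definition monomials :: "'a mat2 set"
  where "monomials = {dia a e | a e. a \<in> carrier D \<and> e \<in> carrier D \<and> \<omega> a + \<omega> e = 0}
    \<union> {ant b c | b c. b \<in> carrier D \<and> c \<in> carrier D \<and> \<omega> b + \<omega> c = 0}"

text \<open>This extends \<open>nu\<close> to all of \<open>monomials\<close>. One entry determines
  the map, because the valuation of the other nonzero entry is its negative, and \<open>m11\<close>
  separates diagonal from antidiagonal matrices.\<close>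

definition aff :: "'a mat2 \<Rightarrow> real \<Rightarrow> real"
  where "aff n = (if m11 n \<noteq> \<zero> then (\<lambda>t. t - 2 * real_of_ereal (\<omega> (m11 n)))
    else (\<lambda>t. - 2 * real_of_ereal (\<omega> (m12 n)) - t))"

lemma val_sum_zeroE:
  assumes "a \<in> carrier D" "e \<in> carrier D" "\<omega> a + \<omega> e = 0"
  obtains s where "\<omega> a = ereal s" "\<omega> e = ereal (- s)" "a \<noteq> \<zero>" "e \<noteq> \<zero>"
proof -
  have "a \<noteq> \<zero>" using assms val_neq_minus_infinity[OF assms(2)] by (cases "\<omega> e") auto
  moreover have "e \<noteq> \<zero>" using assms val_neq_minus_infinity[OF assms(1)] by (cases "\<omega> a") auto
  moreover obtain s where "\<omega> a = ereal s" using assms \<open>a \<noteq> \<zero>\<close> val_finite by metis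
  moreover obtain t where "\<omega> e = ereal t" using assms \<open>e \<noteq> \<zero>\<close> val_finite by metis
  ultimately show ?thesis using assms(3) that by (auto simp: zero_ereal_def add_eq_0_iff)
qed

lemma monomialsE [consumes 1, case_names dia ant]:
  assumes "n \<in> monomials"
  obtains a e s where "n = dia a e" "a \<in> carrier D" "e \<in> carrier D" "a \<noteq> \<zero>" "e \<noteq> \<zero>"
      "\<omega> a = ereal s" "\<omega> e = ereal (- s)" "\<And>t. aff n t = t - 2 * s"
    | b c s where "n = ant b c" "b \<in> carrier D" "c \<in> carrier D" "b \<noteq> \<zero>" "c \<noteq> \<zero>"
      "\<omega> b = ereal s" "\<omega> c = ereal (- s)" "\<And>t. aff n t = - 2 * s - t"
proof -
  from assms consider (1) a e where "n = dia a e" "a \<in> carrier D" "e \<in> carrier D" "\<omega> a + \<omega> e = 0"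
    | (2) b c where "n = ant b c" "b \<in> carrier D" "c \<in> carrier D" "\<omega> b + \<omega> c = 0"
    unfolding monomials_def by blast
  then show thesis
  proof cases
    case 1
    obtain s where s: "\<omega> a = ereal s" "\<omega> e = ereal (- s)" "a \<noteq> \<zero>" "e \<noteq> \<zero>"
      using val_sum_zeroE[OF 1(2-4)] .
    show thesis by (rule that(1)[OF 1(1-3) s(3,4,1,2)]) (simp add: 1 s aff_def)
  next
    case 2
    obtain s where s: "\<omega> b = ereal s" "\<omega> c = ereal (- s)" "b \<noteq> \<zero>" "c \<noteq> \<zero>"
      using val_sum_zeroE[OF 2(2-4)] .
    show thesis by (rule that(2)[OF 2(1-3) s(3,4,1,2)]) (simp add: 2 s aff_def)
  qed
qed

lemma monomials_carrier: "n \<in> monomials \<Longrightarrow> n \<in> carrier M"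
  by (auto simp: monomials_def)

lemma dia_monomials:
  "a \<in> carrier D \<Longrightarrow> e \<in> carrier D \<Longrightarrow> \<omega> a + \<omega> e = 0 \<Longrightarrow> dia a e \<in> monomials"
  by (auto simp: monomials_def)

lemma ant_monomials:
  "b \<in> carrier D \<Longrightarrow> c \<in> carrier D \<Longrightarrow> \<omega> b + \<omega> c = 0 \<Longrightarrow> ant b c \<in> monomials"
  by (auto simp: monomials_def)

lemma monomials_mult:
  assumes "m \<in> monomials" "n \<in> monomials"
  shows "m \<star> n \<in> monomials \<and> aff (m \<star> n) t = aff m (aff n t)"
  using assms(1)
proof (cases rule: monomialsE)
  case m: (dia a e s)
  show ?thesis
    using assms(2)
  proof (cases rule: monomialsE)
    case (dia a' e' s')
    have "a \<otimes> a' \<noteq> \<zero>" using m dia by (metis PInfty_neq_ereal(1) plus_ereal.simps(1) val_mult val_zero)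
    then show ?thesis using m dia by (auto intro!: dia_monomials simp: val_mult aff_def)
  next
    case (ant b' c' s')
    then show ?thesis using m by (auto intro!: ant_monomials simp: val_mult aff_def)
  qed
next
  case m: (ant b c s)
  show ?thesis
    using assms(2)
  proof (cases rule: monomialsE)
    case (dia a' e' s')
    then show ?thesis using m by (auto intro!: ant_monomials simp: val_mult aff_def)
  next
    case (ant b' c' s')
    have "b \<otimes> c' \<noteq> \<zero>" using m ant by (metis PInfty_neq_ereal(1) plus_ereal.simps(1) val_mult val_zero)
    then show ?thesis using m ant by (auto intro!: dia_monomials simp: val_mult aff_def)
  qed
qed

text \<open>Inverses are written down explicitly because the ambient matrices form only a monoid.
  The last clause is the conjugation rule: n P_x n^{-1} lies in P_{n x}. Symmetry and transitivity
  of \<open>pt_rel\<close> rest on it.\<close>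

lemma monomials_inv:
  assumes "n \<in> monomials"
  obtains n' where "n' \<in> monomials" "n' \<star> n = \<one>\<^bsub>M\<^esub>" "n \<star> n' = \<one>\<^bsub>M\<^esub>"
    "\<And>x. val_ge \<omega> n x \<Longrightarrow> val_ge \<omega> n' x"
    "\<And>x p. p \<in> carrier M \<Longrightarrow> val_ge \<omega> p x \<Longrightarrow> val_ge \<omega> (n \<star> p \<star> n') (aff n x)"
  using assms
proof (cases rule: monomialsE)
  case (dia a e s)
  note i = nonzero_inv[OF dia(2,4)] nonzero_inv[OF dia(3,5)]
  have v: "\<omega> (inv a) = ereal (- s)" "\<omega> (inv e) = ereal s" using dia val_inv by auto
  show thesis
  proof (rule that[of "dia (inv a) (inv e)"])
    fix x p assume p: "p \<in> carrier M" "val_ge \<omega> p x"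
    then show "val_ge \<omega> (n \<star> p \<star> dia (inv a) (inv e)) (aff n x)"
    proof (elim mat2_carrierE)
      fix a' b' c' e' assume q: "p = Mat2 a' b' c' e'" "a' \<in> carrier D" "b' \<in> carrier D" "c' \<in> carrier D" "e' \<in> carrier D"
      show ?thesis using p q dia i v
        by (cases "\<omega> a'"; cases "\<omega> b'"; cases "\<omega> c'"; cases "\<omega> e'") (auto simp: val_ge_def val_mult)
    qed
  qed (use dia i v in \<open>auto intro!: dia_monomials simp: val_ge_def\<close>)
next
  case (ant b c s)
  note i = nonzero_inv[OF ant(2,4)] nonzero_inv[OF ant(3,5)]
  have v: "\<omega> (inv b) = ereal (- s)" "\<omega> (inv c) = ereal s" using ant val_inv by auto
  show thesis
  proof (rule that[of "ant (inv c) (inv b)"])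
    fix x p assume p: "p \<in> carrier M" "val_ge \<omega> p x"
    then show "val_ge \<omega> (n \<star> p \<star> ant (inv c) (inv b)) (aff n x)"
    proof (elim mat2_carrierE)
      fix a' b' c' e' assume q: "p = Mat2 a' b' c' e'" "a' \<in> carrier D" "b' \<in> carrier D" "c' \<in> carrier D" "e' \<in> carrier D"
      show ?thesis using p q ant i v
        by (cases "\<omega> a'"; cases "\<omega> b'"; cases "\<omega> c'"; cases "\<omega> e'") (auto simp: val_ge_def val_mult)
    qed
  qed (use ant i v in \<open>auto intro!: ant_monomials simp: val_ge_def\<close>)
qed

lemma elem_fix_carrier: "l \<in> elem_fix x \<Longrightarrow> l \<in> carrier M"
  by (auto simp: elem_fix_def)

lemma elem_fix_val_ge: "l \<in> elem_fix x \<Longrightarrow> val_ge \<omega> l x"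
  by (auto simp: elem_fix_def val_ge_def)

lemma elem_fix_inv:
  assumes "l \<in> elem_fix x"
  obtains l' where "l' \<in> elem_fix x" "l' \<star> l = \<one>\<^bsub>M\<^esub>" "l \<star> l' = \<one>\<^bsub>M\<^esub>"
proof -
  from assms consider b where "l = upr b" "b \<in> carrier D" "ereal (- x) \<le> \<omega> b"
    | c where "l = lwr c" "c \<in> carrier D" "ereal x \<le> \<omega> c"
    unfolding elem_fix_def by blast
  then show thesis
  proof cases
    case 1
    then show thesis by (intro that[of "upr (\<ominus> b)"]) (auto simp: elem_fix_def l_neg r_neg)
  next
    case 2
    then show thesis by (intro that[of "lwr (\<ominus> c)"]) (auto simp: elem_fix_def l_neg r_neg)
  qed
qed

lemma val_quotient_ge:
  assumes "a \<in> carrier D" "a \<noteq> \<zero>" "c \<in> carrier D" "\<omega> a + ereal s \<le> \<omega> c"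
  shows "ereal s \<le> \<omega> (c \<otimes> inv a)" "ereal s \<le> \<omega> (inv a \<otimes> c)"
proof -
  obtain r where "\<omega> a = ereal r" using assms val_finite by metis
  then show "ereal s \<le> \<omega> (c \<otimes> inv a)" "ereal s \<le> \<omega> (inv a \<otimes> c)"
    using assms nonzero_inv[OF assms(1,2)] by (cases "\<omega> c"; simp add: val_mult val_inv)+
qed

text \<open>Measure the entries of a matrix with the weights adapted to row operations fixing \<open>y\<close> and
  column operations fixing \<open>x\<close>: an entry of minimal weight is an admissible pivot.\<close>

lemma admissible_pivot:
  assumes g: "g \<in> carrier M" "g \<noteq> dia \<zero> \<zero>"
  obtains l n r where "l \<in> elem_fix y" "r \<in> elem_fix x" "g = l \<star> n \<star> r"
    "(\<exists>a e. a \<in> carrier D \<and> e \<in> carrier D \<and> n = dia a e) \<or> (\<exists>b c. b \<in> carrier D \<and> c \<in> carrier D \<and> n = ant b c)"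
proof -
  from g(1) obtain a b c e where g_eq: "g = Mat2 a b c e"
    and cl: "a \<in> carrier D" "b \<in> carrier D" "c \<in> carrier D" "e \<in> carrier D"
    by (elim mat2_carrierE)
  \<comment> \<open>The right column is shifted by x and the lower row by -y. Thus
    \<open>wa \<le> wc\<close> says that the row multiplier c a^{-1} has valuation at least y, and
    \<open>wa \<le> wb\<close> that the column multiplier a^{-1} b has valuation at least
    -x.\<close>
  define wa wb wc we where w_def: "wa = \<omega> a" "wb = \<omega> b + ereal x" "wc = \<omega> c + ereal (- y)" "we = \<omega> e + ereal (x - y)"
  consider (a) "wa \<le> wb" "wa \<le> wc" "wa \<le> we" | (b) "wb \<le> wa" "wb \<le> wc" "wb \<le> we"
    | (c) "wc \<le> wa" "wc \<le> wb" "wc \<le> we" | (e) "we \<le> wa" "we \<le> wb" "we \<le> wc"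
    using linear[of wa wb] linear[of wa wc] linear[of wa we] linear[of wb wc] linear[of wb we] linear[of wc we]
    by (elim disjE) (blast intro: order_trans)+
  then show thesis
  proof cases
    case a
    \<comment> \<open>If the least weight were infinite, all entries would be zero.\<close>
    have nz: "a \<noteq> \<zero>"
      using a g cl unfolding g_eq w_def by (auto simp: val_eq_infinity_iff)
    then obtain s where s: "\<omega> a = ereal s" using cl val_finite by metis
    have "\<omega> a + ereal y \<le> \<omega> c" using a s unfolding w_def by (cases "\<omega> c") auto
    moreover have "\<omega> a + ereal (- x) \<le> \<omega> b" using a s unfolding w_def by (cases "\<omega> b") auto
    ultimately show thesis
      using cl nz nonzero_inv[OF cl(1) nz]
      by (intro that[OF _ _ pivot11[OF cl nz, folded g_eq]]) (auto simp: elem_fix_def intro: val_quotient_ge)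
  next
    case b
    have nz: "b \<noteq> \<zero>"
      using b g cl unfolding g_eq w_def by (auto simp: val_eq_infinity_iff)
    then obtain s where s: "\<omega> b = ereal s" using cl val_finite by metis
    have "\<omega> b + ereal y \<le> \<omega> e" using b s unfolding w_def by (cases "\<omega> e") auto
    moreover have "\<omega> b + ereal x \<le> \<omega> a" using b s unfolding w_def by (cases "\<omega> a") auto
    ultimately show thesis
      using cl nz nonzero_inv[OF cl(2) nz]
      by (intro that[OF _ _ pivot12[OF cl nz, folded g_eq]]) (auto simp: elem_fix_def intro: val_quotient_ge)
  next
    case c
    have nz: "c \<noteq> \<zero>"
      using c g cl unfolding g_eq w_def by (auto simp: val_eq_infinity_iff)
    then obtain s where s: "\<omega> c = ereal s" using cl val_finite by metis
    have "\<omega> c + ereal (- y) \<le> \<omega> a" using c s unfolding w_def by (cases "\<omega> a") auto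
    moreover have "\<omega> c + ereal (- x) \<le> \<omega> e" using c s unfolding w_def by (cases "\<omega> e") auto
    ultimately show thesis
      using cl nz nonzero_inv[OF cl(3) nz]
      by (intro that[OF _ _ pivot21[OF cl nz, folded g_eq]]) (auto simp: elem_fix_def intro: val_quotient_ge)
  next
    case e
    have nz: "e \<noteq> \<zero>"
      using e g cl unfolding g_eq w_def by (auto simp: val_eq_infinity_iff)
    then obtain s where s: "\<omega> e = ereal s" using cl val_finite by metis
    have "\<omega> e + ereal (- y) \<le> \<omega> b" using e s unfolding w_def by (cases "\<omega> b") auto
    moreover have "\<omega> e + ereal x \<le> \<omega> c" using e s unfolding w_def by (cases "\<omega> c") auto
    ultimately show thesis
      using cl nz nonzero_inv[OF cl(4) nz]
      by (intro that[OF _ _ pivot22[OF cl nz, folded g_eq]]) (auto simp: elem_fix_def intro: val_quotient_ge)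
  qed
qed

end

section \<open>Points of apartments\<close>

text \<open>\<open>v\<close> plays the role of the valuation of the Dieudonne determinant.\<close>

locale valued_skew_field_det = valued_skew_field D \<omega>
  for D :: "('a, 'b) ring_scheme" (structure) and \<omega> :: "'a \<Rightarrow> ereal" +
  fixes v :: "'a mat2 \<Rightarrow> ereal"
  assumes v_mult: "\<lbrakk>g \<in> carrier (mat2_monoid D); h \<in> carrier (mat2_monoid D)\<rbrakk>
      \<Longrightarrow> v (g \<otimes>\<^bsub>mat2_monoid D\<^esub> h) = v g + v h"
    and v_upr: "b \<in> carrier D \<Longrightarrow> v (upr b) = 0"
    and v_lwr: "c \<in> carrier D \<Longrightarrow> v (lwr c) = 0"
    and v_dia: "\<lbrakk>a \<in> carrier D; e \<in> carrier D\<rbrakk> \<Longrightarrow> v (dia a e) = 0 \<longleftrightarrow> \<omega> a + \<omega> e = 0"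
begin

definition unimod :: "'a mat2 monoid"
  where "unimod = M\<lparr>carrier := {g \<in> carrier M. v g = 0}\<rparr>"

abbreviation uinv where "uinv \<equiv> m_inv unimod"

definition fixer :: "real \<Rightarrow> 'a mat2 set"
  where "fixer x = point_stab unimod \<omega> x"

definition pt_rel :: "'a mat2 \<Rightarrow> real \<Rightarrow> 'a mat2 \<Rightarrow> real \<Rightarrow> bool"
  where "pt_rel g x h y \<longleftrightarrow>
    (\<exists>n\<in>monomials. aff n x = y \<and> uinv g \<star> h \<star> n \<in> fixer x)"

sublocale M: monoid M
  by (rule monoid_mat2)

lemma unimod_simps [simp]:
  "\<one>\<^bsub>unimod\<^esub> = \<one>\<^bsub>M\<^esub>" "g \<otimes>\<^bsub>unimod\<^esub> h = g \<star> h"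
  by (simp_all add: unimod_def)

lemma unimod_carrier: "g \<in> carrier unimod \<longleftrightarrow> g \<in> carrier M \<and> v g = 0"
  by (simp add: unimod_def)

lemma unimod_elem_fix: "l \<in> elem_fix x \<Longrightarrow> l \<in> carrier unimod"
  by (auto simp: unimod_carrier elem_fix_def v_upr v_lwr)

lemma unimod_mult: "g \<in> carrier unimod \<Longrightarrow> h \<in> carrier unimod \<Longrightarrow> g \<star> h \<in> carrier unimod"
  by (simp add: unimod_carrier v_mult)

lemma unimod_one: "\<one>\<^bsub>M\<^esub> \<in> carrier unimod"
  using v_upr[of \<zero>] by (simp add: unimod_carrier)

lemma unimod_weyl: "weyl \<in> carrier unimod"
proof -
  have "upr (\<ominus> \<one>) \<in> carrier unimod" "lwr \<one> \<in> carrier unimod"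
    by (simp_all add: unimod_carrier v_upr v_lwr)
  then show ?thesis unfolding weyl_elementary by (intro unimod_mult)
qed

lemma ant_eq_weyl_dia:
  assumes "b \<in> carrier D" "c \<in> carrier D"
  shows "ant b c = weyl \<star> dia c (\<ominus> b)"
  using assms by (simp add: l_minus r_minus)

lemma v_ant: "\<lbrakk>b \<in> carrier D; c \<in> carrier D\<rbrakk> \<Longrightarrow> v (ant b c) = 0 \<longleftrightarrow> \<omega> b + \<omega> c = 0"
  using v_mult[of weyl "dia c (\<ominus> b)"] unimod_weyl v_dia[of c "\<ominus> b"] ant_eq_weyl_dia[of b c]
  by (auto simp: unimod_carrier add.commute simp del: mat2_mult)

lemma unimod_monomials: "n \<in> monomials \<Longrightarrow> n \<in> carrier unimod"
  by (auto simp: monomials_def unimod_carrier v_dia v_ant)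

text \<open>This is G = P_y N P_x, the fact that two points of the tree lie in a common apartment,
  with a single elementary matrix taken from each stabiliser. Both points are free: y = x yields
  inverses, y = 0 integral representatives.\<close>

lemma unimod_decomposition:
  assumes "g \<in> carrier unimod"
  obtains l n r where "l \<in> elem_fix y" "r \<in> elem_fix x" "n \<in> monomials" "g = l \<star> n \<star> r"
proof -
  have "v (dia \<zero> \<zero>) \<noteq> 0" using v_dia[of \<zero> \<zero>] by simp
  then have g: "g \<in> carrier M" "g \<noteq> dia \<zero> \<zero>" "v g = 0" using assms by (auto simp: unimod_carrier)
  obtain l n r where d: "l \<in> elem_fix y" "r \<in> elem_fix x" "g = l \<star> n \<star> r"
    and n: "(\<exists>a e. a \<in> carrier D \<and> e \<in> carrier D \<and> n = dia a e) \<or> (\<exists>b c. b \<in> carrier D \<and> c \<in> carrier D \<and> n = ant b c)"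
    using admissible_pivot[OF g(1,2)] .
  have nM: "n \<in> carrier M" using n by auto
  have "v n = 0"
    using g(3) d nM unimod_elem_fix by (auto simp: unimod_carrier v_mult simp del: mat2_mult)
  then have "n \<in> monomials" using n by (auto intro: dia_monomials ant_monomials simp: v_dia v_ant)
  then show thesis using that d by blast
qed

lemma fixer_iff: "g \<in> fixer x \<longleftrightarrow> g \<in> carrier unimod \<and> val_ge \<omega> g x"
  by (simp add: fixer_def point_stab_def)

lemma fixer_mult: "g \<in> fixer x \<Longrightarrow> h \<in> fixer x \<Longrightarrow> g \<star> h \<in> fixer x"
  using val_ge_mult by (auto simp: fixer_iff unimod_mult unimod_carrier[of g] unimod_carrier[of h])

lemma fixer_elem_fix: "elem_fix x \<subseteq> fixer x"
  using unimod_elem_fix elem_fix_val_ge by (auto simp: fixer_iff)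

text \<open>The inverse is assembled from the decomposition. With both points equal to x the
  elementary factors lie in the stabiliser; if \<open>g\<close> does too, then so does its monomial
  factor, whose inverse obeys the same bounds.\<close>

lemma unimod_inverse_ex:
  assumes "g \<in> carrier unimod"
  obtains h where "h \<in> carrier unimod" "h \<star> g = \<one>\<^bsub>M\<^esub>" "val_ge \<omega> g x \<Longrightarrow> val_ge \<omega> h x"
proof -
  obtain l n r where d: "l \<in> elem_fix x" "r \<in> elem_fix x" "n \<in> monomials" "g = l \<star> n \<star> r"
    using unimod_decomposition[OF assms] .
  obtain l' where l: "l' \<in> elem_fix x" "l' \<star> l = \<one>\<^bsub>M\<^esub>" "l \<star> l' = \<one>\<^bsub>M\<^esub>"
    using elem_fix_inv[OF d(1)] .
  obtain r' where r: "r' \<in> elem_fix x" "r' \<star> r = \<one>\<^bsub>M\<^esub>" "r \<star> r' = \<one>\<^bsub>M\<^esub>"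
    using elem_fix_inv[OF d(2)] .
  obtain n' where n: "n' \<in> monomials" "n' \<star> n = \<one>\<^bsub>M\<^esub>" "val_ge \<omega> n x \<Longrightarrow> val_ge \<omega> n' x"
    using monomials_inv[OF d(3)] by metis
  have cl: "l \<in> carrier M" "r \<in> carrier M" "l' \<in> carrier M" "r' \<in> carrier M" "n \<in> carrier M" "n' \<in> carrier M"
    using d l r n elem_fix_carrier monomials_carrier by blast+
  show thesis
  proof (rule that[of "r' \<star> n' \<star> l'"])
    show "r' \<star> n' \<star> l' \<in> carrier unimod"
      using l r n by (intro unimod_mult unimod_elem_fix unimod_monomials)
    have "r' \<star> n' \<star> l' \<star> g = r' \<star> (n' \<star> ((l' \<star> l) \<star> n) \<star> r)"
      unfolding d(4) using cl by (simp add: M.m_assoc del: mat2_one)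
    then show "r' \<star> n' \<star> l' \<star> g = \<one>\<^bsub>M\<^esub>"
      using l r n cl by (simp del: mat2_one)
    assume g: "val_ge \<omega> g x"
    have "l' \<star> g \<star> r' = (l' \<star> l) \<star> n \<star> (r \<star> r')"
      unfolding d(4) using cl by (simp add: M.m_assoc del: mat2_one)
    then have "n = l' \<star> g \<star> r'" using l r cl by (simp del: mat2_one)
    then have "val_ge \<omega> n x"
      using g l r cl assms elem_fix_val_ge by (auto intro!: val_ge_mult simp: unimod_carrier simp del: mat2_one)
    then show "val_ge \<omega> (r' \<star> n' \<star> l') x"
      using l r n cl elem_fix_val_ge by (auto intro!: val_ge_mult)
  qed
qed

sublocale unimod: group unimod
proof (rule groupI)
  fix g assume "g \<in> carrier unimod"
  then obtain h where "h \<in> carrier unimod" "h \<star> g = \<one>\<^bsub>M\<^esub>" using unimod_inverse_ex by metis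
  then show "\<exists>h\<in>carrier unimod. h \<otimes>\<^bsub>unimod\<^esub> g = \<one>\<^bsub>unimod\<^esub>" by auto
qed (use unimod_one unimod_mult in \<open>auto simp: unimod_carrier M.m_assoc simp del: mat2_one\<close>)

lemma fixer_subgroup: "subgroup (fixer x) unimod"
proof (rule unimod.subgroupI)
  fix g assume g: "g \<in> fixer x"
  then obtain h where "h \<in> carrier unimod" "h \<star> g = \<one>\<^bsub>M\<^esub>" "val_ge \<omega> h x"
    using unimod_inverse_ex[of g x] by (auto simp: fixer_iff)
  then show "uinv g \<in> fixer x"
    using g unimod.inv_equality[of h g] by (simp add: fixer_iff)
next
  have "\<one>\<^bsub>M\<^esub> \<in> fixer x" using unimod_one by (simp add: fixer_iff val_ge_def)
  then show "fixer x \<noteq> {}" by blast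
next
  show "fixer x \<subseteq> carrier unimod" by (auto simp: fixer_iff)
qed (simp add: fixer_mult)

lemma monomials_unimod_inv:
  assumes "n \<in> monomials"
  shows "uinv n \<in> monomials" "aff (uinv n) (aff n x) = x"
    "p \<in> fixer x \<Longrightarrow> n \<star> p \<star> uinv n \<in> fixer (aff n x)"
proof -
  obtain n' where n: "n' \<in> monomials" "n' \<star> n = \<one>\<^bsub>M\<^esub>"
      "\<And>x p. p \<in> carrier M \<Longrightarrow> val_ge \<omega> p x \<Longrightarrow> val_ge \<omega> (n \<star> p \<star> n') (aff n x)"
    using monomials_inv[OF assms] by metis
  have eq: "uinv n = n'"
    using unimod.inv_equality[of n' n] n assms unimod_monomials by simp
  show "uinv n \<in> monomials" using n eq by simp
  have "aff (n' \<star> n) x = x" unfolding n(2) using one_neq_zero by (simp add: aff_def)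
  then show "aff (uinv n) (aff n x) = x" using monomials_mult[OF n(1) assms] eq by simp
  show "n \<star> p \<star> uinv n \<in> fixer (aff n x)" if "p \<in> fixer x"
    using that n assms by (simp add: eq fixer_iff unimod_monomials unimod_mult unimod_carrier[of p])
qed

section \<open>The equivalence relation on pairs of a matrix and a point\<close>

lemma pt_rel_refl:
  assumes "g \<in> carrier unimod"
  shows "pt_rel g x g x"
proof -
  have "\<one>\<^bsub>M\<^esub> \<in> monomials" by (auto intro: dia_monomials)
  moreover have "aff \<one>\<^bsub>M\<^esub> x = x" using one_neq_zero by (simp add: aff_def)
  moreover have "uinv g \<star> g \<star> \<one>\<^bsub>M\<^esub> \<in> fixer x"
    using unimod.l_inv[OF assms] subgroup.one_closed[OF fixer_subgroup, of x] by simp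
  ultimately show ?thesis unfolding pt_rel_def by blast
qed

lemma pt_rel_sym:
  assumes g: "g \<in> carrier unimod" and h: "h \<in> carrier unimod" and gh: "pt_rel g x h y"
  shows "pt_rel h y g x"
proof -
  obtain n where n: "n \<in> monomials" "aff n x = y" "uinv g \<star> h \<star> n \<in> fixer x"
    using gh unfolding pt_rel_def by blast
  let ?p = "uinv g \<otimes>\<^bsub>unimod\<^esub> h \<otimes>\<^bsub>unimod\<^esub> n"
  have nc: "n \<in> carrier unimod" using n unimod_monomials by blast
  \<comment> \<open>The inverse of p = g^{-1} h n lies in P_x; conjugation by n moves it to P_y and
    turns it into h^{-1} g n^{-1}.\<close>
  have "uinv ?p \<in> fixer x" using n by (auto intro: subgroup.m_inv_closed[OF fixer_subgroup])
  then have "n \<star> uinv ?p \<star> uinv n \<in> fixer y"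
    using monomials_unimod_inv(3)[OF n(1)] n(2) by blast
  moreover have "n \<otimes>\<^bsub>unimod\<^esub> uinv ?p \<otimes>\<^bsub>unimod\<^esub> uinv n
      = uinv h \<otimes>\<^bsub>unimod\<^esub> g \<otimes>\<^bsub>unimod\<^esub> uinv n"
    using g h nc
    by (simp add: unimod.inv_mult_group unimod.m_assoc[symmetric] del: unimod_simps)
  ultimately have "uinv h \<star> g \<star> uinv n \<in> fixer y" by simp
  then show ?thesis
    unfolding pt_rel_def using monomials_unimod_inv(1,2)[OF n(1)] n(2) by blast
qed

text \<open>The witness is the product m n, so closure of \<open>monomials\<close> under
  multiplication enters here. The second membership holds in P_y and is brought back to P_x by
  conjugation with n^{-1}.\<close>

lemma pt_rel_trans:
  assumes g: "g \<in> carrier unimod" and h: "h \<in> carrier unimod" and k: "k \<in> carrier unimod"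
    and gh: "pt_rel g x h y" and hk: "pt_rel h y k z"
  shows "pt_rel g x k z"
proof -
  obtain n where n: "n \<in> monomials" "aff n x = y" "uinv g \<star> h \<star> n \<in> fixer x"
    using gh unfolding pt_rel_def by blast
  obtain m where m: "m \<in> monomials" "aff m y = z" "uinv h \<star> k \<star> m \<in> fixer y"
    using hk unfolding pt_rel_def by blast
  have nc: "n \<in> carrier unimod" "m \<in> carrier unimod" using n m unimod_monomials by blast+
  have inn: "uinv (uinv n) = n" using nc by simp
  have "uinv n \<star> (uinv h \<star> k \<star> m) \<star> uinv (uinv n) \<in> fixer (aff (uinv n) y)"
    using monomials_unimod_inv(1,3) n m by blast
  then have "uinv n \<star> (uinv h \<star> k \<star> m) \<star> n \<in> fixer x"
    using monomials_unimod_inv(2)[OF n(1), of x] n(2) inn by simp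
  then have "(uinv g \<star> h \<star> n) \<star> (uinv n \<star> (uinv h \<star> k \<star> m) \<star> n) \<in> fixer x"
    using n(3) by (rule fixer_mult[rotated])
  moreover have "(uinv g \<otimes>\<^bsub>unimod\<^esub> h \<otimes>\<^bsub>unimod\<^esub> n) \<otimes>\<^bsub>unimod\<^esub> (uinv n \<otimes>\<^bsub>unimod\<^esub> (uinv h \<otimes>\<^bsub>unimod\<^esub> k \<otimes>\<^bsub>unimod\<^esub> m) \<otimes>\<^bsub>unimod\<^esub> n)
      = uinv g \<otimes>\<^bsub>unimod\<^esub> (h \<otimes>\<^bsub>unimod\<^esub> ((n \<otimes>\<^bsub>unimod\<^esub> uinv n) \<otimes>\<^bsub>unimod\<^esub> uinv h)) \<otimes>\<^bsub>unimod\<^esub> (k \<otimes>\<^bsub>unimod\<^esub> (m \<otimes>\<^bsub>unimod\<^esub> n))"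
    using g h k nc by (simp add: unimod.m_assoc del: unimod_simps unimod.r_inv unimod.Units_r_inv)
  moreover have "\<dots> = uinv g \<otimes>\<^bsub>unimod\<^esub> k \<otimes>\<^bsub>unimod\<^esub> (m \<otimes>\<^bsub>unimod\<^esub> n)"
    using g h k nc by (simp add: unimod.m_assoc del: unimod_simps)
  ultimately have "uinv g \<star> k \<star> (m \<star> n) \<in> fixer x" by simp
  then show ?thesis
    unfolding pt_rel_def using monomials_mult[OF m(1) n(1)] n(2) m(2) by metis
qed

lemma pt_rel_left_mult:
  assumes "k \<in> carrier unimod" "g \<in> carrier unimod" "h \<in> carrier unimod"
  shows "pt_rel (k \<star> g) x (k \<star> h) y \<longleftrightarrow> pt_rel g x h y"
proof -
  have "uinv (k \<otimes>\<^bsub>unimod\<^esub> g) \<otimes>\<^bsub>unimod\<^esub> (k \<otimes>\<^bsub>unimod\<^esub> h) = uinv g \<otimes>\<^bsub>unimod\<^esub> h"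
    using assms by (simp add: unimod.inv_mult_group unimod.m_assoc unimod.inv_solve_left' del: unimod_simps)
  then show ?thesis unfolding pt_rel_def by simp
qed

lemma unit_dia_fixer:
  assumes "a \<in> carrier D" "e \<in> carrier D" "\<omega> a = 0" "\<omega> e = 0"
  shows "dia a e \<in> fixer x"
  using assms by (simp add: fixer_iff unimod_carrier v_dia val_ge_def)

lemma torus_subset_monomials: "torus D \<union> antitorus D \<subseteq> monomials"
proof
  fix n assume "n \<in> torus D \<union> antitorus D"
  then consider x where "x \<in> carrier D" "x \<noteq> \<zero>" "n = dia x (inv x)"
    | x where "x \<in> carrier D" "x \<noteq> \<zero>" "n = ant (\<ominus> x) (inv x)"
    by (auto simp: torus_def antitorus_def)
  then show "n \<in> monomials"
  proof cases
    case 1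
    obtain s where "\<omega> x = ereal s" using 1 val_finite by metis
    then show ?thesis using 1 nonzero_inv[OF 1(1,2)] by (auto intro!: dia_monomials simp: val_inv zero_ereal_def)
  next
    case 2
    obtain s where "\<omega> x = ereal s" using 2 val_finite by metis
    then show ?thesis using 2 nonzero_inv[OF 2(1,2)] by (auto intro!: ant_monomials simp: val_inv zero_ereal_def)
  qed
qed

lemma nu_eq_aff:
  assumes "n \<in> torus D \<union> antitorus D"
  shows "nu D \<omega> n = aff n"
proof (cases "n \<in> torus D")
  case True
  then have "m11 n \<noteq> \<zero>" unfolding torus_def by auto
  then show ?thesis using True by (simp add: nu_def aff_def)
next
  case False
  then have "m11 n = \<zero>" using assms by (auto simp: antitorus_def)
  then show ?thesis using False by (simp add: nu_def aff_def)
qed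

text \<open>Multiplying \<open>n\<close> on the right by a diagonal matrix with unit entries changes
  neither its action on the apartment nor the membership in P_x, and this freedom is enough to reach
  the torus or the antitorus.\<close>

lemma pt_rel_iff_torus:
  assumes "g \<in> carrier unimod" "h \<in> carrier unimod"
  shows "pt_rel g x h y \<longleftrightarrow>
    (\<exists>n \<in> torus D \<union> antitorus D. nu D \<omega> n x = y \<and> uinv g \<star> h \<star> n \<in> fixer x)"
proof
  assume "pt_rel g x h y"
  then obtain n where n: "n \<in> monomials" "aff n x = y" "uinv g \<star> h \<star> n \<in> fixer x"
    unfolding pt_rel_def by blast
  obtain t where t: "t \<in> fixer x" "n \<star> t \<in> torus D \<union> antitorus D" "aff (n \<star> t) x = aff n x"
    using n(1)
  proof (cases rule: monomialsE)
    case (dia a e s)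
    note i = nonzero_inv[OF dia(2,4)] nonzero_inv[OF dia(3,5)]
    \<comment> \<open>The lower right entry has to become a^{-1}; the correction e^{-1} a^{-1} is a
      unit because \<open>a\<close> and \<open>e\<close> have opposite valuations.\<close>
    let ?t = "dia \<one> (inv e \<otimes> inv a)"
    have "?t \<in> fixer x" using dia i by (intro unit_dia_fixer) (auto simp: val_mult val_inv zero_ereal_def)
    moreover have "n \<star> ?t = dia a (inv a)" using dia i by (simp add: cancel_inv)
    ultimately show thesis
      using dia by (intro that[of ?t]) (auto simp: torus_def aff_def)
  next
    case (ant b c s)
    note i = nonzero_inv[OF ant(2,4)] nonzero_inv[OF ant(3,5)]
    have b: "\<ominus> b \<in> carrier D" "\<ominus> b \<noteq> \<zero>" using ant by auto
    note i' = nonzero_inv[OF b]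
    let ?t = "dia (inv c \<otimes> inv (\<ominus> b)) \<one>"
    have "?t \<in> fixer x" using ant i b i' by (intro unit_dia_fixer) (auto simp: val_mult val_inv zero_ereal_def)
    moreover have eq: "n \<star> ?t = ant (\<ominus> (\<ominus> b)) (inv (\<ominus> b))"
      using ant i i' by (simp add: cancel_inv)
    moreover have "\<dots> \<in> antitorus D" unfolding antitorus_def using b by blast
    moreover have "aff (n \<star> ?t) x = aff n x" unfolding eq using ant by (simp add: aff_def)
    ultimately show thesis by (intro that[of ?t]) (simp_all del: mat2_mult)
  qed
  have c: "n \<in> carrier M" "t \<in> carrier M" "uinv g \<in> carrier M" "h \<in> carrier M"
    using assms n t monomials_carrier unimod.inv_closed[OF assms(1)] by (auto simp: fixer_iff unimod_carrier)
  have "uinv g \<star> h \<star> n \<star> t \<in> fixer x" using n(3) t(1) by (rule fixer_mult)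
  then have "uinv g \<star> h \<star> (n \<star> t) \<in> fixer x" using c by (simp add: M.m_assoc)
  then show "\<exists>n \<in> torus D \<union> antitorus D. nu D \<omega> n x = y \<and> uinv g \<star> h \<star> n \<in> fixer x"
    using n t nu_eq_aff by metis
qed (use torus_subset_monomials nu_eq_aff in \<open>unfold pt_rel_def, fastforce\<close>)

text \<open>Modulo the maximal ideal the matrix stays invertible, so no row or column has both
  entries of positive valuation. Rows are tested with g g^{-1} = 1, columns with g^{-1} g =
  1.\<close>

lemma fixer_zero_unit_entries:
  assumes "Mat2 a b c e \<in> fixer 0"
  shows "0 < \<omega> a \<Longrightarrow> \<omega> b = 0 \<and> \<omega> c = 0" "0 < \<omega> e \<Longrightarrow> \<omega> b = 0 \<and> \<omega> c = 0"
    "0 < \<omega> b \<Longrightarrow> \<omega> a = 0 \<and> \<omega> e = 0" "0 < \<omega> c \<Longrightarrow> \<omega> a = 0 \<and> \<omega> e = 0"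
proof -
  let ?g = "Mat2 a b c e"
  have g: "?g \<in> carrier unimod" "uinv ?g \<in> fixer 0"
    using assms subgroup.m_inv_closed[OF fixer_subgroup] by (auto simp: fixer_iff)
  obtain a' b' c' e' where h: "uinv ?g = Mat2 a' b' c' e'" by (cases "uinv ?g")
  have cl: "a \<in> carrier D" "b \<in> carrier D" "c \<in> carrier D" "e \<in> carrier D"
      "a' \<in> carrier D" "b' \<in> carrier D" "c' \<in> carrier D" "e' \<in> carrier D"
    using g unfolding h by (auto simp: fixer_iff unimod_carrier)
  have nn: "0 \<le> \<omega> a" "0 \<le> \<omega> b" "0 \<le> \<omega> c" "0 \<le> \<omega> e" "0 \<le> \<omega> a'" "0 \<le> \<omega> b'" "0 \<le> \<omega> c'" "0 \<le> \<omega> e'"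
    using assms g(2) unfolding h by (auto simp: fixer_iff val_ge_def zero_ereal_def[symmetric])
  have eq: "a \<otimes> a' \<oplus> b \<otimes> c' = \<one>" "c \<otimes> b' \<oplus> e \<otimes> e' = \<one>" "a' \<otimes> a \<oplus> b' \<otimes> c = \<one>" "c' \<otimes> b \<oplus> e' \<otimes> e = \<one>"
    using unimod.r_inv[OF g(1)] unimod.l_inv[OF g(1)] unfolding h by auto
  \<comment> \<open>The element 1 has valuation 0, so it is not a sum of two elements of positive
    valuation.\<close>
  have pos: "False" if "x \<otimes> x' \<oplus> y \<otimes> y' = \<one>" "0 < \<omega> (x \<otimes> x')" "0 < \<omega> (y \<otimes> y')"
    "x \<in> carrier D" "x' \<in> carrier D" "y \<in> carrier D" "y' \<in> carrier D" for x x' y y'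
    using val_add[of "x \<otimes> x'" "y \<otimes> y'"] that by (auto simp: min_def split: if_splits)
  have m: "0 < \<omega> (x \<otimes> y)" "0 < \<omega> (y \<otimes> x)" if "0 < \<omega> x" "0 \<le> \<omega> y" "x \<in> carrier D" "y \<in> carrier D" for x y
    using that by (auto simp: val_mult intro: add_pos_nonneg add_nonneg_pos)
  have z: "\<omega> x = 0" if "\<not> 0 < \<omega> x" "x \<in> {a, b, c, e}" for x
    using that nn by (intro antisym) auto
  have ab: "\<not> (0 < \<omega> a \<and> 0 < \<omega> b)"
    using pos[OF eq(1)] m(1)[of a a'] m(1)[of b c'] nn cl by blast
  have ce: "\<not> (0 < \<omega> c \<and> 0 < \<omega> e)"
    using pos[OF eq(2)] m(1)[of c b'] m(1)[of e e'] nn cl by blast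
  have ac: "\<not> (0 < \<omega> a \<and> 0 < \<omega> c)"
    using pos[OF eq(3)] m(2)[of a a'] m(2)[of c b'] nn cl by blast
  have be: "\<not> (0 < \<omega> b \<and> 0 < \<omega> e)"
    using pos[OF eq(4)] m(2)[of b c'] m(2)[of e e'] nn cl by blast
  show "0 < \<omega> a \<Longrightarrow> \<omega> b = 0 \<and> \<omega> c = 0" using ab ac z[of b, simplified] z[of c, simplified] by blast
  show "0 < \<omega> e \<Longrightarrow> \<omega> b = 0 \<and> \<omega> c = 0" using be ce z[of b, simplified] z[of c, simplified] by blast
  show "0 < \<omega> b \<Longrightarrow> \<omega> a = 0 \<and> \<omega> e = 0" using ab be z[of a, simplified] z[of e, simplified] by blast
  show "0 < \<omega> c \<Longrightarrow> \<omega> a = 0 \<and> \<omega> e = 0" using ac ce z[of a, simplified] z[of e, simplified] by blast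
qed

text \<open>The two coordinates agree up to sign, so the monomial matrix can be chosen among \<open>1\<close> and
  \<open>weyl\<close>, although the given one need not have integral entries.\<close>

lemma pt_rel_integral:
  assumes k: "uinv g \<star> h \<in> fixer 0"
  shows "pt_rel g x h y \<longleftrightarrow>
    (y = x \<and> uinv g \<star> h \<in> fixer x) \<or> (y = - x \<and> uinv g \<star> h \<star> weyl \<in> fixer x)"
proof -
  define k where "k = uinv g \<star> h"
  have kf: "k \<in> fixer 0" and ku: "k \<in> carrier unimod" using assms by (auto simp: k_def fixer_iff)
  obtain a b c e where k_eq: "k = Mat2 a b c e" by (cases k)
  have cl: "a \<in> carrier D" "b \<in> carrier D" "c \<in> carrier D" "e \<in> carrier D"
    using ku by (auto simp: k_eq unimod_carrier)
  have nn: "0 \<le> \<omega> a" "0 \<le> \<omega> b" "0 \<le> \<omega> c" "0 \<le> \<omega> e"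
    using kf by (auto simp: k_eq fixer_iff val_ge_def zero_ereal_def[symmetric])
  note unit = fixer_zero_unit_entries[OF kf[unfolded k_eq]]
  have kw: "k \<star> weyl = Mat2 b (\<ominus> a) e (\<ominus> c)" using cl by (simp add: k_eq r_minus)
  have kwu: "k \<star> weyl \<in> carrier unimod" using ku unimod_weyl by (rule unimod_mult)
  have kI: "k \<in> fixer x" if "ereal (- x) \<le> \<omega> b" "ereal x \<le> \<omega> c"
    using that nn ku by (simp add: fixer_iff val_ge_def k_eq)
  have kwI: "k \<star> weyl \<in> fixer x" if "ereal (- x) \<le> \<omega> a" "ereal x \<le> \<omega> e"
    using that nn kwu cl unfolding kw by (simp add: fixer_iff val_ge_def)
  have shift: "ereal (t - s) \<le> w" if "ereal t \<le> w + ereal s" for t s w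
    using that by (cases w) auto
  have below: "ereal t \<le> w" if "t \<le> 0" "0 \<le> w" for t w
    using that by (cases w) auto
  have pos: "0 < w" if "ereal t \<le> w" "0 < t" for t w
    using that by (cases w) auto
  have "(y = x \<and> k \<in> fixer x) \<or> (y = - x \<and> k \<star> weyl \<in> fixer x)"
    if n: "n \<in> monomials" "aff n x = y" "k \<star> n \<in> fixer x" for n
    using n(1)
  proof (cases rule: monomialsE)
    case (dia a' e' s)
    have "k \<star> n = Mat2 (a \<otimes> a') (b \<otimes> e') (c \<otimes> a') (e \<otimes> e')"
      unfolding k_eq dia(1) using cl dia(2,3) by simp
    then have "val_ge \<omega> (Mat2 (a \<otimes> a') (b \<otimes> e') (c \<otimes> a') (e \<otimes> e')) x" using n(3) by (simp add: fixer_iff)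
    then have "ereal 0 \<le> \<omega> a + ereal s" "ereal (- x) \<le> \<omega> b + ereal (- s)"
        "ereal x \<le> \<omega> c + ereal s" "ereal 0 \<le> \<omega> e + ereal (- s)"
      using cl dia(2,3) by (simp_all add: val_ge_def val_mult dia(6,7) zero_ereal_def)
    note ge = this[THEN shift]
    have y: "y = x - 2 * s" using n(2) dia(8) by simp
    \<comment> \<open>If s is not 0, one diagonal entry of \<open>k\<close> has positive valuation
      and the off-diagonal entries are units. The bounds then force x = s, and the translation by
      -2s sends x to -x.\<close>
    consider "s = 0" | "s > 0" | "s < 0" by linarith
    then show ?thesis
    proof cases
      case 1
      then show ?thesis using ge(2,3) y kI by simp
    next
      case 2
      then have bc: "\<omega> b = 0" "\<omega> c = 0" using unit(2) pos[OF ge(4)] by auto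
      have xs: "x = s" using ge(2,3) unfolding bc by simp
      then show ?thesis using y 2 ge(4) below[of "- x" "\<omega> a"] nn(1) kwI by simp
    next
      case 3
      then have bc: "\<omega> b = 0" "\<omega> c = 0" using unit(1) pos[OF ge(1)] by auto
      have xs: "x = s" using ge(2,3) unfolding bc by simp
      then show ?thesis using y 3 ge(1) below[of x "\<omega> e"] nn(4) kwI by simp
    qed
  next
    case (ant b' c' s)
    have "k \<star> n = Mat2 (b \<otimes> c') (a \<otimes> b') (e \<otimes> c') (c \<otimes> b')"
      unfolding k_eq ant(1) using cl ant(2,3) by simp
    then have "val_ge \<omega> (Mat2 (b \<otimes> c') (a \<otimes> b') (e \<otimes> c') (c \<otimes> b')) x" using n(3) by (simp add: fixer_iff)
    then have "ereal 0 \<le> \<omega> b + ereal (- s)" "ereal (- x) \<le> \<omega> a + ereal s"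
        "ereal x \<le> \<omega> e + ereal (- s)" "ereal 0 \<le> \<omega> c + ereal s"
      using cl ant(2,3) by (simp_all add: val_ge_def val_mult ant(6,7) zero_ereal_def)
    note ge = this[THEN shift]
    have y: "y = - 2 * s - x" using n(2) ant(8) by simp
    \<comment> \<open>Likewise, for s not 0 an off-diagonal entry has positive valuation and the
      diagonal entries are units. Now x = -s, so x is the fixed point of the reflection and y =
      x.\<close>
    consider "s = 0" | "s > 0" | "s < 0" by linarith
    then show ?thesis
    proof cases
      case 1
      then show ?thesis using ge(2,3) y kwI by simp
    next
      case 2
      then have ae: "\<omega> a = 0" "\<omega> e = 0" using unit(3) pos[OF ge(1)] by auto
      have xs: "x = - s" using ge(2,3) unfolding ae by simp
      then show ?thesis using y 2 ge(1) below[of x "\<omega> c"] nn(3) kI by simp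
    next
      case 3
      then have ae: "\<omega> a = 0" "\<omega> e = 0" using unit(4) pos[OF ge(4)] by auto
      have xs: "x = - s" using ge(2,3) unfolding ae by simp
      then show ?thesis using y 3 ge(4) below[of "- x" "\<omega> b"] nn(2) kI by simp
    qed
  qed
  moreover have "\<exists>n\<in>monomials. aff n x = x \<and> k \<star> n \<in> fixer x" if "k \<in> fixer x"
  proof (rule bexI[of _ "\<one>\<^bsub>M\<^esub>"])
    show "\<one>\<^bsub>M\<^esub> \<in> monomials" by (auto intro: dia_monomials)
    have "k \<star> \<one>\<^bsub>M\<^esub> = k" using ku by (intro M.r_one) (simp add: unimod_carrier)
    then show "aff \<one>\<^bsub>M\<^esub> x = x \<and> k \<star> \<one>\<^bsub>M\<^esub> \<in> fixer x"
      using that one_neq_zero by (simp add: aff_def)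
  qed
  moreover have "\<exists>n\<in>monomials. aff n x = - x \<and> k \<star> n \<in> fixer x" if "k \<star> weyl \<in> fixer x"
    using that by (intro bexI[of _ weyl]) (auto simp: aff_def intro: ant_monomials)
  ultimately show ?thesis unfolding pt_rel_def k_def[symmetric] by blast
qed

text \<open>In g = l n r the factor r fixes x, so g sends x to the same point as l sends n x, and l
  is an elementary matrix over O_D. Hence every point of the tree has a representative in
  P_0.\<close>

lemma pt_rel_to_integral:
  assumes "g \<in> carrier unimod"
  obtains k y where "k \<in> elem_fix 0" "pt_rel g x k y"
proof -
  obtain l n r where d: "l \<in> elem_fix 0" "r \<in> elem_fix x" "n \<in> monomials" "g = l \<star> n \<star> r"
    using unimod_decomposition[OF assms] .
  have c: "l \<in> carrier unimod" "r \<in> carrier unimod" "n \<in> carrier unimod"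
    using d unimod_elem_fix unimod_monomials by blast+
  have "uinv (l \<otimes>\<^bsub>unimod\<^esub> n \<otimes>\<^bsub>unimod\<^esub> r) \<otimes>\<^bsub>unimod\<^esub> l \<otimes>\<^bsub>unimod\<^esub> n = uinv r"
    using c by (simp add: unimod.inv_mult_group unimod.m_assoc del: unimod_simps)
  moreover have "uinv r \<in> fixer x"
    using d fixer_elem_fix subgroup.m_inv_closed[OF fixer_subgroup] by blast
  ultimately have "pt_rel g x l (aff n x)" unfolding pt_rel_def d(4) using d(3) by auto
  then show thesis using that d by blast
qed

text \<open>Diagonal matrices with unit entries normalise the elementary matrices over O_D, so they
  can be moved to the far right, next to the point of the apartment. What remains on the left will
  have reduced norm exactly 1.\<close>

lemma fixer_zero_decomposition:
  assumes "g \<in> fixer 0"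
  obtains l w r a e where "l \<in> elem_fix 0" "w = \<one>\<^bsub>M\<^esub> \<or> w = weyl" "r \<in> elem_fix 0"
    "a \<in> carrier D" "e \<in> carrier D" "\<omega> a = 0" "\<omega> e = 0" "g = l \<star> w \<star> r \<star> dia a e"
proof -
  have g: "g \<in> carrier unimod" using assms by (simp add: fixer_iff)
  obtain l n r where d: "l \<in> elem_fix 0" "r \<in> elem_fix 0" "n \<in> monomials" "g = l \<star> n \<star> r"
    using unimod_decomposition[OF g] .
  have c: "l \<in> carrier unimod" "r \<in> carrier unimod" "n \<in> carrier unimod"
    using d unimod_elem_fix unimod_monomials by blast+
  then have cM: "l \<in> carrier M" "r \<in> carrier M" "n \<in> carrier M" by (auto simp: unimod_carrier)
  \<comment> \<open>Solving for n shows that it fixes the vertex 0 as well, so its nonzero entries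
    are units.\<close>
  have "uinv l \<otimes>\<^bsub>unimod\<^esub> g \<otimes>\<^bsub>unimod\<^esub> uinv r = n"
    unfolding d(4) unimod_simps(2)[symmetric]
    using c by (simp add: unimod.m_assoc unimod.inv_solve_left' del: unimod_simps)
  moreover have "uinv l \<in> fixer 0" "uinv r \<in> fixer 0"
    using d fixer_elem_fix subgroup.m_inv_closed[OF fixer_subgroup] by blast+
  ultimately have nf: "n \<in> fixer 0" using assms by (metis fixer_mult unimod_simps(2))
  obtain w a e where w: "w = \<one>\<^bsub>M\<^esub> \<or> w = weyl" "a \<in> carrier D" "e \<in> carrier D" "\<omega> a = 0" "\<omega> e = 0"
    "n = w \<star> dia a e"
    using d(3)
  proof (cases rule: monomialsE)
    case (dia a e s)
    then have "s = 0" using nf by (simp add: fixer_iff val_ge_def)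
    then show thesis using dia by (intro that[of "\<one>\<^bsub>M\<^esub>" a e]) (auto simp: zero_ereal_def)
  next
    case (ant b c s)
    then have "s = 0" using nf by (simp add: fixer_iff val_ge_def)
    then show thesis
      using ant by (intro that[of weyl c "\<ominus> b"]) (auto simp: zero_ereal_def l_minus r_minus)
  qed
  have nz: "a \<noteq> \<zero>" "e \<noteq> \<zero>" using w by auto
  note i = nonzero_inv[OF w(2) nz(1)] nonzero_inv[OF w(3) nz(2)]
  obtain r' where r': "r' \<in> elem_fix 0" "dia a e \<star> r = r' \<star> dia a e"
  proof -
    from d(2) consider b where "r = upr b" "b \<in> carrier D" "0 \<le> \<omega> b" | c where "r = lwr c" "c \<in> carrier D" "0 \<le> \<omega> c"
      unfolding elem_fix_def by (auto simp: zero_ereal_def)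
    then show thesis
    proof cases
      case 1
      then show thesis using w i nz
        by (intro that[of "upr (a \<otimes> b \<otimes> inv e)"])
          (auto simp: elem_fix_def val_mult val_inv m_assoc zero_ereal_def[symmetric])
    next
      case 2
      then show thesis using w i nz
        by (intro that[of "lwr (e \<otimes> c \<otimes> inv a)"])
          (auto simp: elem_fix_def val_mult val_inv m_assoc zero_ereal_def[symmetric])
    qed
  qed
  have wM: "w \<in> carrier M" "dia a e \<in> carrier M" "r' \<in> carrier M"
    using w r' elem_fix_carrier by auto
  have "g = l \<star> (w \<star> (dia a e \<star> r))"
    unfolding d(4) w(6) using cM wM by (simp add: M.m_assoc del: mat2_mult)
  also have "\<dots> = l \<star> w \<star> r' \<star> dia a e"
    unfolding r'(2) using cM wM by (simp add: M.m_assoc del: mat2_mult)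
  finally show thesis using that d w r' by blast
qed

lemma pt_rel_unit_dia:
  assumes "l \<in> carrier unimod" "a \<in> carrier D" "e \<in> carrier D" "\<omega> a = 0" "\<omega> e = 0"
  shows "pt_rel l x (l \<star> dia a e) x"
proof -
  have t: "dia a e \<in> fixer x" using assms by (intro unit_dia_fixer)
  then have tu: "dia a e \<in> carrier unimod" by (simp add: fixer_iff)
  have "uinv l \<otimes>\<^bsub>unimod\<^esub> (l \<otimes>\<^bsub>unimod\<^esub> dia a e) \<otimes>\<^bsub>unimod\<^esub> \<one>\<^bsub>unimod\<^esub> = dia a e"
    using assms(1) tu by (simp add: unimod.inv_solve_left' del: unimod_simps)
  then have "uinv l \<star> (l \<star> dia a e) \<star> \<one>\<^bsub>M\<^esub> \<in> fixer x" using t by simp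
  moreover have "\<one>\<^bsub>M\<^esub> \<in> monomials" by (auto intro: dia_monomials)
  moreover have "aff \<one>\<^bsub>M\<^esub> x = x" using one_neq_zero by (simp add: aff_def)
  ultimately show ?thesis unfolding pt_rel_def by blast
qed

end

section \<open>The reduced norm\<close>

context cyclic_local_division_algebra
begin

section \<open>Value groups and coordinates in the cyclic algebra\<close>

abbreviation EE where "EE \<equiv> D\<lparr>carrier := E\<rparr>"

text \<open>The valuation is not normalised: \<open>q\<close> and \<open>qD\<close> are the positive
  generators of the value groups of K and D, as \<open>val_K\<close> and \<open>val_D\<close> will
  show.\<close>

definition q :: real where "q = real_of_ereal (\<omega> \<pi>\<^sub>K)"
definition qD :: real where "qD = real_of_ereal (\<omega> u)"

lemma K_subfield: "subfield K D"
  using local_field by (simp add: local_subfield_def)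

lemmas K_ops = subringE[OF subfieldE(1)[OF K_subfield]]
lemmas E_ops = subringE[OF subfieldE(1)[OF E_subfield]]

lemma E_carrier: "x \<in> E \<Longrightarrow> x \<in> carrier D"
  using E_ops(1) by blast

lemma pi_K: "\<pi>\<^sub>K \<in> K" "\<pi>\<^sub>K \<in> E" "\<pi>\<^sub>K \<in> carrier D" "\<omega> \<pi>\<^sub>K = ereal q" "0 < q" "\<pi>\<^sub>K \<noteq> \<zero>"
proof -
  show K: "\<pi>\<^sub>K \<in> K" using uniformiser_K by (simp add: uniformiser_def val_ideal_def)
  then show "\<pi>\<^sub>K \<in> E" "\<pi>\<^sub>K \<in> carrier D" using K_subset_E E_carrier by blast+
  have w: "0 < \<omega> \<pi>\<^sub>K" "\<omega> \<pi>\<^sub>K \<noteq> \<infinity>" using uniformiser_K by (auto simp: uniformiser_def val_ideal_def)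
  then show "\<omega> \<pi>\<^sub>K = ereal q" by (cases "\<omega> \<pi>\<^sub>K") (auto simp: q_def)
  then show "0 < q" "\<pi>\<^sub>K \<noteq> \<zero>" using w by auto
qed

lemma d_pos: "0 < d"
proof (rule ccontr)
  assume "\<not> 0 < d"
  then have "{..<d} = {}" by auto
  moreover obtain c where "\<one> = (\<Oplus>i\<in>{..<d}. u [^] i \<otimes> c i)" using direct_sum[of \<one>] by auto
  ultimately show False using one_neq_zero by simp
qed

lemma val_u: "\<omega> u = ereal qD" "real d * qD = q" "0 < qD"
proof -
  obtain s where s: "\<omega> u = ereal s" using u_closed u_nonzero val_finite by metis
  then show w: "\<omega> u = ereal qD" by (simp add: qD_def)
  show e: "real d * qD = q" using val_pow[OF u_closed w, of d] pi_K(4) by (simp add: u_pow)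
  then show "0 < qD" using pi_K(5) d_pos by (metis of_nat_0_less_iff zero_less_mult_pos)
qed

text \<open>Division with remainder: a power of \<open>\<pi>\<^sub>K\<close> brings the valuation
  into the interval from 0 to q, q excluded, where minimality of the uniformiser leaves only
  0.\<close>

lemma val_K:
  assumes "x \<in> K" "x \<noteq> \<zero>"
  obtains m :: int where "\<omega> x = ereal (real_of_int m * q)"
proof -
  obtain s where s: "\<omega> x = ereal s" using assms K_ops(1) val_finite by blast
  define m where "m = \<lfloor>s / q\<rfloor>"
  have pK: "inv \<pi>\<^sub>K \<in> K" "inv \<pi>\<^sub>K \<in> carrier D"
    using subfield_m_inv(1)[OF K_subfield, of "\<pi>\<^sub>K"] pi_K K_ops(1) by auto
  have pow: "y [^] (n::nat) \<in> K" if "y \<in> K" for y n by (induction n) (use that K_ops in auto)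
  obtain z where z: "z \<in> K" "\<omega> z = ereal (- (real_of_int m * q))"
  proof (cases "0 \<le> m")
    case True
    have "\<omega> (inv \<pi>\<^sub>K) = ereal (- q)" using val_inv pi_K by simp
    then show thesis using True pow[OF pK(1), of "nat m"] val_pow[OF pK(2), of "- q" "nat m"]
      by (intro that[of "inv \<pi>\<^sub>K [^] nat m"]) auto
  next
    case False
    then show thesis using pow[OF pi_K(1), of "nat (- m)"] val_pow[OF pi_K(3,4), of "nat (- m)"]
      by (intro that[of "\<pi>\<^sub>K [^] nat (- m)"]) auto
  qed
  have xz: "x \<otimes> z \<in> K" using assms z K_ops by blast
  have v: "\<omega> (x \<otimes> z) = ereal (s - real_of_int m * q)"
    using val_mult[of x z] assms z s K_ops(1) by auto
  have fl: "real_of_int m \<le> s / q" "s / q < real_of_int m + 1" unfolding m_def by linarith+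
  then have b: "0 \<le> s - real_of_int m * q" "s - real_of_int m * q < q"
    using pi_K(5) by (simp_all add: field_simps)
  have "s - real_of_int m * q = 0"
  proof (rule ccontr)
    assume "s - real_of_int m * q \<noteq> 0"
    then have "x \<otimes> z \<in> val_ideal \<omega> K" using b v xz by (simp add: val_ideal_def)
    then have "\<omega> \<pi>\<^sub>K \<le> \<omega> (x \<otimes> z)" using uniformiser_K by (simp add: uniformiser_def)
    then show False using b v pi_K(4) by simp
  qed
  then show thesis using that[of m] s by simp
qed

lemma val_E:
  assumes "x \<in> E" "x \<noteq> \<zero>"
  obtains m :: int where "\<omega> x = ereal (real_of_int m * q)"
proof -
  have "\<omega> x \<in> \<omega> ` (K - {\<zero>})" using assms E_unramified by blast
  then obtain y where "y \<in> K" "y \<noteq> \<zero>" "\<omega> x = \<omega> y" by auto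
  then show thesis using val_K that by metis
qed

abbreviation coord where "coord \<equiv> coords D E u d"

lemma coord_PiE: "x \<in> carrier D \<Longrightarrow> coord x \<in> {..<d} \<rightarrow>\<^sub>E E"
  and coord_sum: "x \<in> carrier D \<Longrightarrow> x = (\<Oplus>i\<in>{..<d}. u [^] i \<otimes> coord x i)"
  using theI'[OF direct_sum[of x]] by (auto simp: coords_def)

lemma coord_E: "x \<in> carrier D \<Longrightarrow> i < d \<Longrightarrow> coord x i \<in> E"
  using coord_PiE[of x] by (auto simp: PiE_iff)

lemma coord_eqI:
  assumes "x = (\<Oplus>j\<in>{..<d}. u [^] j \<otimes> c j)" "\<And>j. j < d \<Longrightarrow> c j \<in> E" "i < d"
  shows "coord x i = c i"
proof -
  have x: "x \<in> carrier D" unfolding assms(1) using assms(2) u_closed E_carrier by (auto intro!: finsum_closed)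
  let ?c = "restrict c {..<d}"
  have "x = (\<Oplus>j\<in>{..<d}. u [^] j \<otimes> ?c j)"
    unfolding assms(1) using assms(2) u_closed E_carrier by (intro finsum_cong') auto
  moreover have "?c \<in> {..<d} \<rightarrow>\<^sub>E E" using assms(2) by auto
  ultimately have "coord x = ?c"
    using direct_sum[OF x] coord_PiE[OF x] coord_sum[OF x] by blast
  then show ?thesis using assms(3) by simp
qed

lemma coord_add:
  assumes "x \<in> carrier D" "y \<in> carrier D" "i < d"
  shows "coord (x \<oplus> y) i = coord x i \<oplus> coord y i"
proof (rule coord_eqI[OF _ _ assms(3)])
  have c: "u [^] j \<otimes> coord x j \<in> carrier D" "u [^] j \<otimes> coord y j \<in> carrier D" if "j < d" for j
    using that assms coord_E E_carrier u_closed by auto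
  have "x \<oplus> y = (\<Oplus>j\<in>{..<d}. u [^] j \<otimes> coord x j) \<oplus> (\<Oplus>j\<in>{..<d}. u [^] j \<otimes> coord y j)"
    using coord_sum assms by metis
  also have "\<dots> = (\<Oplus>j\<in>{..<d}. u [^] j \<otimes> coord x j \<oplus> u [^] j \<otimes> coord y j)"
    using c by (intro finsum_addf[symmetric]) auto
  also have "\<dots> = (\<Oplus>j\<in>{..<d}. u [^] j \<otimes> (coord x j \<oplus> coord y j))"
    using assms coord_E E_carrier u_closed by (intro finsum_cong') (auto simp: r_distr)
  finally show "x \<oplus> y = (\<Oplus>j\<in>{..<d}. u [^] j \<otimes> (coord x j \<oplus> coord y j))" .
qed (use assms coord_E E_ops in auto)

lemma coord_mult_right:
  assumes "x \<in> carrier D" "y \<in> E" "i < d"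
  shows "coord (x \<otimes> y) i = coord x i \<otimes> y"
proof (rule coord_eqI[OF _ _ assms(3)])
  have "x \<otimes> y = (\<Oplus>j\<in>{..<d}. u [^] j \<otimes> coord x j) \<otimes> y"
    using coord_sum assms by metis
  also have "\<dots> = (\<Oplus>j\<in>{..<d}. u [^] j \<otimes> coord x j \<otimes> y)"
    using assms coord_E E_carrier u_closed by (intro finsum_ldistr) auto
  also have "\<dots> = (\<Oplus>j\<in>{..<d}. u [^] j \<otimes> (coord x j \<otimes> y))"
    using assms coord_E E_carrier u_closed by (intro finsum_cong') (auto simp: m_assoc)
  finally show "x \<otimes> y = (\<Oplus>j\<in>{..<d}. u [^] j \<otimes> (coord x j \<otimes> y))" .
qed (use assms coord_E E_ops in auto)

lemma coord_zero: "i < d \<Longrightarrow> coord \<zero> i = \<zero>"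
  using coord_mult_right[of \<one> \<zero> i] E_ops coord_E E_carrier by simp

lemma coord_finsum:
  assumes "finite S" "\<And>k. k \<in> S \<Longrightarrow> f k \<in> carrier D" "i < d"
  shows "coord (\<Oplus>k\<in>S. f k) i = (\<Oplus>k\<in>S. coord (f k) i)"
  using assms(1,2)
proof (induction S rule: finite_induct)
  case empty
  then show ?case using coord_zero assms by simp
next
  case (insert k S)
  have "(\<Oplus>k\<in>insert k S. f k) = f k \<oplus> (\<Oplus>k\<in>S. f k)" using insert by (intro finsum_insert) auto
  moreover have "(\<Oplus>k\<in>insert k S. coord (f k) i) = coord (f k) i \<oplus> (\<Oplus>k\<in>S. coord (f k) i)"
    using insert assms coord_E E_carrier by (intro finsum_insert) auto
  moreover have "(\<Oplus>k\<in>S. f k) \<in> carrier D" using insert by (intro finsum_closed) auto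
  ultimately show ?case using insert coord_add assms by simp
qed

lemma coord_u_pow:
  assumes "i < d" "j < d"
  shows "coord (u [^] j) i = (if i = j then \<one> else \<zero>)"
proof (rule coord_eqI[OF _ _ assms(1)])
  have "(\<Oplus>k\<in>{..<d}. u [^] k \<otimes> (if k = j then \<one> else \<zero>)) = (\<Oplus>k\<in>{..<d}. if j = k then u [^] k else \<zero>)"
    using u_closed by (intro finsum_cong') auto
  also have "\<dots> = u [^] j" using assms u_closed by (intro finsum_singleton) auto
  finally show "u [^] j = (\<Oplus>k\<in>{..<d}. u [^] k \<otimes> (if k = j then \<one> else \<zero>))" ..
qed (use E_ops in auto)

text \<open>Values on E are multiples of q = d * qD, so in units of \<open>qD\<close> the valuation
  of u^i x is congruent to i modulo d.\<close>

lemma val_u_mult: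
  assumes "x \<in> E" "x \<noteq> \<zero>"
  obtains m :: int where "\<omega> x = ereal (real_of_int m * q)" "\<And>i. \<omega> (u [^] i \<otimes> x) = ereal (real_of_int (int i + m * int d) * qD)"
proof -
  obtain m :: int where m: "\<omega> x = ereal (real_of_int m * q)" using val_E assms by metis
  have "\<omega> (u [^] i \<otimes> x) = ereal (real i * qD + real_of_int m * q)" for i :: nat
    using assms E_carrier u_closed val_mult val_pow[OF u_closed val_u(1)] m by simp
  moreover have "real i * qD + real_of_int m * q = real_of_int (int i + m * int d) * qD" for i
    unfolding val_u(2)[symmetric] by (simp add: algebra_simps)
  ultimately show thesis using m that by auto
qed

text \<open>The nonzero terms u^i c_i have valuations in different classes modulo d, so nothing
  cancels and the valuation of x is the least of theirs.\<close>

lemma val_coord_distinct: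
  assumes "x \<in> carrier D"
  shows "(\<forall>i<d. \<omega> x \<le> \<omega> (u [^] i \<otimes> coord x i)) \<and>
    (x = \<zero> \<or> (\<exists>i<d. coord x i \<noteq> \<zero> \<and> \<omega> x = \<omega> (u [^] i \<otimes> coord x i)))"
proof -
  let ?f = "\<lambda>i. u [^] i \<otimes> coord x i"
  have cl: "?f \<in> {..<d} \<rightarrow> carrier D" using assms coord_E E_carrier u_closed by auto
  have "\<omega> (?f i) \<noteq> \<omega> (?f j)" if ij: "i < d" "j < d" "i \<noteq> j" "?f i \<noteq> \<zero>" for i j
  proof -
    have ci: "coord x i \<in> E" "coord x i \<noteq> \<zero>" using ij assms coord_E u_closed by auto
    obtain m where m: "\<omega> (?f i) = ereal (real_of_int (int i + m * int d) * qD)"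
      using val_u_mult[OF ci] by metis
    show ?thesis
    proof (cases "coord x j = \<zero>")
      case True
      then show ?thesis using m u_closed by simp
    next
      case False
      then obtain l where l: "\<omega> (?f j) = ereal (real_of_int (int j + l * int d) * qD)"
        using val_u_mult[OF coord_E[OF assms ij(2)]] by metis
      have "(int i + m * int d) mod int d \<noteq> (int j + l * int d) mod int d" using ij by simp
      then have "int i + m * int d \<noteq> int j + l * int d" by metis
      then show ?thesis unfolding m l using val_u(3) by (simp only: ereal.inject mult_cancel_right of_int_eq_iff) simp
    qed
  qed
  then have "(\<forall>i\<in>{..<d}. \<omega> (\<Oplus>i\<in>{..<d}. ?f i) \<le> \<omega> (?f i)) \<and>
    ((\<Oplus>i\<in>{..<d}. ?f i) = \<zero> \<or> (\<exists>i\<in>{..<d}. ?f i \<noteq> \<zero> \<and> \<omega> (\<Oplus>i\<in>{..<d}. ?f i) = \<omega> (?f i)))"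
    using cl by (intro val_finsum_distinct) auto
  then show ?thesis unfolding coord_sum[OF assms, symmetric] using u_closed by fastforce
qed

lemma val_D:
  assumes "x \<in> carrier D" "x \<noteq> \<zero>"
  obtains k :: int where "\<omega> x = ereal (real_of_int k * qD)"
proof -
  obtain i where i: "i < d" "coord x i \<noteq> \<zero>" "\<omega> x = \<omega> (u [^] i \<otimes> coord x i)"
    using val_coord_distinct[OF assms(1)] assms(2) by blast
  then show thesis using val_u_mult[OF coord_E[OF assms(1) i(1)] i(2)] that by metis
qed

lemma uniformiser_E: "uniformiser \<omega> E \<pi>\<^sub>K"
  unfolding uniformiser_def
proof (intro conjI ballI)
  show "\<pi>\<^sub>K \<in> val_ideal \<omega> E" "\<omega> \<pi>\<^sub>K \<noteq> \<infinity>" using pi_K by (auto simp: val_ideal_def)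
  fix x assume x: "x \<in> val_ideal \<omega> E"
  show "\<omega> \<pi>\<^sub>K \<le> \<omega> x"
  proof (cases "x = \<zero>")
    case False
    then obtain m :: int where m: "\<omega> x = ereal (real_of_int m * q)" using val_E x by (auto simp: val_ideal_def)
    then have "0 < m" using x pi_K(5) by (simp add: val_ideal_def zero_less_mult_iff)
    then have "1 * q \<le> real_of_int m * q" using pi_K(5) by (intro mult_right_mono) auto
    then show ?thesis using m pi_K by simp
  qed simp
qed

text \<open>A positive integer multiple of \<open>qD\<close> is at least \<open>qD\<close>. That u
  has the least positive value is thus a consequence of u^d = \<open>\<pi>\<^sub>K\<close> and of E
  being unramified.\<close>

lemma uniformiser_D: "uniformiser \<omega> (carrier D) u"
  unfolding uniformiser_def
proof (intro conjI ballI)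
  show "u \<in> val_ideal \<omega> (carrier D)" "\<omega> u \<noteq> \<infinity>" using val_u u_closed by (auto simp: val_ideal_def)
  fix x assume x: "x \<in> val_ideal \<omega> (carrier D)"
  show "\<omega> u \<le> \<omega> x"
  proof (cases "x = \<zero>")
    case False
    then obtain m :: int where m: "\<omega> x = ereal (real_of_int m * qD)" using val_D x by (auto simp: val_ideal_def)
    then have "0 < m" using x val_u(3) by (simp add: val_ideal_def zero_less_mult_iff)
    then have "1 * qD \<le> real_of_int m * qD" using val_u(3) by (intro mult_right_mono) auto
    then show ?thesis using m val_u by simp
  qed simp
qed

text \<open>For i < d the factor u^i contributes less than q, and values on E are multiples of q, so
  rounding loses nothing: m < l + 1 gives m \<le> l. With m = r this is why elements of m_D^{rd} get
  matrices with entries in m_E^r.\<close>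

lemma val_coord:
  assumes "x \<in> carrier D" "ereal (real_of_int m * q) \<le> \<omega> x" "i < d"
  shows "ereal (real_of_int m * q) \<le> \<omega> (coord x i)"
proof (cases "coord x i = \<zero>")
  case False
  then obtain l :: int where l: "\<omega> (coord x i) = ereal (real_of_int l * q)"
    using val_u_mult[OF coord_E[OF assms(1,3)]] by metis
  have "\<omega> (u [^] i \<otimes> coord x i) = ereal (real i * qD + real_of_int l * q)"
    using val_mult[of "u [^] i" "coord x i"] val_pow[OF u_closed val_u(1)] l u_closed
      coord_E[OF assms(1,3)] E_carrier by simp
  moreover have "ereal (real_of_int m * q) \<le> \<omega> (u [^] i \<otimes> coord x i)"
    using val_coord_distinct[OF assms(1)] assms(2,3) order_trans by blast
  ultimately have "real_of_int m * q \<le> real i * qD + real_of_int l * q" by simp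
  also have "\<dots> < real d * qD + real_of_int l * q" using assms(3) val_u(3) by simp
  also have "\<dots> = real_of_int (l + 1) * q" using val_u(2) by (simp add: algebra_simps)
  finally have "real_of_int m < real_of_int (l + 1)" using pi_K(5) by (simp only: mult_less_cancel_right_pos)
  then have "m \<le> l" by linarith
  then have "real_of_int m * q \<le> real_of_int l * q" using pi_K(5) by (intro mult_right_mono) auto
  then show ?thesis using l by simp
qed simp

section \<open>The splitting representation and multiplicativity of the reduced norm\<close>

abbreviation ph where "ph \<equiv> phi D E u d"
abbreviation nrd where "nrd \<equiv> reduced_norm D E u d"

lemma phi_E: "a \<in> carrier D \<Longrightarrow> i < d \<Longrightarrow> ph a i j \<in> E"
  using coord_E u_closed by (simp add: phi_def)

lemma phi_add: "\<lbrakk>a \<in> carrier D; b \<in> carrier D; i < d\<rbrakk> \<Longrightarrow> ph (a \<oplus> b) i j = ph a i j \<oplus> ph b i j"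
  using coord_add u_closed by (simp add: phi_def l_distr)

lemma phi_mult:
  assumes "a \<in> carrier D" "b \<in> carrier D" "i < d"
  shows "ph (a \<otimes> b) i j = (\<Oplus>k\<in>{..<d}. ph a i k \<otimes> ph b k j)"
proof -
  have cE: "coord (b \<otimes> u [^] j) k \<in> E" "coord (b \<otimes> u [^] j) k \<in> carrier D" if "k < d" for k
    using that coord_E E_carrier u_closed assms by auto
  have "a \<otimes> b \<otimes> u [^] j = a \<otimes> (\<Oplus>k\<in>{..<d}. u [^] k \<otimes> coord (b \<otimes> u [^] j) k)"
    using assms u_closed coord_sum[of "b \<otimes> u [^] j"] by (simp add: m_assoc)
  also have "\<dots> = (\<Oplus>k\<in>{..<d}. a \<otimes> (u [^] k \<otimes> coord (b \<otimes> u [^] j) k))"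
    using assms u_closed cE by (intro finsum_rdistr) auto
  also have "\<dots> = (\<Oplus>k\<in>{..<d}. (a \<otimes> u [^] k) \<otimes> coord (b \<otimes> u [^] j) k)"
    using assms u_closed cE by (intro finsum_cong') (auto simp: m_assoc)
  finally have "ph (a \<otimes> b) i j = coord (\<Oplus>k\<in>{..<d}. (a \<otimes> u [^] k) \<otimes> coord (b \<otimes> u [^] j) k) i"
    by (simp add: phi_def)
  also have "\<dots> = (\<Oplus>k\<in>{..<d}. coord ((a \<otimes> u [^] k) \<otimes> coord (b \<otimes> u [^] j) k) i)"
    using assms u_closed cE by (intro coord_finsum) auto
  also have "\<dots> = (\<Oplus>k\<in>{..<d}. ph a i k \<otimes> ph b k j)"
    using assms u_closed cE coord_E E_carrier
    by (intro finsum_cong') (auto simp: phi_def coord_mult_right)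
  finally show ?thesis .
qed

text \<open>Central elements act by scalar matrices, whereas a general element of E would show its
  conjugates under \<tau> on the diagonal.\<close>

lemma phi_K:
  assumes "z \<in> K" "i < d" "j < d"
  shows "ph z i j = (if i = j then z else \<zero>)"
proof -
  have "z \<otimes> u [^] j = u [^] j \<otimes> z" using assms(1) u_closed by (auto simp: central[symmetric] ring_centre_def)
  then show ?thesis
    using assms coord_mult_right[of "u [^] j" z i] coord_u_pow u_closed K_subset_E E_carrier
    by (auto simp: phi_def)
qed

lemma val_phi:
  assumes "a \<in> carrier D" "ereal (real_of_int m * q) \<le> \<omega> a" "i < d"
  shows "ereal (real_of_int m * q) \<le> \<omega> (ph a i j)"
proof -
  have "\<omega> a \<le> \<omega> (a \<otimes> u [^] j)"
    using assms(1) u_closed val_mult[of a "u [^] j"] val_pow[OF u_closed val_u(1), of j] val_u(3)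
    by (cases "\<omega> a") auto
  then show ?thesis unfolding phi_def using assms u_closed by (intro val_coord) auto
qed

sublocale EE: field EE
  using subfield_iff(2)[OF E_subfield] .

lemma block_mat_E:
  assumes "g \<in> carrier M" "i < 2 * d"
  shows "block_mat ph d g i j \<in> E"
  using assms phi_E by (elim mat2_carrierE) (auto simp: block_mat_def)

lemma block_mat_mult:
  assumes "g \<in> carrier M" "h \<in> carrier M" "i < 2 * d" "j < 2 * d"
  shows "block_mat ph d (g \<star> h) i j
    = (\<Oplus>\<^bsub>EE\<^esub>k\<in>{..<2 * d}. block_mat ph d g i k \<otimes>\<^bsub>EE\<^esub> block_mat ph d h k j)"
proof -
  obtain a b c e where g: "g = Mat2 a b c e" "a \<in> carrier D" "b \<in> carrier D" "c \<in> carrier D" "e \<in> carrier D"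
    using assms(1) by (elim mat2_carrierE)
  obtain a' b' c' e' where h: "h = Mat2 a' b' c' e'" "a' \<in> carrier D" "b' \<in> carrier D" "c' \<in> carrier D" "e' \<in> carrier D"
    using assms(2) by (elim mat2_carrierE)
  let ?f = "\<lambda>k. block_mat ph d g i k \<otimes> block_mat ph d h k j"
  have cl: "?f k \<in> E" if "k < 2 * d" for k
    using that assms block_mat_E E_ops(6) by blast
  have "(\<Oplus>\<^bsub>EE\<^esub>k\<in>{..<2 * d}. block_mat ph d g i k \<otimes>\<^bsub>EE\<^esub> block_mat ph d h k j) = (\<Oplus>k\<in>{..<2 * d}. ?f k)"
    using finsum_subring_consistent[OF subfieldE(1)[OF E_subfield], of "{..<2 * d}" ?f] cl by simp
  also have "\<dots> = (\<Oplus>k\<in>{..<d}. ?f k) \<oplus> (\<Oplus>k\<in>{..<d}. ?f (k + d))"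
    using cl E_carrier by (intro finsum_lessThan_double) auto
  also have "(\<Oplus>k\<in>{..<d}. ?f k) = (\<Oplus>k\<in>{..<d}. (if i < d then ph a i k else ph c (i - d) k)
      \<otimes> (if j < d then ph a' k j else ph b' k (j - d)))"
    using assms cl E_carrier g h phi_E by (intro finsum_cong') (auto simp: block_mat_def)
  also have "(\<Oplus>k\<in>{..<d}. ?f (k + d)) = (\<Oplus>k\<in>{..<d}. (if i < d then ph b i k else ph e (i - d) k)
      \<otimes> (if j < d then ph c' k j else ph e' k (j - d)))"
    using assms cl E_carrier g h phi_E by (intro finsum_cong') (auto simp: block_mat_def)
  finally show ?thesis
    using assms g h by (auto simp: block_mat_def phi_add phi_mult)
qed

lemma nrd_E: "g \<in> carrier M \<Longrightarrow> nrd g \<in> E"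
  using EE.ring_det_closed[of "2 * d" "block_mat ph d g"] block_mat_E by (simp add: reduced_norm_def)

lemma nrd_mult:
  assumes "g \<in> carrier M" "h \<in> carrier M"
  shows "nrd (g \<star> h) = nrd g \<otimes> nrd h"
proof -
  let ?p = "\<lambda>i j. \<Oplus>\<^bsub>EE\<^esub>k\<in>{..<2 * d}. block_mat ph d g i k \<otimes>\<^bsub>EE\<^esub> block_mat ph d h k j"
  have "ring_det EE (2 * d) (block_mat ph d (g \<star> h)) = ring_det EE (2 * d) ?p"
  proof (rule EE.ring_det_cong)
    fix i j assume ij: "i < 2 * d" "j < 2 * d"
    show "block_mat ph d (g \<star> h) i j = ?p i j" using block_mat_mult assms ij by blast
    show "?p i j \<in> carrier EE" using block_mat_E assms ij by (intro EE.finsum_closed funcsetI EE.m_closed) auto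
  qed
  also have "\<dots> = ring_det EE (2 * d) (block_mat ph d g) \<otimes>\<^bsub>EE\<^esub> ring_det EE (2 * d) (block_mat ph d h)"
    using block_mat_E assms by (intro EE.ring_det_mult) auto
  finally show ?thesis by (simp add: reduced_norm_def)
qed

text \<open>Entries \<open>a\<close> and \<open>e\<close> from K have scalar blocks, which makes the
  large matrix triangular and not merely block triangular.\<close>

lemma nrd_triangular:
  assumes "Mat2 a b c e \<in> carrier M" "a \<in> K" "e \<in> K" "b = \<zero> \<or> c = \<zero>"
  shows "nrd (Mat2 a b c e) = (\<Otimes>\<^bsub>EE\<^esub>i\<in>{..<2 * d}. if i < d then a else e)"
proof -
  let ?B = "block_mat ph d (Mat2 a b c e)"
  have z: "ph \<zero> i j = \<zero>" if "i < d" "j < d" for i j using phi_K[of \<zero> i j] that K_ops by simp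
  have "ring_det EE (2 * d) ?B = (\<Otimes>\<^bsub>EE\<^esub>i\<in>{..<2 * d}. ?B i i)"
  proof (rule EE.ring_det_triangular)
    show "?B i j \<in> carrier EE" if "i < 2 * d" for i j using block_mat_E[OF assms(1)] that by simp
    show "(\<forall>i<2 * d. \<forall>j<i. ?B i j = \<zero>\<^bsub>EE\<^esub>) \<or> (\<forall>j<2 * d. \<forall>i<j. ?B i j = \<zero>\<^bsub>EE\<^esub>)"
      using assms(4)
    proof
      assume "c = \<zero>"
      then have "\<forall>i<2 * d. \<forall>j<i. ?B i j = \<zero>" using assms phi_K z by (auto simp: block_mat_def)
      then show ?thesis by simp
    next
      assume "b = \<zero>"
      then have "\<forall>j<2 * d. \<forall>i<j. ?B i j = \<zero>" using assms phi_K z by (auto simp: block_mat_def)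
      then show ?thesis by simp
    qed
  qed
  also have "\<dots> = (\<Otimes>\<^bsub>EE\<^esub>i\<in>{..<2 * d}. if i < d then a else e)"
    using assms phi_K K_subset_E by (intro EE.finprod_cong') (auto simp: block_mat_def)
  finally show ?thesis by (simp add: reduced_norm_def)
qed

lemma nrd_elementary: "b \<in> carrier D \<Longrightarrow> nrd (upr b) = \<one>" "b \<in> carrier D \<Longrightarrow> nrd (lwr b) = \<one>"
  using nrd_triangular[of \<one> b \<zero> \<one>] nrd_triangular[of \<one> \<zero> b \<one>] K_ops EE.finprod_one[of "{..<2 * d}"] by simp_all

lemma nrd_one: "nrd \<one>\<^bsub>M\<^esub> = \<one>"
  using nrd_elementary(1)[of \<zero>] by simp

lemma E_subcring: "subcring E D"
  using subfieldE(2)[OF E_subfield] .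

lemma val_ring_E_cring: "cring (val_ring D \<omega> E)"
  using val_ring_cring[OF E_subcring] .

text \<open>Inclusions of rings preserve determinants. Over O_E the determinant is visibly integral
  and can be reduced modulo powers of the maximal ideal.\<close>

lemma nrd_val_ring:
  assumes "g \<in> carrier M" "val_ge \<omega> g 0"
  shows "nrd g = ring_det (val_ring D \<omega> E) (2 * d) (block_mat ph d g)"
    "\<And>i j. i < 2 * d \<Longrightarrow> block_mat ph d g i j \<in> carrier (val_ring D \<omega> E)"
proof -
  interpret OE: cring "val_ring D \<omega> E" by (rule val_ring_E_cring)
  have "id \<in> ring_hom (val_ring D \<omega> E) EE" by (auto simp: ring_hom_def val_ring_def)
  then interpret h: ring_hom_cring "val_ring D \<omega> E" EE id
    by (intro ring_hom_cringI ring_hom_ringI2 OE.ring_axioms EE.ring_axioms OE.is_cring EE.is_cring)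
  have "0 \<le> \<omega> (ph a i j)" if "a \<in> carrier D" "0 \<le> \<omega> a" "i < d" for a i j
    using val_phi[of a 0 i j] that by (simp add: zero_ereal_def)
  then show B: "block_mat ph d g i j \<in> carrier (val_ring D \<omega> E)" if "i < 2 * d" for i j
    using that assms phi_E
    by (elim mat2_carrierE) (auto simp: block_mat_def val_ring_def val_ge_def zero_ereal_def[symmetric])
  show "nrd g = ring_det (val_ring D \<omega> E) (2 * d) (block_mat ph d g)"
    using h.hom_ring_det[of "2 * d" "block_mat ph d g"] B by (simp add: reduced_norm_def)
qed

lemma nrd_integral:
  assumes "g \<in> carrier M" "val_ge \<omega> g 0"
  shows "0 \<le> \<omega> (nrd g)"
proof -
  interpret OE: cring "val_ring D \<omega> E" by (rule val_ring_E_cring)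
  have "nrd g \<in> carrier (val_ring D \<omega> E)"
    using nrd_val_ring[OF assms] by (auto intro: OE.ring_det_closed)
  then show ?thesis by (simp add: val_ring_def)
qed

section \<open>The valuation of the reduced norm on diagonal matrices\<close>

lemma val_nrd_mult:
  "g \<in> carrier M \<Longrightarrow> h \<in> carrier M \<Longrightarrow> \<omega> (nrd (g \<star> h)) = \<omega> (nrd g) + \<omega> (nrd h)"
  using nrd_mult nrd_E E_carrier val_mult by simp

lemma val_nrd_dia_mult:
  assumes "x \<in> carrier D" "y \<in> carrier D"
  shows "\<omega> (nrd (dia (x \<otimes> y) \<one>)) = \<omega> (nrd (dia x \<one>)) + \<omega> (nrd (dia y \<one>))"
  using val_nrd_mult[of "dia x \<one>" "dia y \<one>"] assms by simp

lemma val_nrd_dia_integral: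
  assumes "y \<in> carrier D" "0 \<le> \<omega> y"
  shows "0 \<le> \<omega> (nrd (dia y \<one>))"
  using nrd_integral[of "dia y \<one>"] assms by (simp add: val_ge_def zero_ereal_def)

lemma val_nrd_dia_pi_K: "0 < \<omega> (nrd (dia \<pi>\<^sub>K \<one>))"
proof -
  let ?f = "\<lambda>i. if i < d then \<pi>\<^sub>K else \<one>"
  have fE: "?f \<in> A \<rightarrow> carrier EE" for A using pi_K E_ops by auto
  have nonneg: "(\<Otimes>\<^bsub>EE\<^esub>i\<in>A. ?f i) \<in> E \<and> 0 \<le> \<omega> (\<Otimes>\<^bsub>EE\<^esub>i\<in>A. ?f i)" if "finite A" for A :: "nat set"
    using that
  proof (induction A rule: finite_induct)
    case empty
    then show ?case using E_ops by simp
  next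
    case (insert i A)
    have "(\<Otimes>\<^bsub>EE\<^esub>i\<in>insert i A. ?f i) = ?f i \<otimes> (\<Otimes>\<^bsub>EE\<^esub>i\<in>A. ?f i)"
      using insert fE pi_K(2) E_ops(3) by (subst EE.finprod_insert) auto
    then show ?case using insert pi_K E_ops E_carrier by (auto simp: val_mult)
  qed
  have "nrd (dia \<pi>\<^sub>K \<one>) = (\<Otimes>\<^bsub>EE\<^esub>i\<in>{..<2 * d}. ?f i)"
    using pi_K K_ops by (intro nrd_triangular) auto
  \<comment> \<open>As d > 0, the index 0 carries a factor \<open>\<pi>\<^sub>K\<close>; splitting
    it off leaves an integral product, which suffices for positivity.\<close>
  also have "{..<2 * d} = insert 0 {0<..<2 * d}" using d_pos by auto
  also have "(\<Otimes>\<^bsub>EE\<^esub>i\<in>insert 0 {0<..<2 * d}. ?f i) = \<pi>\<^sub>K \<otimes> (\<Otimes>\<^bsub>EE\<^esub>i\<in>{0<..<2 * d}. ?f i)"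
    using fE d_pos pi_K(2) E_ops(3) by (subst EE.finprod_insert) auto
  finally have "\<omega> (nrd (dia \<pi>\<^sub>K \<one>)) = ereal q + \<omega> (\<Otimes>\<^bsub>EE\<^esub>i\<in>{0<..<2 * d}. ?f i)"
    using nonneg[of "{0<..<2 * d}"] pi_K E_carrier val_mult by simp
  then show ?thesis using nonneg[of "{0<..<2 * d}"] pi_K(5) by (simp add: add_pos_nonneg)
qed

text \<open>Here \<open>y\<^sup>d\<close> is an integral multiple of \<open>\<pi>\<^sub>K\<close>, whose reduced norm is known.\<close>

lemma val_nrd_dia_pos:
  assumes y: "y \<in> carrier D" "0 < \<omega> y"
  shows "0 < \<omega> (nrd (dia y \<one>))"
proof (rule ccontr)
  assume "\<not> 0 < \<omega> (nrd (dia y \<one>))"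
  then have z: "\<omega> (nrd (dia y \<one>)) = 0" using val_nrd_dia_integral[OF y(1)] y(2) by simp
  have pow: "\<omega> (nrd (dia (y [^] n) \<one>)) = 0" for n :: nat
  proof (induction n)
    case 0
    then show ?case using nrd_one by simp
  next
    case (Suc n)
    then show ?case using val_nrd_dia_mult[of "y [^] n" y] y z by simp
  qed
  have "ereal qD \<le> \<omega> y"
    using y uniformiser_D val_u(1) by (simp add: uniformiser_def val_ideal_def)
  have yd: "ereal q \<le> \<omega> (y [^] d)"
  proof (cases "y = \<zero>")
    case True
    then have "y [^] d = \<zero>" using d_pos by (cases d) auto
    then show ?thesis by simp
  next
    case False
    then obtain s where s: "\<omega> y = ereal s" using y val_finite by metis
    have "real d * qD \<le> real d * s" using \<open>ereal qD \<le> \<omega> y\<close> s by (intro mult_left_mono) auto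
    then show ?thesis using val_pow[OF y(1) s, of d] val_u(2) by simp
  qed
  \<comment> \<open>Integral, because y has valuation at least \<open>qD\<close> and therefore y^d
    at least d * qD = q.\<close>
  let ?z = "inv \<pi>\<^sub>K \<otimes> y [^] d"
  have p: "inv \<pi>\<^sub>K \<in> carrier D" "\<omega> (inv \<pi>\<^sub>K) = ereal (- q)"
    using nonzero_inv(1) val_inv pi_K by auto
  have zc: "?z \<in> carrier D" "\<pi>\<^sub>K \<otimes> ?z = y [^] d" using p y pi_K cancel_inv by auto
  have "0 \<le> \<omega> ?z" using yd p y by (cases "\<omega> (y [^] d)") (auto simp: val_mult)
  then have "0 < \<omega> (nrd (dia \<pi>\<^sub>K \<one>)) + \<omega> (nrd (dia ?z \<one>))"
    using val_nrd_dia_pi_K val_nrd_dia_integral[OF zc(1)] by (simp add: add_pos_nonneg)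
  also have "\<dots> = \<omega> (nrd (dia (y [^] d) \<one>))" using val_nrd_dia_mult[of "\<pi>\<^sub>K" ?z] zc pi_K by simp
  finally show False using pow by simp
qed

text \<open>For nonzero y the values at y and at its inverse add up to 0. If y is a unit, both are
  nonnegative and hence 0; otherwise y or its inverse has positive valuation and
  \<open>val_nrd_dia_pos\<close> applies.\<close>

lemma val_nrd_dia_zero_iff:
  assumes y: "y \<in> carrier D"
  shows "\<omega> (nrd (dia y \<one>)) = 0 \<longleftrightarrow> \<omega> y = 0"
proof (cases "0 < \<omega> y")
  case True
  then show ?thesis using val_nrd_dia_pos[OF y] by auto
next
  case False
  then have nz: "y \<noteq> \<zero>" by auto
  note i = nonzero_inv[OF y nz]
  obtain s where s: "\<omega> y = ereal s" using y nz val_finite by metis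
  have vi: "\<omega> (inv y) = ereal (- s)" using val_inv[OF y nz] s by simp
  have sum: "\<omega> (nrd (dia y \<one>)) + \<omega> (nrd (dia (inv y) \<one>)) = 0"
    using val_nrd_dia_mult[OF y i(1)] i nrd_one by simp
  show ?thesis
  proof (cases "s = 0")
    case True
    then have "\<omega> y = 0" "\<omega> (inv y) = 0" using s vi by (simp_all add: zero_ereal_def)
    then have "0 \<le> \<omega> (nrd (dia y \<one>))" "0 \<le> \<omega> (nrd (dia (inv y) \<one>))"
      using y i(1) val_nrd_dia_integral by simp_all
    then have "\<omega> (nrd (dia y \<one>)) = 0" using sum by (metis add_nonneg_eq_0_iff)
    then show ?thesis using True s by (simp add: zero_ereal_def)
  next
    case s0: False
    then have "s < 0" using False s by simp
    then have "0 < \<omega> (nrd (dia (inv y) \<one>))" using i vi by (intro val_nrd_dia_pos) auto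
    then have "\<omega> (nrd (dia y \<one>)) \<noteq> 0" using sum by auto
    then show ?thesis using s s0 by simp
  qed
qed

lemma nrd_weyl_inverse: "nrd (ant \<one> (\<ominus> \<one>)) = \<one>"
proof -
  interpret M: monoid M by (rule monoid_mat2)
  show ?thesis unfolding weyl_cubed_elementary by (simp add: nrd_mult nrd_elementary del: mat2_mult)
qed

lemma nrd_dia_inv:
  assumes "x \<in> carrier D" "x \<noteq> \<zero>"
  shows "nrd (dia x (inv x)) = \<one>"
proof -
  have c: "upr (\<ominus> x) \<in> carrier M" "lwr (inv x) \<in> carrier M" "ant \<one> (\<ominus> \<one>) \<in> carrier M"
    using assms nonzero_inv by simp_all
  interpret M: monoid M by (rule monoid_mat2)
  show ?thesis unfolding dia_elementary[OF assms]
    using c assms nonzero_inv nrd_weyl_inverse by (simp add: nrd_mult nrd_elementary del: mat2_mult)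
qed

text \<open>Splitting off the diagonal matrix of e^{-1} and e, which has reduced norm 1, collects
  both entries in the product a e and reduces to \<open>val_nrd_dia_zero_iff\<close>.\<close>

lemma val_nrd_dia_unimodular_iff:
  assumes "a \<in> carrier D" "e \<in> carrier D"
  shows "\<omega> (nrd (dia a e)) = 0 \<longleftrightarrow> \<omega> a + \<omega> e = 0"
proof (cases "e = \<zero>")
  case False
  note i = nonzero_inv[OF assms(2) False]
  have "inv (inv e) = e" using i assms nonzero_Units False by (metis DiffI Units_inv_inv singletonD)
  then have "\<omega> (nrd (dia (inv e) e)) = 0" using nrd_dia_inv[OF i(1,4)] by simp
  moreover have "dia a e = dia (a \<otimes> e) \<one> \<star> dia (inv e) e" using assms i by (simp add: m_assoc)
  ultimately have "\<omega> (nrd (dia a e)) = \<omega> (nrd (dia (a \<otimes> e) \<one>))"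
    using val_nrd_mult[of "dia (a \<otimes> e) \<one>" "dia (inv e) e"] assms i by (simp del: mat2_mult)
  then show ?thesis using val_nrd_dia_zero_iff[of "a \<otimes> e"] assms by (simp add: val_mult)
next
  case True
  note i = nonzero_inv[OF pi_K(3,6)]
  have "dia \<one> \<pi>\<^sub>K = dia \<pi>\<^sub>K \<one> \<star> dia (inv \<pi>\<^sub>K) \<pi>\<^sub>K" using pi_K i by simp
  moreover have "nrd (dia (inv \<pi>\<^sub>K) \<pi>\<^sub>K) = \<one>"
    using nrd_dia_inv[OF i(1,4)] pi_K nonzero_Units by (metis DiffI Units_inv_inv singletonD)
  ultimately have pos: "0 < \<omega> (nrd (dia \<one> \<pi>\<^sub>K))"
    using val_nrd_mult[of "dia \<pi>\<^sub>K \<one>" "dia (inv \<pi>\<^sub>K) \<pi>\<^sub>K"] pi_K i val_nrd_dia_pi_K by (simp del: mat2_mult)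
  \<comment> \<open>A zero entry absorbs \<open>\<pi>\<^sub>K\<close>, so the value equals itself
    plus a positive amount and cannot be 0.\<close>
  have "dia a \<zero> = dia a \<zero> \<star> dia \<one> \<pi>\<^sub>K" using assms pi_K by simp
  then have "\<omega> (nrd (dia a \<zero>)) = \<omega> (nrd (dia a \<zero>)) + \<omega> (nrd (dia \<one> \<pi>\<^sub>K))"
    using val_nrd_mult[of "dia a \<zero>" "dia \<one> \<pi>\<^sub>K"] assms pi_K by (simp del: mat2_mult)
  then have "\<omega> (nrd (dia a \<zero>)) \<noteq> 0" using pos by auto
  moreover have "\<omega> a + \<omega> e \<noteq> 0" using True val_neq_minus_infinity[OF assms(1)] by simp
  ultimately show ?thesis using True by simp
qed

sublocale valued_skew_field_det D \<omega> "\<lambda>g. \<omega> (nrd g)"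
  by unfold_locales (use val_nrd_mult nrd_elementary val_nrd_dia_unimodular_iff in auto)

end

section \<open>Truncated valuation rings\<close>

text \<open>Both truncations are instances: A = E with \<open>\<pi>\<^sub>K\<close>, and A = D with
  u. The ring A may be noncommutative.\<close>

locale uniformised_subring = valued_skew_field D \<omega>
  for D :: "('a, 'b) ring_scheme" (structure) and \<omega> :: "'a \<Rightarrow> ereal" +
  fixes A :: "'a set" and p :: 'a and s :: real
  assumes A_subring: "subring A D"
    and A_inv: "\<lbrakk>x \<in> A; x \<noteq> \<zero>\<rbrakk> \<Longrightarrow> inv x \<in> A"
    and A_uniformiser: "uniformiser \<omega> A p" and val_p: "\<omega> p = ereal s"
begin

abbreviation OA where "OA \<equiv> val_ring D \<omega> A"
abbreviation I where "I k \<equiv> val_ideal_pow D \<omega> A k"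
abbreviation T where "T k \<equiv> trunc_ring D \<omega> A k"
abbreviation tr where "tr k \<equiv> trunc D \<omega> A k"

lemmas A_ops = subringE[OF A_subring]

lemma A_carrier: "x \<in> A \<Longrightarrow> x \<in> carrier D"
  using A_ops(1) by blast

lemma p_facts: "p \<in> A" "0 < s" "p \<noteq> \<zero>" "p \<in> carrier D"
proof -
  show "p \<in> A" using A_uniformiser by (simp add: uniformiser_def val_ideal_def)
  then show "p \<in> carrier D" by (rule A_carrier)
  show "0 < s" using A_uniformiser val_p by (simp add: uniformiser_def val_ideal_def)
  show "p \<noteq> \<zero>" using val_p by auto
qed

lemma val_ring_simps [simp]:
  "carrier OA = {x \<in> A. 0 \<le> \<omega> x}" "\<zero>\<^bsub>OA\<^esub> = \<zero>" "\<one>\<^bsub>OA\<^esub> = \<one>"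
  "x \<oplus>\<^bsub>OA\<^esub> y = x \<oplus> y" "x \<otimes>\<^bsub>OA\<^esub> y = x \<otimes> y"
  by (simp_all add: val_ring_def)

sublocale OA: ring OA
  by (rule val_ring_ring[OF A_subring])

lemma val_ring_uminus: "x \<in> carrier OA \<Longrightarrow> \<ominus>\<^bsub>OA\<^esub> x = \<ominus> x"
  using OA.minus_equality[of "\<ominus> x" x] A_ops A_carrier by (simp add: l_neg)

lemma val_ring_minus: "x \<in> carrier OA \<Longrightarrow> y \<in> carrier OA \<Longrightarrow> x \<ominus>\<^bsub>OA\<^esub> y = x \<ominus> y"
  using val_ring_uminus[of y] by (simp add: a_minus_def)

text \<open>An element of valuation at least (k + 1) s is its quotient by p, which lies in the k-th
  power, times p. So the abstract ideal power is cut out by a bound on the valuation.\<close>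

lemma val_ideal_pow_eq: "I k = {x \<in> A. ereal (real k * s) \<le> \<omega> x}"
proof (induction k)
  case 0
  then show ?case by (auto simp: val_ideal_pow_def ideals_set_def nat_pow_def zero_ereal_def)
next
  case (Suc k)
  have step: "I (Suc k) = ideal_prod OA (I k) (val_ideal \<omega> A)"
    by (simp add: val_ideal_pow_def ideals_set_def nat_pow_def)
  show ?case
  proof
    show "I (Suc k) \<subseteq> {x \<in> A. ereal (real (Suc k) * s) \<le> \<omega> x}"
    proof
      fix x assume "x \<in> I (Suc k)"
      then have "x \<in> ideal_prod OA (I k) (val_ideal \<omega> A)" by (simp add: step)
      then show "x \<in> {x \<in> A. ereal (real (Suc k) * s) \<le> \<omega> x}"
      proof (induction rule: ideal_prod.induct)
        case (prod i j)
        have ij: "i \<in> A" "j \<in> A" "ereal (real k * s) \<le> \<omega> i" "ereal s \<le> \<omega> j"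
          using prod Suc A_uniformiser val_p by (auto simp: uniformiser_def val_ideal_def)
        then show ?case
          using val_mult_ge[of i j "real k * s" s] A_ops A_carrier by (auto simp: algebra_simps)
      next
        case (sum s1 s2)
        then show ?case using A_ops A_carrier by (auto intro: val_add_ge)
      qed
    qed
    show "{x \<in> A. ereal (real (Suc k) * s) \<le> \<omega> x} \<subseteq> I (Suc k)"
    proof
      fix x assume x: "x \<in> {x \<in> A. ereal (real (Suc k) * s) \<le> \<omega> x}"
      note i = nonzero_inv[OF p_facts(4,3)]
      have xi: "x \<otimes> inv p \<in> A" using x A_ops A_inv p_facts by auto
      have "\<omega> (x \<otimes> inv p) = \<omega> x + ereal (- s)"
        using val_mult[of x "inv p"] val_inv[OF p_facts(4,3)] val_p x A_carrier i by simp
      then have "ereal (real k * s) \<le> \<omega> (x \<otimes> inv p)"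
        using x by (cases "\<omega> x") (auto simp: algebra_simps)
      then have "x \<otimes> inv p \<in> I k" using xi Suc by simp
      moreover have "p \<in> val_ideal \<omega> A" using A_uniformiser by (simp add: uniformiser_def)
      ultimately have "(x \<otimes> inv p) \<otimes>\<^bsub>OA\<^esub> p \<in> ideal_prod OA (I k) (val_ideal \<omega> A)"
        by (rule ideal_prod.prod)
      moreover have "(x \<otimes> inv p) \<otimes>\<^bsub>OA\<^esub> p = x"
        using x i p_facts A_carrier by (simp add: m_assoc)
      ultimately show "x \<in> I (Suc k)" by (simp add: step)
    qed
  qed
qed

lemma val_ideal_pow_ideal: "ideal (I k) OA"
proof (rule idealI)
  show "ring OA" by (rule OA.ring_axioms)
  have nn: "0 \<le> \<omega> x" if "ereal (real k * s) \<le> \<omega> x" for x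
    using order_trans[OF _ that, of 0] p_facts(2) by simp
  show "subgroup (I k) (add_monoid OA)"
  proof (rule OA.add.subgroupI)
    show "I k \<subseteq> carrier OA" using nn by (auto simp: val_ideal_pow_eq)
    show "I k \<noteq> {}" using A_ops(2) by (auto simp: val_ideal_pow_eq)
    fix a assume a: "a \<in> I k"
    then have "a \<in> carrier OA" using nn by (auto simp: val_ideal_pow_eq)
    then show "\<ominus>\<^bsub>OA\<^esub> a \<in> I k"
      using a val_ring_uminus[of a] A_ops A_carrier by (simp add: val_ideal_pow_eq)
    fix b assume "b \<in> I k"
    then show "a \<oplus>\<^bsub>OA\<^esub> b \<in> I k" using a A_ops A_carrier by (auto simp: val_ideal_pow_eq intro: val_add_ge)
  qed
  fix a x assume a: "a \<in> I k" and x: "x \<in> carrier OA"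
  have v: "ereal (real k * s) \<le> \<omega> a" "ereal 0 \<le> \<omega> x" "a \<in> carrier D" "x \<in> carrier D"
    using a x A_carrier by (auto simp: val_ideal_pow_eq zero_ereal_def)
  then show "x \<otimes>\<^bsub>OA\<^esub> a \<in> I k" "a \<otimes>\<^bsub>OA\<^esub> x \<in> I k"
    using a x A_ops val_mult_ge[OF v(4,3,2,1)] val_mult_ge[OF v(3,4,1,2)] by (auto simp: val_ideal_pow_eq)
qed

lemma trunc_hom: "ring_hom_ring OA (T k) (tr k)"
  unfolding trunc_ring_def trunc_def using ideal.rcos_ring_hom_ring[OF val_ideal_pow_ideal] .

lemma trunc_carrier: "carrier (T k) = tr k ` carrier OA"
  unfolding trunc_ring_def trunc_def FactRing_def A_RCOSETS_def' by (simp add: UNION_singleton_eq_range)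

lemma trunc_eq_iff:
  assumes "x \<in> carrier OA" "y \<in> carrier OA"
  shows "tr k x = tr k y \<longleftrightarrow> ereal (real k * s) \<le> \<omega> (x \<ominus> y)"
proof -
  have "x \<ominus> y \<in> A" using assms A_ops by (auto simp: minus_eq)
  then show ?thesis
    using OA.quotient_eq_iff_same_a_r_cos[OF val_ideal_pow_ideal assms, of k] assms val_ring_minus
    by (simp add: trunc_def val_ideal_pow_eq)
qed

lemma trunc_eq_zero_iff:
  assumes "x \<in> carrier OA"
  shows "tr k x = \<zero>\<^bsub>T k\<^esub> \<longleftrightarrow> ereal (real k * s) \<le> \<omega> x"
proof -
  interpret h: ring_hom_ring OA "T k" "tr k" by (rule trunc_hom)
  have "\<zero>\<^bsub>T k\<^esub> = tr k \<zero>" using h.hom_zero by simp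
  then show ?thesis using trunc_eq_iff[OF assms, of \<zero> k] A_ops assms A_carrier by (simp add: minus_eq)
qed

lemma mem_trunc:
  assumes "x \<in> carrier OA"
  shows "y \<in> tr k x \<longleftrightarrow> y \<in> carrier OA \<and> tr k y = tr k x"
proof -
  interpret Ik: ideal "I k" OA by (rule val_ideal_pow_ideal)
  show ?thesis
    unfolding trunc_def
  proof
    assume y: "y \<in> I k +>\<^bsub>OA\<^esub> x"
    then show "y \<in> carrier OA \<and> I k +>\<^bsub>OA\<^esub> y = I k +>\<^bsub>OA\<^esub> x"
      using Ik.a_repr_independence'[OF y assms] Ik.a_elemrcos_carrier[OF assms y] by metis
  next
    assume "y \<in> carrier OA \<and> I k +>\<^bsub>OA\<^esub> y = I k +>\<^bsub>OA\<^esub> x"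
    then show "y \<in> I k +>\<^bsub>OA\<^esub> x" using Ik.a_rcos_self[of y] by metis
  qed
qed

text \<open>Below the threshold, adding an element of the ideal cannot change the valuation, so
  \<open>the_elem\<close> in \<open>trunc_val\<close> meets a singleton; from the threshold on the
  class is zero.\<close>

lemma trunc_val_trunc:
  assumes "x \<in> carrier OA"
  shows "trunc_val D \<omega> A k (tr k x) = (if ereal (real k * s) \<le> \<omega> x then \<infinity> else \<omega> x)"
proof (cases "ereal (real k * s) \<le> \<omega> x")
  case True
  then show ?thesis using trunc_eq_zero_iff[OF assms] by (simp add: trunc_val_def)
next
  case False
  have "\<omega> y = \<omega> x" if "y \<in> tr k x" for y
  proof -
    have y: "y \<in> carrier OA" "ereal (real k * s) \<le> \<omega> (y \<ominus> x)"
      using that mem_trunc[OF assms] trunc_eq_iff[OF _ assms] by auto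
    have c: "x \<in> carrier D" "y \<in> carrier D" using assms y A_carrier by auto
    then have "x \<oplus> (y \<ominus> x) = y" by (rule cancel_add_minus)
    moreover have "\<omega> x < \<omega> (y \<ominus> x)" using y(2) False by (metis linorder_not_less order_less_le_trans)
    then have "\<omega> (x \<oplus> (y \<ominus> x)) = \<omega> x" using c by (intro val_add_eq minus_closed)
    ultimately show ?thesis by simp
  qed
  moreover have "x \<in> tr k x" using mem_trunc[OF assms] assms by blast
  ultimately have "\<omega> ` tr k x = {\<omega> x}" by blast
  then show ?thesis using False trunc_eq_zero_iff[OF assms] by (simp add: trunc_val_def)
qed

end

section \<open>Comparison of the tree with its local version\<close>

context cyclic_local_division_algebra
begin

sublocale TE: uniformised_subring D \<omega> E \<pi>\<^sub>K q
proof (intro uniformised_subring.intro uniformised_subring_axioms.intro valued_skew_field_axioms)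
  show "inv x \<in> E" if "x \<in> E" "x \<noteq> \<zero>" for x
    using subfield_m_inv(1)[OF E_subfield, of x] that by simp
qed (rule subfieldE(1)[OF E_subfield] uniformiser_E pi_K(4))+

sublocale TD: uniformised_subring D \<omega> "carrier D" u qD
  by (intro uniformised_subring.intro uniformised_subring_axioms.intro valued_skew_field_axioms
      carrier_is_subring nonzero_inv(1) uniformiser_D val_u(1))

section \<open>Reduction of matrices and of their determinants\<close>

abbreviation red where "red r \<equiv> reduction D \<omega> (r * d)"
abbreviation RD where "RD r \<equiv> trunc_ring D \<omega> (carrier D) (r * d)"
abbreviation tD where "tD r \<equiv> trunc D \<omega> (carrier D) (r * d)"
abbreviation SL where "SL \<equiv> SL2 D E u d"
abbreviation tpt where "tpt \<equiv> tree_pt D \<omega> E u d"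
abbreviation lpt where "lpt \<equiv> loc_pt D \<omega> E u d"
abbreviation apt where "apt \<pi> r \<equiv> apt_interval D \<omega> \<pi> (r * d)"
abbreviation tE where "tE r \<equiv> trunc D \<omega> E r"

text \<open>The preimage of the local SL_2 among the integral matrices, as
  \<open>red_SL2_loc_iff\<close> shows; the bound r * q is the one that cuts out m_E^r.\<close>

definition congr :: "nat \<Rightarrow> 'a mat2 set" where
  "congr r = {g \<in> carrier M. val_ge \<omega> g 0 \<and> ereal (real r * q) \<le> \<omega> (nrd g \<ominus> \<one>)}"

lemma threshold: "real (r * d) * qD = real r * q"
  using val_u(2) by simp

lemma val_ge_zero_iff: "val_ge \<omega> (Mat2 a b c e) 0 \<longleftrightarrow> 0 \<le> \<omega> a \<and> 0 \<le> \<omega> b \<and> 0 \<le> \<omega> c \<and> 0 \<le> \<omega> e"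
  by (simp add: val_ge_def zero_ereal_def)

text \<open>Representatives of a class differ by an element of m_D^{rd}, whose image has entries in
  m_E^r by \<open>val_phi\<close>. Hence \<open>the_elem\<close> in \<open>phi_bar\<close> meets a
  singleton.\<close>

lemma phi_bar_trunc:
  assumes "a \<in> carrier D" "0 \<le> \<omega> a" "i < d"
  shows "phi_bar D \<omega> E u d r (tD r a) i j = tE r (ph a i j)"
proof -
  have pO: "ph x i j \<in> carrier (val_ring D \<omega> E)" if "x \<in> carrier D" "0 \<le> \<omega> x" for x
    using val_phi[of x 0 i j] phi_E that assms by (simp add: zero_ereal_def)
  have "tE r (ph b i j) = tE r (ph a i j)" if "b \<in> tD r a" for b
  proof -
    have b: "b \<in> carrier D" "0 \<le> \<omega> b" "ereal (real r * q) \<le> \<omega> (b \<ominus> a)"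
      using that TD.mem_trunc[of a b "r * d"] TD.trunc_eq_iff[of b a "r * d"] assms
      unfolding threshold by auto
    have "ph b i j = ph a i j \<oplus> ph (b \<ominus> a) i j"
      using phi_add[of a "b \<ominus> a" i j] assms b by (simp add: cancel_add_minus)
    moreover have c: "ph a i j \<in> carrier D" "ph (b \<ominus> a) i j \<in> carrier D"
      using assms b phi_E E_carrier by auto
    ultimately have "ph b i j \<ominus> ph a i j = ph (b \<ominus> a) i j"
      by (simp add: minus_eq a_ac r_neg1 r_neg2 r_neg)
    moreover have "ereal (real r * q) \<le> \<omega> (ph (b \<ominus> a) i j)"
      using val_phi[of "b \<ominus> a" "int r" i j] assms b by simp
    ultimately show ?thesis using TE.trunc_eq_iff[OF pO pO] assms b by simp
  qed
  moreover have "a \<in> tD r a" using TD.mem_trunc[of a a "r * d"] assms by simp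
  ultimately have "(\<lambda>b. tE r (ph b i j)) ` tD r a = {tE r (ph a i j)}" by blast
  then show ?thesis by (simp add: phi_bar_def)
qed

lemma red_Mat2: "red r (Mat2 a b c e) = Mat2 (tD r a) (tD r b) (tD r c) (tD r e)"
  by (simp add: reduction_def)

lemma mat2_loc_carrier:
  "carrier (mat2_monoid (RD r)) = red r ` {g \<in> carrier M. val_ge \<omega> g 0}"
proof (intro equalityI subsetI)
  fix G assume "G \<in> carrier (mat2_monoid (RD r))"
  then obtain a b c e where "G = Mat2 a b c e"
    "a \<in> carrier (RD r)" "b \<in> carrier (RD r)" "c \<in> carrier (RD r)" "e \<in> carrier (RD r)"
    by (elim mat2_carrierE)
  then obtain a' b' c' e' where G: "G = Mat2 (tD r a') (tD r b') (tD r c') (tD r e')"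
    "a' \<in> carrier D" "b' \<in> carrier D" "c' \<in> carrier D" "e' \<in> carrier D"
    "0 \<le> \<omega> a'" "0 \<le> \<omega> b'" "0 \<le> \<omega> c'" "0 \<le> \<omega> e'"
    unfolding TD.trunc_carrier by auto
  then have "G = red r (Mat2 a' b' c' e')" "Mat2 a' b' c' e' \<in> {g \<in> carrier M. val_ge \<omega> g 0}"
    by (auto simp: red_Mat2 val_ge_zero_iff)
  then show "G \<in> red r ` {g \<in> carrier M. val_ge \<omega> g 0}" by blast
next
  fix G assume "G \<in> red r ` {g \<in> carrier M. val_ge \<omega> g 0}"
  then show "G \<in> carrier (mat2_monoid (RD r))"
    by (auto elim!: mat2_carrierE simp: red_Mat2 val_ge_zero_iff TD.trunc_carrier)
qed

lemma red_mult:
  assumes "g \<in> carrier M" "val_ge \<omega> g 0" "h \<in> carrier M" "val_ge \<omega> h 0"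
  shows "red r (g \<star> h) = red r g \<otimes>\<^bsub>mat2_monoid (RD r)\<^esub> red r h"
proof -
  interpret h: ring_hom_ring "val_ring D \<omega> (carrier D)" "RD r" "tD r" by (rule TD.trunc_hom)
  have m: "tD r (x \<otimes> y) = tD r x \<otimes>\<^bsub>RD r\<^esub> tD r y" "tD r (x \<oplus> y) = tD r x \<oplus>\<^bsub>RD r\<^esub> tD r y"
    if "x \<in> carrier D" "0 \<le> \<omega> x" "y \<in> carrier D" "0 \<le> \<omega> y" for x y
    using h.hom_mult[of x y] h.hom_add[of x y] that by simp_all
  have nn: "0 \<le> \<omega> (x \<otimes> y)" if "x \<in> carrier D" "0 \<le> \<omega> x" "y \<in> carrier D" "0 \<le> \<omega> y" for x y
    using that by (simp add: val_mult)
  show ?thesis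
    using assms by (elim mat2_carrierE) (auto simp: red_Mat2 val_ge_zero_iff m nn)
qed

lemma red_one: "red r \<one>\<^bsub>M\<^esub> = \<one>\<^bsub>mat2_monoid (RD r)\<^esub>"
proof -
  interpret h: ring_hom_ring "val_ring D \<omega> (carrier D)" "RD r" "tD r" by (rule TD.trunc_hom)
  show ?thesis using h.hom_one h.hom_zero by (simp add: red_Mat2)
qed

text \<open>Reduction of O_E is a ring homomorphism, so the determinant of the reduced matrix is the
  class of the reduced norm.\<close>

lemma red_SL2_loc_iff:
  assumes "g \<in> carrier M" "val_ge \<omega> g 0"
  shows "red r g \<in> carrier (SL2_loc D \<omega> E u d r) \<longleftrightarrow> g \<in> congr r"
proof -
  interpret OE: cring "val_ring D \<omega> E" by (rule val_ring_E_cring)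
  have "ring_hom_cring (val_ring D \<omega> E) (trunc_ring D \<omega> E r) (tE r)"
    unfolding trunc_ring_def trunc_def
    using ideal.rcos_ring_hom_cring[OF TE.val_ideal_pow_ideal val_ring_E_cring] .
  then interpret h: ring_hom_cring "val_ring D \<omega> E" "trunc_ring D \<omega> E r" "tE r" .
  have B: "block_mat ph d g i j \<in> carrier (val_ring D \<omega> E)" if "i < 2 * d" for i j
    using nrd_val_ring(2)[OF assms that] .
  have "block_mat (phi_bar D \<omega> E u d r) d (red r g) i j = tE r (block_mat ph d g i j)" if "i < 2 * d" for i j
    using assms that by (elim mat2_carrierE) (auto simp: red_Mat2 block_mat_def val_ge_zero_iff phi_bar_trunc)
  then have "ring_det (trunc_ring D \<omega> E r) (2 * d) (block_mat (phi_bar D \<omega> E u d r) d (red r g))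
      = ring_det (trunc_ring D \<omega> E r) (2 * d) (\<lambda>i j. tE r (block_mat ph d g i j))"
    using h.hom_closed B by (intro h.S.ring_det_cong) auto
  also have "\<dots> = tE r (ring_det (val_ring D \<omega> E) (2 * d) (block_mat ph d g))"
    using B by (intro h.hom_ring_det[symmetric])
  also have "\<dots> = tE r (nrd g)" using nrd_val_ring(1)[OF assms] by simp
  finally have det: "ring_det (trunc_ring D \<omega> E r) (2 * d) (block_mat (phi_bar D \<omega> E u d r) d (red r g)) = tE r (nrd g)" .
  have "red r g \<in> carrier (mat2_monoid (RD r))" using assms mat2_loc_carrier by blast
  then have "red r g \<in> carrier (SL2_loc D \<omega> E u d r) \<longleftrightarrow> tE r (nrd g) = \<one>\<^bsub>trunc_ring D \<omega> E r\<^esub>"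
    by (simp add: SL2_loc_def Let_def det)
  also have "\<dots> \<longleftrightarrow> tE r (nrd g) = tE r \<one>" using h.hom_one by simp
  also have "\<dots> \<longleftrightarrow> ereal (real r * q) \<le> \<omega> (nrd g \<ominus> \<one>)"
    using nrd_E nrd_integral assms E_ops by (intro TE.trunc_eq_iff) auto
  finally show ?thesis using assms by (simp add: congr_def)
qed

lemma SL2_loc_carrier: "carrier (SL2_loc D \<omega> E u d r) = red r ` congr r"
proof -
  have "carrier (SL2_loc D \<omega> E u d r) \<subseteq> red r ` {g \<in> carrier M. val_ge \<omega> g 0}"
    unfolding mat2_loc_carrier[symmetric] by (auto simp: SL2_loc_def Let_def)
  then show ?thesis using red_SL2_loc_iff by (auto simp: congr_def)
qed

text \<open>Truncation only replaces valuations from r * q on by \<infinity>, which a bound t up to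
  and including r * q cannot detect. This is where the radius rd enters.\<close>

lemma trunc_val_ge_iff:
  assumes "a \<in> carrier D" "0 \<le> \<omega> a" "t \<le> real r * q"
  shows "ereal t \<le> trunc_val D \<omega> (carrier D) (r * d) (tD r a) \<longleftrightarrow> ereal t \<le> \<omega> a"
proof -
  have "ereal t \<le> \<omega> a" if "ereal (real r * q) \<le> \<omega> a"
    using that assms(3) by (meson ereal_less_eq(3) order_trans)
  moreover have "trunc_val D \<omega> (carrier D) (r * d) (tD r a) = (if ereal (real r * q) \<le> \<omega> a then \<infinity> else \<omega> a)"
    using TD.trunc_val_trunc[of a "r * d"] assms unfolding threshold by simp
  ultimately show ?thesis by simp
qed

lemma val_ge_red_iff:
  assumes "g \<in> carrier M" "val_ge \<omega> g 0" "\<bar>x\<bar> \<le> real r * q"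
  shows "val_ge (trunc_val D \<omega> (carrier D) (r * d)) (red r g) x \<longleftrightarrow> val_ge \<omega> g x"
proof -
  have "0 \<le> real r * q" "x \<le> real r * q" "- x \<le> real r * q" using assms(3) by auto
  then show ?thesis
    using assms(1,2) trunc_val_ge_iff[of _ 0 r]
    by (elim mat2_carrierE) (auto simp: red_Mat2 val_ge_zero_iff val_ge_def trunc_val_ge_iff zero_ereal_def)
qed

lemma point_stab_loc_iff:
  assumes "g \<in> congr r" "\<bar>x\<bar> \<le> real r * q"
  shows "red r g \<in> point_stab_loc D \<omega> E u d r x \<longleftrightarrow> val_ge \<omega> g x"
  using assms val_ge_red_iff[of g x r] SL2_loc_carrier
  by (auto simp: point_stab_loc_def point_stab_def congr_def)

lemma P0_loc_carrier: "carrier (P0_loc D \<omega> E u d r) = red r ` congr r"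
proof -
  have "0 \<le> real r * q" using pi_K(5) by simp
  then have "red r g \<in> point_stab_loc D \<omega> E u d r 0" if "g \<in> congr r" for g
    using point_stab_loc_iff[OF that, of 0] that by (simp add: congr_def)
  moreover have "point_stab_loc D \<omega> E u d r 0 \<subseteq> red r ` congr r"
    unfolding SL2_loc_carrier[symmetric] by (auto simp: point_stab_loc_def point_stab_def)
  ultimately show ?thesis by (auto simp: P0_loc_def)
qed

lemma P0_loc_eq: "P0_loc D \<omega> E u d r = (mat2_monoid (RD r))\<lparr>carrier := red r ` congr r\<rparr>"
proof -
  have "P0_loc D \<omega> E u d r = (mat2_monoid (RD r))\<lparr>carrier := carrier (P0_loc D \<omega> E u d r)\<rparr>"
    by (simp add: P0_loc_def SL2_loc_def Let_def)
  then show ?thesis by (simp add: P0_loc_carrier)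
qed

section \<open>SL_2(D) and the congruence group inside the unimodular group\<close>

lemma SL2_eq: "SL2 D E u d = unimod\<lparr>carrier := {g \<in> carrier M. nrd g = \<one>}\<rparr>"
  by (simp add: SL2_def unimod_def)

lemma SL2_carrier: "g \<in> carrier SL \<longleftrightarrow> g \<in> carrier M \<and> nrd g = \<one>"
  by (simp add: SL2_def)

lemma SL2_subgroup: "subgroup (carrier SL) unimod"
proof (rule unimod.subgroupI)
  show sub: "carrier SL \<subseteq> carrier unimod"
    by (auto simp: SL2_carrier unimod_carrier)
  show "carrier SL \<noteq> {}" using nrd_one by (auto simp: SL2_def)
  fix g assume g: "g \<in> carrier SL"
  have i: "uinv g \<in> carrier M" using sub g unimod.inv_closed unimod_carrier by blast
  have "uinv g \<star> g = \<one>\<^bsub>M\<^esub>" using unimod.l_inv[of g] sub g by auto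
  then have "nrd (uinv g) \<otimes> nrd g = \<one>" using nrd_mult[OF i, of g] g nrd_one by (simp add: SL2_carrier)
  then show "uinv g \<in> carrier SL"
    using g i nrd_E E_carrier by (simp add: SL2_carrier)
  fix h assume "h \<in> carrier SL"
  then show "g \<otimes>\<^bsub>unimod\<^esub> h \<in> carrier SL"
    using g nrd_mult M.m_closed by (simp add: SL2_carrier)
qed

lemma SL2_mult: "g \<otimes>\<^bsub>SL\<^esub> h = g \<star> h"
  by (simp add: SL2_eq)

lemma SL2_inv: "g \<in> carrier SL \<Longrightarrow> inv\<^bsub>SL\<^esub> g = uinv g"
  using unimod.m_inv_consistent[OF SL2_subgroup] by (simp add: SL2_eq)

lemma SL2_elem_fix: "l \<in> elem_fix x \<Longrightarrow> l \<in> carrier SL"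
  using nrd_elementary by (auto simp: elem_fix_def SL2_carrier)

lemma SL2_weyl: "weyl \<in> carrier SL"
proof -
  have "nrd weyl = \<one>"
    unfolding weyl_elementary by (simp add: nrd_mult nrd_elementary del: mat2_mult)
  then show ?thesis by (simp add: SL2_carrier)
qed

lemma P0_carrier: "carrier (P0 D \<omega> E u d) = carrier SL \<inter> fixer 0"
  using subgroup.subset[OF SL2_subgroup] by (auto simp: P0_def point_stab_def fixer_iff)

lemma P0_subset_congr: "carrier (P0 D \<omega> E u d) \<subseteq> congr r"
  by (auto simp: P0_carrier congr_def SL2_carrier fixer_iff minus_eq r_neg)

text \<open>Elements of the torus and antitorus have reduced norm 1, so the product in the
  definition stays in SL_2(D) and only the bounds on its entries are at issue.\<close>

lemma tree_rel_iff:
  "((g, x), (h, y)) \<in> tree_rel D \<omega> E u d \<longleftrightarrow>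
    g \<in> carrier SL \<and> h \<in> carrier SL \<and> pt_rel g x h y"
proof -
  note sub = subgroup.subset[OF SL2_subgroup]
  have "(\<exists>n \<in> torus D \<union> antitorus D. nu D \<omega> n x = y \<and>
        inv\<^bsub>SL\<^esub> g \<otimes>\<^bsub>SL\<^esub> h \<otimes>\<^bsub>SL\<^esub> n \<in> point_stab SL \<omega> x) \<longleftrightarrow> pt_rel g x h y"
    if gh: "g \<in> carrier SL" "h \<in> carrier SL"
  proof -
    have n: "n \<in> carrier SL" if "n \<in> torus D \<union> antitorus D" for n
    proof -
      from that consider x where "x \<in> carrier D" "x \<noteq> \<zero>" "n = dia x (inv x)"
        | x where "x \<in> carrier D" "x \<noteq> \<zero>" "n = ant (\<ominus> x) (inv x)"
        by (auto simp: torus_def antitorus_def)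
      then show ?thesis
      proof cases
        case 1
        then show ?thesis using nrd_dia_inv nonzero_inv(1) by (simp add: SL2_carrier)
      next
        case 2
        note i = nonzero_inv[OF 2(1,2)]
        have "inv (inv x) = x" using 2 nonzero_Units by auto
        then have d: "dia (inv x) x \<in> carrier SL"
          using 2 i nrd_dia_inv[OF i(1,4)] by (simp add: SL2_carrier)
        have "n = weyl \<star> dia (inv x) x" using 2 i by (simp add: l_minus)
        then show ?thesis using subgroup.m_closed[OF SL2_subgroup SL2_weyl d] by (simp del: mat2_mult)
      qed
    qed
    have "uinv g \<star> h \<star> n \<in> carrier SL" if "n \<in> torus D \<union> antitorus D" for n
      using subgroup.m_closed[OF SL2_subgroup] subgroup.m_inv_closed[OF SL2_subgroup] gh n[OF that] by fastforce
    then show ?thesis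
      using pt_rel_iff_torus[of g h x y] gh sub SL2_inv[OF gh(1)]
      by (auto simp: SL2_mult fixer_iff point_stab_def)
  qed
  then show ?thesis by (auto simp: tree_rel_def Let_def)
qed

abbreviation PL where "PL r \<equiv> P0_loc D \<omega> E u d r"
abbreviation P where "P \<equiv> P0 D \<omega> E u d"

lemma congr_carrier: "g \<in> congr r \<Longrightarrow> g \<in> carrier M" "g \<in> congr r \<Longrightarrow> val_ge \<omega> g 0"
  by (simp_all add: congr_def)

text \<open>For r > 0 an element congruent to 1 modulo m_E^r is a unit; for r = 0 the congruence
  would say nothing.\<close>

lemma congr_fixer:
  assumes "0 < r" "g \<in> congr r"
  shows "g \<in> fixer 0" "\<omega> (nrd g) = 0"
proof -
  have c: "nrd g \<in> carrier D" using assms nrd_E E_carrier congr_carrier by blast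
  have "0 < real r * q" using assms pi_K(5) by simp
  then have "\<omega> \<one> < \<omega> (nrd g \<ominus> \<one>)"
    using assms(2) order_less_le_trans[of 0 "ereal (real r * q)"] by (simp add: congr_def)
  then have "\<omega> (\<one> \<oplus> (nrd g \<ominus> \<one>)) = \<omega> \<one>" using c by (intro val_add_eq) auto
  then show "\<omega> (nrd g) = 0" using cancel_add_minus(1)[of \<one> "nrd g"] c by simp
  then show "g \<in> fixer 0" using assms congr_carrier by (simp add: fixer_iff unimod_carrier)
qed

lemma congr_subgroup:
  assumes "0 < r"
  shows "subgroup (congr r) unimod"
proof (rule unimod.subgroupI)
  show sub: "congr r \<subseteq> carrier unimod" using congr_fixer[OF assms] by (auto simp: fixer_iff)
  have "\<one>\<^bsub>M\<^esub> \<in> congr r"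
    using nrd_one by (simp add: congr_def val_ge_zero_iff minus_eq r_neg)
  then show "congr r \<noteq> {}" by blast
  fix g assume g: "g \<in> congr r"
  let ?h = "uinv g"
  have hf: "?h \<in> fixer 0" using g congr_fixer[OF assms] subgroup.m_inv_closed[OF fixer_subgroup] by blast
  then have h: "?h \<in> carrier M" "val_ge \<omega> ?h 0" by (auto simp: fixer_iff unimod_carrier)
  have c: "nrd g \<in> carrier D" "nrd ?h \<in> carrier D"
    using g h nrd_E E_carrier congr_carrier by blast+
  have "?h \<star> g = \<one>\<^bsub>M\<^esub>" using unimod.l_inv[of g] sub g by auto
  then have hg: "nrd ?h \<otimes> nrd g = \<one>" using nrd_mult[OF h(1), of g] g nrd_one congr_carrier by simp
  \<comment> \<open>The reduced norm of the inverse is a unit, so this identity shows that both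
    reduced norms are congruent to 1 to the same level.\<close>
  have "nrd ?h \<otimes> (nrd g \<ominus> \<one>) = \<ominus> (nrd ?h \<ominus> \<one>)"
    using c hg by (simp add: minus_eq r_distr r_minus minus_add a_comm)
  then have "\<omega> (nrd ?h \<ominus> \<one>) = \<omega> (nrd ?h \<otimes> (nrd g \<ominus> \<one>))" using c by simp
  also have "\<dots> = \<omega> (nrd g \<ominus> \<one>)" using c hf by (simp add: val_mult fixer_iff unimod_carrier)
  finally show "?h \<in> congr r" using h g by (simp add: congr_def)
  fix g' assume g': "g' \<in> congr r"
  have c': "nrd g' \<in> carrier D" using g' nrd_E E_carrier congr_carrier by blast
  have "nrd g \<otimes> nrd g' \<ominus> \<one> = nrd g \<otimes> (nrd g' \<ominus> \<one>) \<oplus> (nrd g \<ominus> \<one>)"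
    using c c' by (simp add: minus_eq r_distr r_minus a_assoc r_neg1)
  moreover have "ereal (real r * q) \<le> \<omega> (nrd g \<otimes> (nrd g' \<ominus> \<one>))"
    using g' c c' congr_fixer(2)[OF assms g] by (simp add: val_mult congr_def)
  ultimately have "ereal (real r * q) \<le> \<omega> (nrd g \<otimes> nrd g' \<ominus> \<one>)"
    using g c c' by (simp add: val_add_ge congr_def)
  then show "g \<otimes>\<^bsub>unimod\<^esub> g' \<in> congr r"
    using g g' nrd_mult val_ge_mult M.m_closed by (simp add: congr_def)
qed

text \<open>The local group is the image of \<open>congr r\<close> under a homomorphism, so its
  group laws and inverses are inherited instead of being computed in the quotient ring.\<close>

lemma P0_loc_group:
  assumes "0 < r"
  shows "group (PL r)" "g \<in> congr r \<Longrightarrow> inv\<^bsub>PL r\<^esub> (red r g) = red r (uinv g)"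
proof -
  interpret C: group "unimod\<lparr>carrier := congr r\<rparr>"
    using unimod.subgroup_imp_group[OF congr_subgroup[OF assms]] .
  have hom: "red r \<in> hom (unimod\<lparr>carrier := congr r\<rparr>) (PL r)"
    using congr_carrier by (auto simp: hom_def P0_loc_eq red_mult)
  have "PL r\<lparr>carrier := red r ` carrier (unimod\<lparr>carrier := congr r\<rparr>), one := red r \<one>\<^bsub>unimod\<lparr>carrier := congr r\<rparr>\<^esub>\<rparr> = PL r"
    using red_one by (simp add: P0_loc_eq del: mat2_one)
  then show grp: "group (PL r)" using C.hom_imp_img_group[OF hom] by (simp del: mat2_one)
  interpret PL: group "PL r" by (rule grp)
  show "inv\<^bsub>PL r\<^esub> (red r g) = red r (uinv g)" if g: "g \<in> congr r"
  proof (rule PL.inv_equality)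
    have i: "uinv g \<in> congr r" using subgroup.m_inv_closed[OF congr_subgroup[OF assms] g] .
    have "uinv g \<star> g = \<one>\<^bsub>M\<^esub>"
      using unimod.l_inv subgroup.subset[OF congr_subgroup[OF assms]] g by auto
    then show "red r (uinv g) \<otimes>\<^bsub>PL r\<^esub> red r g = \<one>\<^bsub>PL r\<^esub>"
      using red_mult[of "uinv g" g r] g i congr_carrier red_one by (simp add: P0_loc_eq del: mat2_one)
    show "red r g \<in> carrier (PL r)" "red r (uinv g) \<in> carrier (PL r)"
      using g i by (auto simp: P0_loc_carrier)
  qed
qed

lemma trunc_facts:
  shows "monoid (RD r)" "\<zero>\<^bsub>RD r\<^esub> = tD r \<zero>"
    "\<lbrakk>x \<in> carrier D; 0 \<le> \<omega> x\<rbrakk> \<Longrightarrow> \<ominus>\<^bsub>RD r\<^esub> (tD r x) = tD r (\<ominus> x)"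
    "\<lbrakk>x \<in> carrier D; \<omega> x = 0\<rbrakk> \<Longrightarrow> tD r x \<in> Units (RD r) \<and> inv\<^bsub>RD r\<^esub> (tD r x) = tD r (inv x)"
proof -
  interpret h: ring_hom_ring "val_ring D \<omega> (carrier D)" "RD r" "tD r" by (rule TD.trunc_hom)
  show "monoid (RD r)" by (rule h.S.monoid_axioms)
  show "\<zero>\<^bsub>RD r\<^esub> = tD r \<zero>" using h.hom_zero by simp
  show "\<ominus>\<^bsub>RD r\<^esub> (tD r x) = tD r (\<ominus> x)" if "x \<in> carrier D" "0 \<le> \<omega> x"
    using h.hom_a_inv[of x] TD.val_ring_uminus[of x] that by simp
  assume x: "x \<in> carrier D" "\<omega> x = 0"
  then have nz: "x \<noteq> \<zero>" by auto
  note i = nonzero_inv[OF x(1) nz]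
  have o: "x \<in> carrier (val_ring D \<omega> (carrier D))" "inv x \<in> carrier (val_ring D \<omega> (carrier D))"
    using x i val_inv[OF x(1) nz] by simp_all
  have m: "tD r x \<otimes>\<^bsub>RD r\<^esub> tD r (inv x) = \<one>\<^bsub>RD r\<^esub>" "tD r (inv x) \<otimes>\<^bsub>RD r\<^esub> tD r x = \<one>\<^bsub>RD r\<^esub>"
    using h.hom_mult[OF o] h.hom_mult[OF o(2,1)] i h.hom_one by simp_all
  have c: "tD r x \<in> carrier (RD r)" "tD r (inv x) \<in> carrier (RD r)" using h.hom_closed o by blast+
  have "tD r x \<in> Units (RD r)" unfolding Units_def using m c by blast
  moreover have "inv\<^bsub>RD r\<^esub> (tD r x) = tD r (inv x)" using h.S.inv_char[OF c m] .
  ultimately show "tD r x \<in> Units (RD r) \<and> inv\<^bsub>RD r\<^esub> (tD r x) = tD r (inv x)" by blast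
qed

text \<open>For r = 0 the only class is zero, of valuation \<infinity>, so no unit qualifies; this
  is the source of the condition 0 < r in the lemmas that follow.\<close>

lemma trunc_val_zero_iff:
  assumes "x \<in> Units (RD r)"
  shows "trunc_val D \<omega> (carrier D) (r * d) x = 0 \<longleftrightarrow>
    0 < r \<and> (\<exists>a. a \<in> carrier D \<and> \<omega> a = 0 \<and> x = tD r a)"
proof -
  interpret R: monoid "RD r" by (rule trunc_facts)
  have v: "trunc_val D \<omega> (carrier D) (r * d) (tD r a) = (if ereal (real r * q) \<le> \<omega> a then \<infinity> else \<omega> a)"
    if "a \<in> carrier D" "0 \<le> \<omega> a" for a
    using TD.trunc_val_trunc[of a "r * d"] that unfolding threshold by simp
  have "x \<in> carrier (RD r)" using assms by (rule R.Units_closed)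
  then obtain b where b: "b \<in> carrier D" "0 \<le> \<omega> b" "x = tD r b"
    unfolding TD.trunc_carrier by auto
  show ?thesis
  proof
    assume z: "trunc_val D \<omega> (carrier D) (r * d) x = 0"
    then have "\<omega> b = 0" "\<not> ereal (real r * q) \<le> \<omega> b" using v[OF b(1,2)] b(3) by (auto split: if_splits)
    moreover from this have "0 < r" by (cases r) (auto simp: zero_ereal_def)
    ultimately show "0 < r \<and> (\<exists>a. a \<in> carrier D \<and> \<omega> a = 0 \<and> x = tD r a)" using b by blast
  next
    assume "0 < r \<and> (\<exists>a. a \<in> carrier D \<and> \<omega> a = 0 \<and> x = tD r a)"
    then obtain a where "0 < r" "a \<in> carrier D" "\<omega> a = 0" "x = tD r a" by blast
    moreover from this have "\<not> real r * q \<le> 0" using pi_K(5) by (simp add: mult_le_0_iff)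
    ultimately show "trunc_val D \<omega> (carrier D) (r * d) x = 0" using v[of a] by simp
  qed
qed

text \<open>These are the lifts of the local monomial matrices, with reduced norm exactly 1.\<close>

lemma unit_monomial_P0:
  assumes "a \<in> carrier D" "\<omega> a = 0"
  shows "dia a (inv a) \<in> carrier P" "ant (\<ominus> a) (inv a) \<in> carrier P"
proof -
  have nz: "a \<noteq> \<zero>" using assms by auto
  note i = nonzero_inv[OF assms(1) nz]
  have ii: "inv (inv a) = a" using assms nz nonzero_Units by auto
  have vi: "\<omega> (inv a) = 0" using val_inv[OF assms(1) nz] assms by simp
  show "dia a (inv a) \<in> carrier P"
    using assms i vi nrd_dia_inv[OF assms(1) nz]
    by (simp add: P0_carrier SL2_carrier fixer_iff unimod_carrier val_ge_zero_iff)
  have d: "dia (inv a) a \<in> carrier SL"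
    using i assms nrd_dia_inv[OF i(1,4)] ii by (simp add: SL2_carrier)
  have "ant (\<ominus> a) (inv a) = weyl \<star> dia (inv a) a" using assms i by (simp add: l_minus)
  then have "ant (\<ominus> a) (inv a) \<in> carrier SL"
    using subgroup.m_closed[OF SL2_subgroup SL2_weyl d] by (simp del: mat2_mult)
  then show "ant (\<ominus> a) (inv a) \<in> carrier P"
    using assms vi i by (simp add: P0_carrier SL2_carrier fixer_iff unimod_carrier val_ge_zero_iff)
qed

lemma H_loc_iff:
  "n \<in> H_loc D \<omega> E u d r \<longleftrightarrow> 0 < r \<and> (\<exists>a. a \<in> carrier D \<and> \<omega> a = 0 \<and> n = red r (dia a (inv a)))"
proof
  assume "n \<in> H_loc D \<omega> E u d r"
  then obtain x where x: "n = Mat2 x \<zero>\<^bsub>RD r\<^esub> \<zero>\<^bsub>RD r\<^esub> (inv\<^bsub>RD r\<^esub> x)" "x \<in> Units (RD r)"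
      "trunc_val D \<omega> (carrier D) (r * d) x = 0"
    by (auto simp: H_loc_def Let_def)
  then obtain a where a: "0 < r" "a \<in> carrier D" "\<omega> a = 0" "x = tD r a"
    using trunc_val_zero_iff by blast
  have "n = red r (dia a (inv a))" unfolding x(1) a(4) red_Mat2 using trunc_facts(2,4)[where r = r] a by simp
  then show "0 < r \<and> (\<exists>a. a \<in> carrier D \<and> \<omega> a = 0 \<and> n = red r (dia a (inv a)))" using a by blast
next
  assume "0 < r \<and> (\<exists>a. a \<in> carrier D \<and> \<omega> a = 0 \<and> n = red r (dia a (inv a)))"
  then obtain a where a: "0 < r" "a \<in> carrier D" "\<omega> a = 0" "n = red r (dia a (inv a))" by blast
  have t: "tD r a \<in> Units (RD r)" "inv\<^bsub>RD r\<^esub> (tD r a) = tD r (inv a)" using trunc_facts(4) a by blast+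
  have "trunc_val D \<omega> (carrier D) (r * d) (tD r a) = 0" using trunc_val_zero_iff[OF t(1)] a by blast
  moreover have "n = Mat2 (tD r a) \<zero>\<^bsub>RD r\<^esub> \<zero>\<^bsub>RD r\<^esub> (inv\<^bsub>RD r\<^esub> (tD r a))"
    unfolding a(4) red_Mat2 t(2) trunc_facts(2) ..
  moreover have "n \<in> carrier (SL2_loc D \<omega> E u d r)"
    unfolding a(4) using unit_monomial_P0[OF a(2,3)] P0_subset_congr SL2_loc_carrier by blast
  ultimately show "n \<in> H_loc D \<omega> E u d r" unfolding H_loc_def Let_def using t(1) by blast
qed

lemma M_loc_iff:
  "n \<in> M_loc D \<omega> E u d r \<longleftrightarrow> 0 < r \<and> (\<exists>a. a \<in> carrier D \<and> \<omega> a = 0 \<and> n = red r (ant (\<ominus> a) (inv a)))"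
proof
  assume "n \<in> M_loc D \<omega> E u d r"
  then obtain x where x: "n = Mat2 \<zero>\<^bsub>RD r\<^esub> (\<ominus>\<^bsub>RD r\<^esub> x) (inv\<^bsub>RD r\<^esub> x) \<zero>\<^bsub>RD r\<^esub>" "x \<in> Units (RD r)"
      "trunc_val D \<omega> (carrier D) (r * d) x = 0"
    by (auto simp: M_loc_def Let_def)
  then obtain a where a: "0 < r" "a \<in> carrier D" "\<omega> a = 0" "x = tD r a"
    using trunc_val_zero_iff by blast
  have "n = red r (ant (\<ominus> a) (inv a))"
    unfolding x(1) a(4) red_Mat2 using trunc_facts(2,3,4)[where r = r] a by simp
  then show "0 < r \<and> (\<exists>a. a \<in> carrier D \<and> \<omega> a = 0 \<and> n = red r (ant (\<ominus> a) (inv a)))" using a by blast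
next
  assume "0 < r \<and> (\<exists>a. a \<in> carrier D \<and> \<omega> a = 0 \<and> n = red r (ant (\<ominus> a) (inv a)))"
  then obtain a where a: "0 < r" "a \<in> carrier D" "\<omega> a = 0" "n = red r (ant (\<ominus> a) (inv a))" by blast
  have t: "tD r a \<in> Units (RD r)" "inv\<^bsub>RD r\<^esub> (tD r a) = tD r (inv a)" using trunc_facts(4) a by blast+
  have m: "\<ominus>\<^bsub>RD r\<^esub> (tD r a) = tD r (\<ominus> a)" using trunc_facts(3) a by simp
  have "trunc_val D \<omega> (carrier D) (r * d) (tD r a) = 0" using trunc_val_zero_iff[OF t(1)] a by blast
  moreover have "n = Mat2 \<zero>\<^bsub>RD r\<^esub> (\<ominus>\<^bsub>RD r\<^esub> (tD r a)) (inv\<^bsub>RD r\<^esub> (tD r a)) \<zero>\<^bsub>RD r\<^esub>"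
    unfolding a(4) red_Mat2 t(2) m trunc_facts(2) ..
  moreover have "n \<in> carrier (SL2_loc D \<omega> E u d r)"
    unfolding a(4) using unit_monomial_P0[OF a(2,3)] P0_subset_congr SL2_loc_carrier by blast
  ultimately show "n \<in> M_loc D \<omega> E u d r" unfolding M_loc_def Let_def using t(1) by blast
qed

lemma nu_loc_H: "n \<in> H_loc D \<omega> E u d r \<Longrightarrow> nu_loc D \<omega> E u d r n = id"
  by (simp add: nu_loc_def)

text \<open>Since \<open>nu_loc\<close> tests membership in \<open>H_loc\<close>, the two local sets
  must be disjoint: for r > 0 a unit is not congruent to 0.\<close>

lemma nu_loc_M:
  assumes "n \<in> M_loc D \<omega> E u d r"
  shows "nu_loc D \<omega> E u d r n = uminus"
proof -
  have r: "0 < r" using assms by (auto simp: M_loc_iff)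
  have "tD r \<zero> \<noteq> tD r a" if "a \<in> carrier D" "\<omega> a = 0" for a
  proof
    assume "tD r \<zero> = tD r a"
    then have "ereal (real r * q) \<le> \<omega> (\<zero> \<ominus> a)"
      using TD.trunc_eq_iff[of \<zero> a "r * d"] that unfolding threshold by simp
    moreover have "\<not> real r * q \<le> 0" using r pi_K(5) by (simp add: mult_le_0_iff)
    ultimately show False using that by (simp add: minus_eq)
  qed
  then have "n \<notin> H_loc D \<omega> E u d r" using assms r by (auto simp: M_loc_iff H_loc_iff red_Mat2)
  then show ?thesis by (simp add: nu_loc_def)
qed

lemma point_stab_loc_fixer_iff:
  assumes "0 < r" "g \<in> congr r" "\<bar>x\<bar> \<le> real r * q"
  shows "red r g \<in> point_stab_loc D \<omega> E u d r x \<longleftrightarrow> g \<in> fixer x"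
  using point_stab_loc_iff[OF assms(2,3)] congr_fixer(1)[OF assms(1,2)] by (simp add: fixer_iff)

text \<open>Any two uniformisers have the same valuation, so the interval does not depend on the
  choice.\<close>

lemma apt_interval_eq:
  assumes "uniformiser \<omega> (carrier D) \<pi>"
  shows "apt \<pi> r = {- (real r * q)..real r * q}" "\<omega> \<pi> = ereal qD"
proof -
  have "u \<in> val_ideal \<omega> (carrier D)" "\<pi> \<in> val_ideal \<omega> (carrier D)"
    using uniformiser_D assms by (auto simp: uniformiser_def)
  then have "\<omega> \<pi> = \<omega> u" using uniformiser_D assms by (auto simp: uniformiser_def intro: antisym)
  then show v: "\<omega> \<pi> = ereal qD" using val_u by simp
  have "\<pi> \<in> carrier D" using assms by (simp add: uniformiser_def val_ideal_def)
  from val_pow[OF this v, of "r * d"] show "apt \<pi> r = {- (real r * q)..real r * q}"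
    unfolding apt_interval_def threshold by simp
qed

text \<open>For \<open>r = 0\<close> the truncated ring is zero and no element has valuation \<open>0\<close>, hence the local tree
  has the empty class as its only point.\<close>

lemma loc_rel_zero: "loc_rel D \<omega> E u d \<pi> 0 = {}"
proof -
  have "H_loc D \<omega> E u d 0 = {}" "M_loc D \<omega> E u d 0 = {}" by (auto simp: H_loc_iff M_loc_iff)
  then show ?thesis by (simp add: loc_rel_def Let_def)
qed

text \<open>Everything is computed on lifts. A local monomial matrix lifts to a global one.
  Conversely a global monomial matrix need not have integral entries and so need not reduce;
  \<open>pt_rel_integral\<close> trades it for 1 or \<open>weyl\<close>.\<close>

lemma loc_rel_iff:
  assumes r: "0 < r" and g: "g \<in> congr r" and h: "h \<in> congr r" and pi: "uniformiser \<omega> (carrier D) \<pi>"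
  shows "((red r g, x), (red r h, y)) \<in> loc_rel D \<omega> E u d \<pi> r \<longleftrightarrow>
    \<bar>x\<bar> \<le> real r * q \<and> \<bar>y\<bar> \<le> real r * q \<and> pt_rel g x h y"
proof -
  note sg = congr_subgroup[OF r]
  define k where "k = uinv g \<star> h"
  have k: "k \<in> congr r"
    using subgroup.m_closed[OF sg subgroup.m_inv_closed[OF sg g] h] by (simp add: k_def)
  have kf: "k \<in> fixer 0" using congr_fixer[OF r k] by simp
  have mult: "inv\<^bsub>PL r\<^esub> (red r g) \<otimes>\<^bsub>PL r\<^esub> red r h \<otimes>\<^bsub>PL r\<^esub> red r n = red r (k \<star> n)" if "n \<in> congr r" for n
    using P0_loc_group(2)[OF r g] red_mult[of "uinv g" h r] red_mult[of k n r] k h that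
      subgroup.m_inv_closed[OF sg g] congr_carrier by (simp add: P0_loc_eq k_def)
  have kn: "k \<star> n \<in> congr r" if "n \<in> congr r" for n
    using subgroup.m_closed[OF sg k that] by simp
  have dc: "dia a (inv a) \<in> congr r" "ant (\<ominus> a) (inv a) \<in> congr r" if "a \<in> carrier D" "\<omega> a = 0" for a
    using unit_monomial_P0[OF that] P0_subset_congr by blast+
  have stab: "inv\<^bsub>PL r\<^esub> (red r g) \<otimes>\<^bsub>PL r\<^esub> red r h \<otimes>\<^bsub>PL r\<^esub> red r n \<in> point_stab_loc D \<omega> E u d r x
      \<longleftrightarrow> k \<star> n \<in> fixer x" if "n \<in> congr r" "\<bar>x\<bar> \<le> real r * q" for n
    using mult[OF that(1)] point_stab_loc_fixer_iff[OF r kn[OF that(1)] that(2)] by simp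
  have iff: "(\<exists>n \<in> H_loc D \<omega> E u d r \<union> M_loc D \<omega> E u d r. nu_loc D \<omega> E u d r n x = y \<and>
      inv\<^bsub>PL r\<^esub> (red r g) \<otimes>\<^bsub>PL r\<^esub> red r h \<otimes>\<^bsub>PL r\<^esub> n \<in> point_stab_loc D \<omega> E u d r x) \<longleftrightarrow> pt_rel g x h y"
    (is "?L \<longleftrightarrow> _") if x: "\<bar>x\<bar> \<le> real r * q"
  proof
    assume ?L
    then obtain n where n: "n \<in> H_loc D \<omega> E u d r \<union> M_loc D \<omega> E u d r" "nu_loc D \<omega> E u d r n x = y"
      "inv\<^bsub>PL r\<^esub> (red r g) \<otimes>\<^bsub>PL r\<^esub> red r h \<otimes>\<^bsub>PL r\<^esub> n \<in> point_stab_loc D \<omega> E u d r x" by blast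
    from n(1) have "\<exists>m\<in>monomials. aff m x = y \<and> k \<star> m \<in> fixer x"
    proof
      assume H: "n \<in> H_loc D \<omega> E u d r"
      then obtain a where a: "a \<in> carrier D" "\<omega> a = 0" "n = red r (dia a (inv a))"
        by (auto simp: H_loc_iff)
      have nz: "a \<noteq> \<zero>" using a by auto
      have "dia a (inv a) \<in> monomials"
        using a nz nonzero_inv(1) val_inv by (intro dia_monomials) auto
      moreover have "aff (dia a (inv a)) x = y" using n(2) nu_loc_H[OF H] a nz by (simp add: aff_def)
      moreover have "k \<star> dia a (inv a) \<in> fixer x" using n(3) stab[OF dc(1)[OF a(1,2)] x] a(3) by simp
      ultimately show ?thesis by blast
    next
      assume H: "n \<in> M_loc D \<omega> E u d r"
      then obtain a where a: "a \<in> carrier D" "\<omega> a = 0" "n = red r (ant (\<ominus> a) (inv a))"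
        by (auto simp: M_loc_iff)
      have nz: "a \<noteq> \<zero>" using a by auto
      have "ant (\<ominus> a) (inv a) \<in> monomials"
        using a nz nonzero_inv(1) val_inv by (intro ant_monomials) auto
      moreover have "aff (ant (\<ominus> a) (inv a)) x = y" using n(2) nu_loc_M[OF H] a nz by (simp add: aff_def)
      moreover have "k \<star> ant (\<ominus> a) (inv a) \<in> fixer x" using n(3) stab[OF dc(2)[OF a(1,2)] x] a(3) by simp
      ultimately show ?thesis by blast
    qed
    then show "pt_rel g x h y" by (simp add: pt_rel_def k_def)
  next
    assume "pt_rel g x h y"
    then consider "y = x" "k \<in> fixer x" | "y = - x" "k \<star> weyl \<in> fixer x"
      using pt_rel_integral kf unfolding k_def by blast
    then show ?L
    proof cases
      case 1
      \<comment> \<open>The identity, spelled as the case a = 1 of \<open>H_loc_iff\<close>.\<close>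
      let ?n = "dia \<one> (inv \<one>)"
      have n: "red r ?n \<in> H_loc D \<omega> E u d r"
        unfolding H_loc_iff using r one_closed val_one by blast
      have "?n = \<one>\<^bsub>M\<^esub>" by simp
      then have "k \<star> ?n \<in> fixer x" using 1 k congr_carrier M.r_one by metis
      then show ?thesis using n nu_loc_H[OF n] stab[OF dc(1)[of \<one>] x] 1(1) by (intro bexI[of _ "red r ?n"]) auto
    next
      case 2
      let ?n = "ant (\<ominus> \<one>) (inv \<one>)"
      have n: "red r ?n \<in> M_loc D \<omega> E u d r"
        unfolding M_loc_iff using r one_closed val_one by blast
      have "k \<star> ?n \<in> fixer x" using 2 by (simp del: mat2_mult)
      then show ?thesis using n nu_loc_M[OF n] stab[OF dc(2)[of \<one>] x] 2(1) by (intro bexI[of _ "red r ?n"]) auto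
    qed
  qed
  have "red r g \<in> carrier (PL r)" "red r h \<in> carrier (PL r)" using g h by (simp_all add: P0_loc_carrier)
  moreover have "t \<in> {- (real r * q)..real r * q} \<longleftrightarrow> \<bar>t\<bar> \<le> real r * q" for t by auto
  ultimately show ?thesis
    using iff unfolding loc_rel_def Let_def apt_interval_eq[OF pi] by blast
qed

section \<open>Points of both trees and the group actions\<close>

lemma tree_pt_eq: "g \<in> carrier SL \<Longrightarrow>
    tpt g x = {(h, y). h \<in> carrier SL \<and> pt_rel g x h y}"
  by (auto simp: tree_pt_def tree_rel_iff)

lemma SL2_unimod: "g \<in> carrier SL \<Longrightarrow> g \<in> carrier unimod"
  using subgroup.subset[OF SL2_subgroup] by blast

lemma tree_pt_eq_iff:
  assumes "g \<in> carrier SL" "h \<in> carrier SL"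
  shows "tpt g x = tpt h y \<longleftrightarrow> pt_rel g x h y"
proof
  assume "tpt g x = tpt h y"
  then show "pt_rel g x h y"
    using pt_rel_refl[OF SL2_unimod[OF assms(2)]] assms by (auto simp: tree_pt_eq)
next
  assume gh: "pt_rel g x h y"
  note s = SL2_unimod
  show "tpt g x = tpt h y"
    unfolding tree_pt_eq[OF assms(1)] tree_pt_eq[OF assms(2)]
    using pt_rel_trans[OF s s s gh] pt_rel_trans[OF s s s pt_rel_sym[OF s s gh]] assms by auto
qed

lemma loc_pt_eq:
  assumes "0 < r" "g \<in> congr r" "uniformiser \<omega> (carrier D) \<pi>" "\<bar>x\<bar> \<le> real r * q"
  shows "lpt \<pi> r (red r g) x = {(red r h, y) | h y. h \<in> congr r \<and> \<bar>y\<bar> \<le> real r * q \<and> pt_rel g x h y}"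
proof -
  have "loc_rel D \<omega> E u d \<pi> r \<subseteq> UNIV \<times> (red r ` congr r) \<times> UNIV"
    unfolding loc_rel_def Let_def P0_loc_carrier by auto
  then show ?thesis
    unfolding loc_pt_def using loc_rel_iff[OF assms(1,2) _ assms(3)] assms(4) by fastforce
qed

lemma loc_pt_eq_iff:
  assumes r: "0 < r" and g: "g \<in> congr r" and h: "h \<in> congr r" and pi: "uniformiser \<omega> (carrier D) \<pi>"
    and x: "\<bar>x\<bar> \<le> real r * q" and y: "\<bar>y\<bar> \<le> real r * q"
  shows "lpt \<pi> r (red r g) x = lpt \<pi> r (red r h) y \<longleftrightarrow> pt_rel g x h y"
proof
  have s: "g \<in> carrier unimod" if "g \<in> congr r" for g
    using that subgroup.subset[OF congr_subgroup[OF r]] by blast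
  show "pt_rel g x h y" if eq: "lpt \<pi> r (red r g) x = lpt \<pi> r (red r h) y"
  proof -
    have "(red r h, y) \<in> lpt \<pi> r (red r h) y"
      using pt_rel_refl[OF s[OF h]] loc_rel_iff[OF r h h pi] y by (simp add: loc_pt_def)
    then have "((red r g, x), (red r h, y)) \<in> loc_rel D \<omega> E u d \<pi> r" using eq by (simp add: loc_pt_def set_eq_iff)
    then show ?thesis using loc_rel_iff[OF r g h pi] by blast
  qed
  assume gh: "pt_rel g x h y"
  have "pt_rel g x k z \<longleftrightarrow> pt_rel h y k z" if "k \<in> congr r" for k z
    using pt_rel_trans[OF s[OF g] s[OF h] s[OF that] gh]
      pt_rel_trans[OF s[OF h] s[OF g] s[OF that] pt_rel_sym[OF s[OF g] s[OF h] gh]] by blast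
  then show "lpt \<pi> r (red r g) x = lpt \<pi> r (red r h) y"
    unfolding loc_pt_eq[OF r g pi x] loc_pt_eq[OF r h pi y] by blast
qed

text \<open>\<open>left_act\<close> yields the translate of one class; that it fills the whole class
  of k g is seen by translating back with k^{-1}, which stays in SL_2(D).\<close>

lemma left_act_tree_pt:
  assumes k: "k \<in> carrier SL" and g: "g \<in> carrier SL"
  shows "left_act SL k (tpt g x) = tpt (k \<star> g) x"
proof -
  note sg = SL2_subgroup
  have kg: "k \<star> g \<in> carrier SL" using subgroup.m_closed[OF sg k g] by simp
  show ?thesis
    unfolding tree_pt_eq[OF g] tree_pt_eq[OF kg] left_act_def SL2_mult
  proof (intro equalityI subsetI)
    fix z assume "z \<in> (\<lambda>(g, x). (k \<star> g, x)) ` {(h, y). h \<in> carrier SL \<and> pt_rel g x h y}"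
    then show "z \<in> {(h, y). h \<in> carrier SL \<and> pt_rel (k \<star> g) x h y}"
      using subgroup.m_closed[OF sg k] pt_rel_left_mult SL2_unimod k g by auto
  next
    fix z assume "z \<in> {(h, y). h \<in> carrier SL \<and> pt_rel (k \<star> g) x h y}"
    then obtain h y where z: "z = (h, y)" "h \<in> carrier SL" "pt_rel (k \<star> g) x h y" by auto
    let ?h = "uinv k \<otimes>\<^bsub>unimod\<^esub> h"
    have h': "?h \<in> carrier SL"
      using subgroup.m_closed[OF sg subgroup.m_inv_closed[OF sg k] z(2)] .
    have e: "k \<otimes>\<^bsub>unimod\<^esub> ?h = h"
      using SL2_unimod k z(2) by (simp add: unimod.m_assoc[symmetric] del: unimod_simps)
    then have "pt_rel g x ?h y"
      using z(3) pt_rel_left_mult[of k g ?h x y] SL2_unimod k g h' by simp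
    then show "z \<in> (\<lambda>(g, x). (k \<star> g, x)) ` {(h, y). h \<in> carrier SL \<and> pt_rel g x h y}"
      using h' e z(1) by (intro image_eqI[of _ _ "(?h, y)"]) auto
  qed
qed

lemma left_act_loc_pt:
  assumes r: "0 < r" and k: "k \<in> congr r" and g: "g \<in> congr r" and pi: "uniformiser \<omega> (carrier D) \<pi>"
    and x: "\<bar>x\<bar> \<le> real r * q"
  shows "left_act (PL r) (red r k) (lpt \<pi> r (red r g) x) = lpt \<pi> r (red r (k \<star> g)) x"
proof -
  note sg = congr_subgroup[OF r]
  have s: "g \<in> carrier unimod" if "g \<in> congr r" for g using that subgroup.subset[OF sg] by blast
  have kg: "k \<star> g \<in> congr r" using subgroup.m_closed[OF sg k g] by simp
  have m: "red r k \<otimes>\<^bsub>PL r\<^esub> red r h = red r (k \<star> h)" if "h \<in> congr r" for h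
    using red_mult[of k h r] that k congr_carrier by (simp add: P0_loc_eq)
  show ?thesis
    unfolding loc_pt_eq[OF r g pi x] loc_pt_eq[OF r kg pi x] left_act_def
  proof (intro equalityI subsetI)
    fix z assume "z \<in> (\<lambda>(g, x). (red r k \<otimes>\<^bsub>PL r\<^esub> g, x)) ` {(red r h, y) |h y. h \<in> congr r \<and> \<bar>y\<bar> \<le> real r * q \<and> pt_rel g x h y}"
    then obtain h y where z: "z = (red r (k \<star> h), y)" "h \<in> congr r" "\<bar>y\<bar> \<le> real r * q" "pt_rel g x h y"
      using m by auto
    then have "k \<star> h \<in> congr r" "pt_rel (k \<star> g) x (k \<star> h) y"
      using subgroup.m_closed[OF sg k] pt_rel_left_mult s k g by auto
    then show "z \<in> {(red r h, y) |h y. h \<in> congr r \<and> \<bar>y\<bar> \<le> real r * q \<and> pt_rel (k \<star> g) x h y}"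
      using z by blast
  next
    fix z assume "z \<in> {(red r h, y) |h y. h \<in> congr r \<and> \<bar>y\<bar> \<le> real r * q \<and> pt_rel (k \<star> g) x h y}"
    then obtain h y where z: "z = (red r h, y)" "h \<in> congr r" "\<bar>y\<bar> \<le> real r * q" "pt_rel (k \<star> g) x h y" by auto
    let ?h = "uinv k \<otimes>\<^bsub>unimod\<^esub> h"
    have h': "?h \<in> congr r" using subgroup.m_closed[OF sg subgroup.m_inv_closed[OF sg k] z(2)] .
    have e: "k \<otimes>\<^bsub>unimod\<^esub> ?h = h"
      using s k z(2) by (simp add: unimod.m_assoc[symmetric] del: unimod_simps)
    then have "pt_rel g x ?h y" using z(4) pt_rel_left_mult[of k g ?h x y] s k g h' by simp
    then show "z \<in> (\<lambda>(g, x). (red r k \<otimes>\<^bsub>PL r\<^esub> g, x)) ` {(red r h, y) |h y. h \<in> congr r \<and> \<bar>y\<bar> \<le> real r * q \<and> pt_rel g x h y}"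
      using h' e z m[OF h'] by (intro image_eqI[of _ _ "(red r ?h, y)"]) auto
  qed
qed

section \<open>The ball and its comparison with the local tree\<close>

lemma P0_SL2: "g \<in> carrier P \<Longrightarrow> g \<in> carrier SL" "g \<in> carrier P \<Longrightarrow> g \<in> fixer 0"
  by (simp_all add: P0_carrier)

lemma P0_mult: "g \<in> carrier P \<Longrightarrow> h \<in> carrier P \<Longrightarrow> g \<star> h \<in> carrier P"
  using subgroup.m_closed[OF SL2_subgroup] fixer_mult by (auto simp: P0_carrier)

lemma P0_elem_fix: "elem_fix 0 \<subseteq> carrier P"
  using SL2_elem_fix fixer_elem_fix by (auto simp: P0_carrier)

lemma P0_one: "\<one>\<^bsub>M\<^esub> \<in> carrier P" "\<one>\<^bsub>SL\<^esub> = \<one>\<^bsub>M\<^esub>"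
  using P0_elem_fix by (auto simp: elem_fix_def SL2_eq)

lemma tree_pt_zero:
  assumes "g \<in> carrier P" "h \<in> carrier P"
  shows "tpt g 0 = tpt h 0"
proof -
  have f: "uinv g \<star> h \<in> fixer 0"
    using fixer_mult subgroup.m_inv_closed[OF fixer_subgroup] assms P0_SL2 by blast
  then have "pt_rel g 0 h 0" using pt_rel_integral[OF f] by blast
  then show ?thesis using tree_pt_eq_iff assms P0_SL2 by blast
qed

text \<open>An element g of P_0 fixes the centre, so the centre is also the point 0 of the apartment
  of g, and the metric there gives the distance |x| / qD. Every point has such a representative by
  \<open>pt_rel_to_integral\<close>.\<close>

lemma tree_ball_eq:
  assumes pi: "uniformiser \<omega> (carrier D) \<pi>" and "tree_metric D \<omega> E u d (real_of_ereal (\<omega> \<pi>)) \<delta>"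
  shows "tree_ball D \<omega> E u d \<delta> (real (r * d)) =
    {tpt g x | g x. g \<in> carrier P \<and> x \<in> apt \<pi> r}"
proof -
  let ?o = "tpt \<one>\<^bsub>M\<^esub> 0" and ?pt = "tpt"
  have met: "Metric_space (tree D \<omega> E u d) \<delta>"
    and dist: "\<And>g x y. g \<in> carrier SL \<Longrightarrow> \<delta> (?pt g x) (?pt g y) = \<bar>x - y\<bar> / qD"
    using assms(2) apt_interval_eq(2)[OF pi] by (auto simp: tree_metric_def)
  interpret Metric_space "tree D \<omega> E u d" \<delta> by (rule met)
  have tree: "tree D \<omega> E u d = {?pt g x | g x. g \<in> carrier SL}"
    by (auto simp: tree_def quotient_def tree_pt_def)
  have dP: "\<delta> ?o (?pt g x) \<le> real (r * d) \<longleftrightarrow> x \<in> apt \<pi> r" if "g \<in> carrier P" for g x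
  proof -
    have "\<delta> ?o (?pt g x) = \<bar>x\<bar> / qD"
      using dist[of g 0 x] tree_pt_zero[OF P0_one(1) that] P0_SL2 that by simp
    then have "\<delta> ?o (?pt g x) \<le> real (r * d) \<longleftrightarrow> \<bar>x\<bar> \<le> real r * q"
      unfolding threshold[symmetric] using val_u(3) by (simp only: pos_divide_le_eq)
    then show ?thesis unfolding apt_interval_eq(1)[OF pi] by auto
  qed
  have oT: "?o \<in> tree D \<omega> E u d" using P0_one P0_SL2 unfolding tree by blast
  show ?thesis
    unfolding tree_ball_def mcball_def P0_one(2)
  proof (intro equalityI subsetI)
    fix b assume "b \<in> {y. ?o \<in> tree D \<omega> E u d \<and> y \<in> tree D \<omega> E u d \<and> \<delta> ?o y \<le> real (r * d)}"
    then obtain g x where b: "b = ?pt g x" "g \<in> carrier SL" "\<delta> ?o b \<le> real (r * d)"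
      unfolding tree by blast
    obtain k y where k: "k \<in> elem_fix 0" "pt_rel g x k y"
      using pt_rel_to_integral[OF SL2_unimod[OF b(2)]] .
    then have kP: "k \<in> carrier P" using P0_elem_fix by blast
    then have "b = ?pt k y" using tree_pt_eq_iff[OF b(2), of k x y] k(2) b(1) P0_SL2 by blast
    then show "b \<in> {?pt g x | g x. g \<in> carrier P \<and> x \<in> apt \<pi> r}"
      using b(3) dP[OF kP] kP by blast
  next
    fix b assume "b \<in> {?pt g x | g x. g \<in> carrier P \<and> x \<in> apt \<pi> r}"
    then show "b \<in> {y. ?o \<in> tree D \<omega> E u d \<and> y \<in> tree D \<omega> E u d \<and> \<delta> ?o y \<le> real (r * d)}"
      using dP oT P0_SL2 unfolding tree by blast
  qed
qed

text \<open>Both sides amount to \<open>pt_rel\<close>. One direction gives well-definedness of the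
  map, the other its injectivity. For r = 0 the interval is reduced to 0 and both equations
  hold.\<close>

lemma loc_pt_iff_tree_pt:
  assumes pi: "uniformiser \<omega> (carrier D) \<pi>" and g: "g \<in> carrier P" and h: "h \<in> carrier P"
    and x: "x \<in> apt \<pi> r" and y: "y \<in> apt \<pi> r"
  shows "lpt \<pi> r (red r g) x = lpt \<pi> r (red r h) y \<longleftrightarrow>
    tpt g x = tpt h y"
proof (cases "r = 0")
  case True
  then have "x = 0" "y = 0" using x y unfolding apt_interval_eq(1)[OF pi] by auto
  then show ?thesis using tree_pt_zero[OF g h] True by (simp add: loc_pt_def loc_rel_zero)
next
  case False
  then have r: "0 < r" by simp
  have xy: "\<bar>x\<bar> \<le> real r * q" "\<bar>y\<bar> \<le> real r * q" using x y unfolding apt_interval_eq(1)[OF pi] by auto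
  have "g \<in> congr r" "h \<in> congr r" using g h P0_subset_congr by blast+
  then show ?thesis using loc_pt_eq_iff[OF r _ _ pi xy] tree_pt_eq_iff P0_SL2 g h by simp
qed

text \<open>Surjectivity: dropping the unit diagonal factor on the right of a representative in
  \<open>congr r\<close> may change its reduced norm but not the point, and leaves an element of
  P_0.\<close>

lemma loc_tree_eq:
  assumes pi: "uniformiser \<omega> (carrier D) \<pi>"
  shows "loc_tree D \<omega> E u d \<pi> r =
    {lpt \<pi> r (red r g) x | g x. g \<in> carrier P \<and> x \<in> apt \<pi> r}"
proof -
  have ex: "\<exists>l\<in>carrier P. lpt \<pi> r (red r l) x = lpt \<pi> r (red r g) x"
    if g: "g \<in> congr r" and x: "x \<in> apt \<pi> r" for g x
  proof (cases "r = 0")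
    case True
    then show ?thesis using P0_one(1) by (auto simp: loc_pt_def loc_rel_zero)
  next
    case False
    then have r: "0 < r" by simp
    have x': "\<bar>x\<bar> \<le> real r * q" using x unfolding apt_interval_eq(1)[OF pi] by auto
    obtain l w l' a e where d: "l \<in> elem_fix 0" "w = \<one>\<^bsub>M\<^esub> \<or> w = weyl" "l' \<in> elem_fix 0"
      "a \<in> carrier D" "e \<in> carrier D" "\<omega> a = 0" "\<omega> e = 0" "g = l \<star> w \<star> l' \<star> dia a e"
      using fixer_zero_decomposition[OF congr_fixer(1)[OF r g]] .
    have "weyl \<in> carrier P"
      using SL2_weyl unimod_weyl by (simp add: P0_carrier fixer_iff val_ge_zero_iff)
    then have "w \<in> carrier P" using d(2) P0_one(1) by blast
    then have l: "l \<star> w \<star> l' \<in> carrier P" (is "?l \<in> _")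
      using d P0_elem_fix by (intro P0_mult) auto
    then have "pt_rel ?l x g x"
      unfolding d(8) using d(4-7) SL2_unimod P0_SL2 by (intro pt_rel_unit_dia) auto
    then show ?thesis using loc_pt_eq_iff[OF r _ g pi x' x', of ?l] l P0_subset_congr by blast
  qed
  show ?thesis
  proof (intro equalityI subsetI)
    fix C assume "C \<in> loc_tree D \<omega> E u d \<pi> r"
    then obtain g x where g: "g \<in> congr r" "x \<in> apt \<pi> r" "C = lpt \<pi> r (red r g) x"
      unfolding loc_tree_def quotient_def P0_loc_carrier loc_pt_def by blast
    obtain l where "l \<in> carrier P" "lpt \<pi> r (red r l) x = C" using ex[OF g(1,2)] g(3) by blast
    then show "C \<in> {lpt \<pi> r (red r g) x | g x. g \<in> carrier P \<and> x \<in> apt \<pi> r}"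
      using g(2) by blast
  next
    fix C assume "C \<in> {lpt \<pi> r (red r g) x | g x. g \<in> carrier P \<and> x \<in> apt \<pi> r}"
    then obtain g x where g: "g \<in> carrier P" "x \<in> apt \<pi> r" "C = lpt \<pi> r (red r g) x" by blast
    have "red r g \<in> red r ` congr r" using g(1) P0_subset_congr by blast
    then show "C \<in> loc_tree D \<omega> E u d \<pi> r"
      unfolding loc_tree_def quotient_def P0_loc_carrier g(3) loc_pt_def using g(2) by blast
  qed
qed

lemma left_act_loc_pt_P0:
  assumes pi: "uniformiser \<omega> (carrier D) \<pi>" and k: "k \<in> carrier P" and g: "g \<in> carrier P"
    and x: "x \<in> apt \<pi> r"
  shows "left_act (PL r) (red r k) (lpt \<pi> r (red r g) x) = lpt \<pi> r (red r (k \<star> g)) x"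
proof (cases "r = 0")
  case True
  then show ?thesis by (simp add: loc_pt_def loc_rel_zero left_act_def)
next
  case False
  moreover have "\<bar>x\<bar> \<le> real r * q" using x unfolding apt_interval_eq(1)[OF pi] by auto
  ultimately show ?thesis using left_act_loc_pt[OF _ _ _ pi] k g P0_subset_congr by blast
qed

lemma red_hom: "red r \<in> hom P (PL r)"
proof -
  have "val_ge \<omega> g 0" "g \<in> carrier M" if "g \<in> carrier P" for g
    using P0_SL2[OF that] by (simp_all add: fixer_iff SL2_carrier)
  moreover have "g \<otimes>\<^bsub>P\<^esub> h = g \<star> h" for g h by (simp add: P0_def SL2_def)
  moreover have "red r g \<in> carrier (PL r)" if "g \<in> carrier P" for g
    unfolding P0_loc_carrier using that P0_subset_congr by blast
  ultimately show ?thesis by (simp add: hom_def P0_loc_eq red_mult)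
qed

end

theorem theorem4p22:
  fixes D :: "('a, 'b) ring_scheme" and \<omega> :: "'a \<Rightarrow> ereal"
    and K E :: "'a set" and \<tau> :: "'a \<Rightarrow> 'a" and u \<pi>\<^sub>K \<pi>\<^sub>D :: 'a and d r :: nat
    and \<delta> :: "('a mat2 \<times> real) set \<Rightarrow> ('a mat2 \<times> real) set \<Rightarrow> real"
  assumes "cyclic_local_division_algebra D \<omega> K d E \<tau> u \<pi>\<^sub>K"
    and "uniformiser \<omega> (carrier D) \<pi>\<^sub>D"
    and "tree_metric D \<omega> E u d (real_of_ereal (\<omega> \<pi>\<^sub>D)) \<delta>"
  shows "reduction D \<omega> (r * d) \<in> hom (P0 D \<omega> E u d) (P0_loc D \<omega> E u d r) \<and>
    tree_ball D \<omega> E u d \<delta> (real (r * d)) =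
      {tree_pt D \<omega> E u d g x | g x.
        g \<in> carrier (P0 D \<omega> E u d) \<and> x \<in> apt_interval D \<omega> \<pi>\<^sub>D (r * d)} \<and>
    (\<exists>f.
      (\<forall>g \<in> carrier (P0 D \<omega> E u d). \<forall>x \<in> apt_interval D \<omega> \<pi>\<^sub>D (r * d).
        f (tree_pt D \<omega> E u d g x) = loc_pt D \<omega> E u d \<pi>\<^sub>D r (reduction D \<omega> (r * d) g) x) \<and>
      bij_betw f (tree_ball D \<omega> E u d \<delta> (real (r * d))) (loc_tree D \<omega> E u d \<pi>\<^sub>D r) \<and>
      (\<forall>k \<in> carrier (P0 D \<omega> E u d). \<forall>b \<in> tree_ball D \<omega> E u d \<delta> (real (r * d)).
        left_act (SL2 D E u d) k b \<in> tree_ball D \<omega> E u d \<delta> (real (r * d)) \<and>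
        f (left_act (SL2 D E u d) k b) =
          left_act (P0_loc D \<omega> E u d r) (reduction D \<omega> (r * d) k) (f b)))"
proof -
  interpret cyclic_local_division_algebra D \<omega> K d E \<tau> u \<pi>\<^sub>K by (rule assms(1))
  note pi = assms(2)
  let ?I = "apt_interval D \<omega> \<pi>\<^sub>D (r * d)" and ?pt = "tree_pt D \<omega> E u d"
  let ?loc = "loc_pt D \<omega> E u d \<pi>\<^sub>D r" and ?B = "tree_ball D \<omega> E u d \<delta> (real (r * d))"
  note ball = tree_ball_eq[OF pi assms(3), of r]
  \<comment> \<open>The value is computed from a chosen representative;
    \<open>loc_pt_iff_tree_pt\<close> then shows that the choice is immaterial.\<close>
  define f where "f b = (let z = SOME z. fst z \<in> carrier P \<and> snd z \<in> ?I \<and> b = ?pt (fst z) (snd z)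
    in ?loc (red r (fst z)) (snd z))" for b
  have f: "f (?pt g x) = ?loc (red r g) x" if gx: "g \<in> carrier P" "x \<in> ?I" for g x
  proof -
    define z where "z = (SOME z. fst z \<in> carrier P \<and> snd z \<in> ?I \<and> ?pt g x = ?pt (fst z) (snd z))"
    have "fst z \<in> carrier P \<and> snd z \<in> ?I \<and> ?pt g x = ?pt (fst z) (snd z)"
      unfolding z_def by (rule someI[of _ "(g, x)"]) (use gx in simp)
    then have "?loc (red r (fst z)) (snd z) = ?loc (red r g) x"
      using loc_pt_iff_tree_pt[OF pi, of "fst z" g "snd z" r x] gx by simp
    then show ?thesis by (simp add: f_def z_def Let_def)
  qed
  have "inj_on f ?B"
  proof (rule inj_onI)
    fix b c assume "b \<in> ?B" "c \<in> ?B" and eq: "f b = f c"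
    then obtain g x h y where "b = ?pt g x" "g \<in> carrier P" "x \<in> ?I" "c = ?pt h y" "h \<in> carrier P" "y \<in> ?I"
      unfolding ball by blast
    then show "b = c" using eq f loc_pt_iff_tree_pt[OF pi, of g h x r y] by simp
  qed
  moreover have "f ` ?B = loc_tree D \<omega> E u d \<pi>\<^sub>D r"
  proof (intro equalityI subsetI)
    fix c assume "c \<in> f ` ?B"
    then obtain g x where "g \<in> carrier P" "x \<in> ?I" "c = f (?pt g x)" unfolding ball by blast
    then show "c \<in> loc_tree D \<omega> E u d \<pi>\<^sub>D r" unfolding loc_tree_eq[OF pi] using f by blast
  next
    fix c assume "c \<in> loc_tree D \<omega> E u d \<pi>\<^sub>D r"
    then obtain g x where gx: "g \<in> carrier P" "x \<in> ?I" "c = ?loc (red r g) x"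
      unfolding loc_tree_eq[OF pi] by blast
    then have "c = f (?pt g x)" using f by simp
    moreover have "?pt g x \<in> ?B" unfolding ball using gx by blast
    ultimately show "c \<in> f ` ?B" by blast
  qed
  ultimately have bij: "bij_betw f ?B (loc_tree D \<omega> E u d \<pi>\<^sub>D r)" by (simp add: bij_betw_def)
  have act: "left_act (SL2 D E u d) k b \<in> ?B \<and>
      f (left_act (SL2 D E u d) k b) = left_act (PL r) (red r k) (f b)"
    if k: "k \<in> carrier P" and b: "b \<in> ?B" for k b
  proof -
    obtain g x where gx: "b = ?pt g x" "g \<in> carrier P" "x \<in> ?I" using b unfolding ball by blast
    have kg: "k \<star> g \<in> carrier P" using P0_mult k gx by blast
    have l: "left_act (SL2 D E u d) k b = ?pt (k \<star> g) x"
      unfolding gx(1) using left_act_tree_pt P0_SL2 k gx by blast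
    have "?pt (k \<star> g) x \<in> ?B" unfolding ball using kg gx(3) by blast
    then show ?thesis
      unfolding l unfolding gx(1) f[OF kg gx(3)] f[OF gx(2,3)] left_act_loc_pt_P0[OF pi k gx(2,3)] by simp
  qed
  show ?thesis
    by (intro conjI exI[of _ f] ballI red_hom ball f bij) (use act in blast)+
qed

end
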